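(* Let $q>1$, $\nu\in(0,1]$, $0<T\le\infty$, let $\Omega$ be any domain of $\mathbb{R}^N$, and let $u$ be any nonnegative classical solution (resp. any nonnegative weak solution if $q\le2$) of $$u_t-\nu\Delta u+|\nabla u|^q=0\quad\text{in }Q_{\Omega,T}=\Omega\times(0,T),$$ and let $B(x_0,2\eta)\subset\Omega$. Assume that $u$ has trace $u_0\in L^R_{loc}(\Omega)$ for some $R\ge1$, $R>q-1$, and $u\in C([0,T);L^R_{loc}(\Omega))$. Then for any $\varepsilon>0$ and any $\tau\in(0,T)$, there exists $C=C(N,q,R,\eta,\varepsilon,\tau)$ such that, for all $t\in(0,\tau]$, $$\sup_{B_{\eta/2}}u(\cdot,t)\le C\,t^{-\frac{N}{qR+N(q-1)}}\bigl(t+\|u_0\|_{L^R(B_\eta)}\bigr)^{\frac{Rq}{qR+N(q-1)}}+C\,t^{\frac{1-\varepsilon}{R+1-q}}\,\|u_0\|_{L^R(B_\eta)}^{\frac{R}{R+1-q}},$$ where $B_r=B(x_0,r)$. If $q<2$, the estimates for $R=1$ are also valid when $u$ has a trace $u_0\in\mathcal{M}^+(\Omega)$, with $\|u_0\|_{L^1(B_\eta)}$ replaced by $\int_{B_\eta}du_0$.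
   Context: $\mathcal{M}^+(\Omega)$ is the set of nonnegative Radon measures on $\Omega$. $C=C(\dots)$ means that the constant depends only on the listed quantities (in particular not on $\nu$ nor $u$). A classical solution is a nonnegative $u\in C^{2,1}(Q_{\Omega,T})$ satisfying the equation pointwise. A nonnegative function $u$ is a weak solution if $u\in C((0,T);L^1_{loc}(\Omega))\cap L^1_{loc}((0,T);W^{1,1}_{loc}(\Omega))$, $|\nabla u|^q\in L^1_{loc}(Q_{\Omega,T})$, and $\int_0^T\int_\Omega(-u\varphi_t-\nu u\Delta\varphi+|\nabla u|^q\varphi)\,dx\,dt=0$ for all $\varphi\in\mathcal{D}(Q_{\Omega,T})$. $u$ has a trace $u_0\in\mathcal{M}^+(\Omega)$ if $\lim_{t\to0}\int_\Omega u(\cdot,t)\psi\,dx=\int_\Omega\psi\,du_0$ for all $\psi\in C_c(\Omega)$; functions in $L^1_{loc}(\Omega)$ are identified with measures, and when $u\in C([0,T);L^R_{loc}(\Omega))$, $u(\cdot,0)=u_0$. *)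

theory Defs
  imports "HOL-Analysis.Analysis" "HOL-Probability.Essential_Supremum"
begin

text \<open>
  Points of the space-time cylinder are pairs \<open>(x, t)\<close> in \<open>'a \<times> real\<close>, where \<open>'a\<close> is a Euclidean
  space playing the role of \<open>\<real>\<^sup>N\<close> with \<open>N = DIM('a)\<close>.
  The final time is an \<open>ereal\<close>, so that \<open>T = \<infinity>\<close> is allowed.
\<close>

definition cylinder :: "'a set \<Rightarrow> ereal \<Rightarrow> ('a \<times> real) set" where
  "cylinder \<Omega> T = \<Omega> \<times> {t. 0 < t \<and> ereal t < T}"

subsection \<open>Classical partial derivatives, test functions\<close>

definition pderivative :: "'b::real_normed_vector \<Rightarrow> ('b \<Rightarrow> real) \<Rightarrow> 'b \<Rightarrow> real" where
  "pderivative v f z = deriv (\<lambda>h. f (z + h *\<^sub>R v)) 0"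

definition C1_along :: "'b::real_normed_vector \<Rightarrow> 'b set \<Rightarrow> ('b \<Rightarrow> real) \<Rightarrow> bool" where
  "C1_along v S f \<longleftrightarrow>
     (\<forall>z\<in>S. (\<lambda>h. f (z + h *\<^sub>R v)) field_differentiable (at 0)) \<and>
     continuous_on S (pderivative v f)"

definition C21_on :: "('a::euclidean_space \<times> real) set \<Rightarrow> ('a \<times> real \<Rightarrow> real) \<Rightarrow> bool" where
  "C21_on Q u \<longleftrightarrow>
     continuous_on Q u \<and> C1_along (0, 1) Q u \<and>
     (\<forall>i\<in>Basis. C1_along (i, 0) Q u \<and>
        (\<forall>j\<in>Basis. C1_along (j, 0) Q (pderivative (i, 0) u)))"

definition grad_x :: "('a::euclidean_space \<times> real \<Rightarrow> real) \<Rightarrow> 'a \<times> real \<Rightarrow> 'a" where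
  "grad_x u z = (\<Sum>i\<in>Basis. pderivative (i, 0) u z *\<^sub>R i)"

definition laplacian_x :: "('a::euclidean_space \<times> real \<Rightarrow> real) \<Rightarrow> 'a \<times> real \<Rightarrow> real" where
  "laplacian_x u z = (\<Sum>i\<in>Basis. pderivative (i, 0) (pderivative (i, 0) u) z)"

definition smooth :: "('b::euclidean_space \<Rightarrow> real) \<Rightarrow> bool" where
  "smooth f \<longleftrightarrow> continuous_on UNIV f \<and>
     (\<forall>vs. set vs \<subseteq> Basis \<longrightarrow> (\<forall>v\<in>Basis. C1_along v UNIV (foldr pderivative vs f)))"

text \<open>Compactly supported functions on an open set \<open>S\<close> are extended by zero to the whole space.\<close>

definition supported_in :: "'b::topological_space set \<Rightarrow> ('b \<Rightarrow> real) \<Rightarrow> bool" where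
  "supported_in S f \<longleftrightarrow> (\<exists>K. compact K \<and> K \<subseteq> S \<and> (\<forall>x. x \<notin> K \<longrightarrow> f x = 0))"

definition test_functions :: "'b::euclidean_space set \<Rightarrow> ('b \<Rightarrow> real) set" where
  "test_functions S = {\<phi>. smooth \<phi> \<and> supported_in S \<phi>}"

definition Cc :: "'b::euclidean_space set \<Rightarrow> ('b \<Rightarrow> real) set" where
  "Cc S = {\<psi>. continuous_on UNIV \<psi> \<and> supported_in S \<psi>}"

subsection \<open>Local Lebesgue spaces and weak gradients\<close>

definition loc_integrable ::
    "'b::euclidean_space set \<Rightarrow> ('b \<Rightarrow> 'c::{banach, second_countable_topology}) \<Rightarrow> bool" where
  "loc_integrable S f \<longleftrightarrow> (\<forall>K. compact K \<and> K \<subseteq> S \<longrightarrow> integrable (lebesgue_on K) f)"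

definition Lp_loc :: "real \<Rightarrow> 'b::euclidean_space set \<Rightarrow> ('b \<Rightarrow> real) set" where
  "Lp_loc p S = {f. \<forall>K. compact K \<and> K \<subseteq> S \<longrightarrow>
     f \<in> borel_measurable (lebesgue_on K) \<and> integrable (lebesgue_on K) (\<lambda>x. \<bar>f x\<bar> powr p)}"

definition Lp_norm :: "real \<Rightarrow> 'b::euclidean_space set \<Rightarrow> ('b \<Rightarrow> real) \<Rightarrow> real" where
  "Lp_norm p S f = (LINT x|lebesgue_on S. \<bar>f x\<bar> powr p) powr (1 / p)"

text \<open>\<open>u \<in> C(I; L\<^sup>p\<^sub>l\<^sub>o\<^sub>c(S))\<close>\<close>

definition continuous_into_Lp_loc ::
    "real set \<Rightarrow> real \<Rightarrow> 'a::euclidean_space set \<Rightarrow> ('a \<times> real \<Rightarrow> real) \<Rightarrow> bool" where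
  "continuous_into_Lp_loc I p S u \<longleftrightarrow>
     (\<forall>t\<in>I. (\<lambda>x. u (x, t)) \<in> Lp_loc p S) \<and>
     (\<forall>K. compact K \<and> K \<subseteq> S \<longrightarrow> (\<forall>s\<in>I.
        ((\<lambda>t. Lp_norm p K (\<lambda>x. u (x, t) - u (x, s))) \<longlongrightarrow> 0) (at s within I)))"

text \<open>\<open>f \<in> W\<^sup>1\<^sup>,\<^sup>1\<^sub>l\<^sub>o\<^sub>c(\<Omega>)\<close> with distributional gradient \<open>g\<close>\<close>

definition weak_gradient ::
    "'a::euclidean_space set \<Rightarrow> ('a \<Rightarrow> real) \<Rightarrow> ('a \<Rightarrow> 'a) \<Rightarrow> bool" where
  "weak_gradient \<Omega> f g \<longleftrightarrow> loc_integrable \<Omega> f \<and> loc_integrable \<Omega> g \<and>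
     (\<forall>\<phi>\<in>test_functions \<Omega>. \<forall>i\<in>Basis.
        (LINT x|lebesgue_on \<Omega>. f x * pderivative i \<phi> x) =
        - (LINT x|lebesgue_on \<Omega>. (g x \<bullet> i) * \<phi> x))"

text \<open>
  \<open>u \<in> L\<^sup>1\<^sub>l\<^sub>o\<^sub>c((0,T); W\<^sup>1\<^sup>,\<^sup>1\<^sub>l\<^sub>o\<^sub>c(\<Omega>))\<close> with spatial gradient \<open>g\<close>: every compact subset of the cylinder lies
  in a product of compact sets, so local integrability of \<open>t \<mapsto> \<parallel>u(t)\<parallel>\<close> in \<open>W\<^sup>1\<^sup>,\<^sup>1\<^sub>l\<^sub>o\<^sub>c(\<Omega>)\<close> is local
  integrability of \<open>u\<close> and \<open>g\<close> on the cylinder.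
\<close>

definition L1_loc_W11_loc ::
    "'a::euclidean_space set \<Rightarrow> ereal \<Rightarrow> ('a \<times> real \<Rightarrow> real) \<Rightarrow> ('a \<times> real \<Rightarrow> 'a) \<Rightarrow> bool" where
  "L1_loc_W11_loc \<Omega> T u g \<longleftrightarrow>
     loc_integrable (cylinder \<Omega> T) u \<and> loc_integrable (cylinder \<Omega> T) g \<and>
     (AE t in lebesgue_on {t. 0 < t \<and> ereal t < T}.
        weak_gradient \<Omega> (\<lambda>x. u (x, t)) (\<lambda>x. g (x, t)))"

subsection \<open>Nonnegative solutions of \<open>u\<^sub>t - \<nu> \<Delta>u + |\<nabla>u|\<^sup>q = 0\<close>\<close>

definition classical_solution ::
    "real \<Rightarrow> real \<Rightarrow> 'a::euclidean_space set \<Rightarrow> ereal \<Rightarrow> ('a \<times> real \<Rightarrow> real) \<Rightarrow> bool" where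
  "classical_solution \<nu> q \<Omega> T u \<longleftrightarrow>
     C21_on (cylinder \<Omega> T) u \<and>
     (\<forall>z\<in>cylinder \<Omega> T. 0 \<le> u z) \<and>
     (\<forall>z\<in>cylinder \<Omega> T.
        pderivative (0, 1) u z - \<nu> * laplacian_x u z + norm (grad_x u z) powr q = 0)"

definition weak_solution ::
    "real \<Rightarrow> real \<Rightarrow> 'a::euclidean_space set \<Rightarrow> ereal \<Rightarrow> ('a \<times> real \<Rightarrow> real) \<Rightarrow> bool" where
  "weak_solution \<nu> q \<Omega> T u \<longleftrightarrow>
     (AE z in lebesgue_on (cylinder \<Omega> T). 0 \<le> u z) \<and>
     continuous_into_Lp_loc {t. 0 < t \<and> ereal t < T} 1 \<Omega> u \<and>
     (\<exists>g. L1_loc_W11_loc \<Omega> T u g \<and>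
        loc_integrable (cylinder \<Omega> T) (\<lambda>z. norm (g z) powr q) \<and>
        (\<forall>\<phi>\<in>test_functions (cylinder \<Omega> T).
           (LINT z|lebesgue_on (cylinder \<Omega> T).
              - u z * pderivative (0, 1) \<phi> z - \<nu> * u z * laplacian_x \<phi> z
              + norm (g z) powr q * \<phi> z) = 0))"

subsection \<open>Initial trace\<close>

definition radon_measure_on :: "'a::euclidean_space set \<Rightarrow> 'a measure \<Rightarrow> bool" where
  "radon_measure_on \<Omega> \<mu> \<longleftrightarrow>
     sets \<mu> = sets (restrict_space borel \<Omega>) \<and>
     (\<forall>K. compact K \<and> K \<subseteq> \<Omega> \<longrightarrow> emeasure \<mu> K < \<infinity>) \<and>
     (\<forall>A\<in>sets \<mu>. emeasure \<mu> A = (SUP K\<in>{K. compact K \<and> K \<subseteq> A}. emeasure \<mu> K))"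

text \<open>The measure with which a nonnegative function in \<open>L\<^sup>1\<^sub>l\<^sub>o\<^sub>c(\<Omega>)\<close> is identified\<close>

definition fun_measure :: "'a::euclidean_space set \<Rightarrow> ('a \<Rightarrow> real) \<Rightarrow> 'a measure" where
  "fun_measure \<Omega> f = density (lebesgue_on \<Omega>) (\<lambda>x. ennreal (f x))"

definition has_initial_trace ::
    "'a::euclidean_space set \<Rightarrow> ('a \<times> real \<Rightarrow> real) \<Rightarrow> 'a measure \<Rightarrow> bool" where
  "has_initial_trace \<Omega> u \<mu> \<longleftrightarrow>
     (\<forall>\<psi>\<in>Cc \<Omega>. ((\<lambda>t. LINT x|lebesgue_on \<Omega>. u (x, t) * \<psi> x) \<longlongrightarrow> (LINT x|\<mu>. \<psi> x)) (at_right 0))"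

subsection \<open>The right-hand side of the estimate\<close>

text \<open>\<open>m\<close> stands for the size of the initial trace on the ball of radius \<open>\<eta>\<close>.\<close>

definition decay_bound ::
    "real \<Rightarrow> real \<Rightarrow> real \<Rightarrow> real \<Rightarrow> real \<Rightarrow> real \<Rightarrow> real \<Rightarrow> real" where
  "decay_bound N q R \<epsilon> C t m =
     C * t powr (- (N / (q * R + N * (q - 1)))) *
       (t + m) powr (R * q / (q * R + N * (q - 1))) +
     C * t powr ((1 - \<epsilon>) / (R + 1 - q)) * m powr (R / (R + 1 - q))"

end

theory Submission
  imports Defs "HOL-Probability.Distributions"
begin

text \<open>
  The estimate comes from a duality argument that is linear in the solution. With \<open>q' = q / (q - 1)\<close>,
  Young's inequality gives \<open>- |p|^q \<le> - p \<bullet> b + |b|^q'\<close> for every vector \<open>b\<close>, so a subsolution \<open>w\<close>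
  satisfies \<open>w_t \<le> \<nu> \<Delta>w - b \<bullet> \<nabla>w + |b|^q'\<close> for every drift \<open>b\<close> that one cares to choose. In the
  language of control, \<open>w (x, t)\<close> is at most the mean of the initial data along a diffusion that starts
  at \<open>x\<close> and is steered by \<open>b\<close>, plus the running cost \<open>|b|^q'\<close>. Equivalently, \<open>w\<close> is integrated against
  a density that evolves by \<open>\<phi>_t + \<nu> \<Delta>\<phi> + div (b \<phi>) = 0\<close> (\<open>duality_step\<close>). Two kinds of drift are used.

  A drift \<open>- \<nu> \<nabla>\<zeta> / \<zeta>\<close> keeps the diffusion inside the support of a cutoff \<open>\<zeta>\<close>. It costs a bounded
  amount per unit of time, because \<open>|\<nabla>\<zeta>|^q'\<close> is controlled by \<open>\<zeta>^(q' - 1)\<close>. This localises the problem,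
  uniformly in \<open>\<nu> \<le> 1\<close>, and bounds the mass in a ball by \<open>C (m + t)\<close>, where \<open>m\<close> is the size of the
  initial data (\<open>local_mass_bound\<close>).

  A drift that spreads a Gaussian to width \<open>r\<close> during a time \<open>t\<close> costs \<open>r^q' t^(1 - q')\<close> and makes the
  density at the initial time at most \<open>r^(-N)\<close>. The pure diffusion is left untouched near the final
  point, so the cost stays finite for every \<open>q > 1\<close> (\<open>local_pointwise_bound\<close>). Hence, for every
  \<open>r \<le> \<eta>\<close>, \<open>w (x, t) \<le> C (r^(-N/R) (m + t) + r^q' t^(1 - q'))\<close> (\<open>subsolution_bound\<close>).

  The two terms balance at one value of \<open>r\<close>, which produces the first term of the bound. When that value
  exceeds \<open>\<eta>\<close>, the choice \<open>r = \<eta>\<close> yields a multiple of \<open>m + t\<close> while \<open>(m + t)^(q - 1) t\<close> is bounded from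
  below, and then \<open>m + t\<close> is dominated by one of the two terms (\<open>decay_bound_optimize\<close>). The loss \<open>\<epsilon>\<close> in
  the exponent only costs a factor \<open>\<tau>^\<epsilon>\<close>, since \<open>t \<le> \<tau>\<close>.

  Since \<open>|p|^q\<close> is convex, the mollification of a weak solution is a smooth subsolution
  (\<open>weak_solution_mollified\<close>), so both kinds of solution are treated by the same bound. The mollified
  bound, integrated against a test function, passes to the limit (\<open>weak_solution_tested_bound\<close>). The
  initial data enter only through the local \<open>L^R\<close> norm at small times (\<open>initial_bound\<close>), which both
  notions of trace control.
\<close>

section \<open>Integration by parts for compactly supported functions\<close>

lemma integrable_continuous_compact_support:
  fixes f :: "'a::euclidean_space \<Rightarrow> real"
  assumes "continuous_on UNIV f" "compact K" "\<And>x. x \<notin> K \<Longrightarrow> f x = 0"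
  shows "integrable lborel f"
proof -
  have "f = (\<lambda>x. indicator K x *\<^sub>R f x)"
    using assms(3) by (auto simp: indicator_def fun_eq_iff)
  with borel_integrable_compact[OF assms(2) continuous_on_subset[OF assms(1)]] show ?thesis
    by (metis subset_UNIV)
qed

text \<open>
  Products of a cutoff with a function that is regular only on \<open>U\<close> are treated as functions on the
  whole space.
\<close>

lemma continuous_on_extend_by_zero:
  fixes f :: "'a::metric_space \<times> 'b::metric_space \<Rightarrow> real"
  assumes "open U" "closed C" "C \<subseteq> U" "continuous_on (U \<times> T) f"
    "\<And>x t. t \<in> T \<Longrightarrow> x \<notin> C \<Longrightarrow> f (x, t) = 0"
  shows "continuous_on (UNIV \<times> T) f"
proof -
  have eq: "UNIV \<times> T = U \<times> T \<union> (- C) \<times> T" using assms(3) by auto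
  have "continuous_on ((- C) \<times> T) f"
    by (rule continuous_on_eq[of _ "\<lambda>_. 0"]) (auto simp: assms(5))
  moreover have "openin (top_of_set (UNIV \<times> T)) (U \<times> T)"
    using assms(1) by (auto simp: openin_open intro!: exI[of _ "U \<times> UNIV"] open_Times)
  moreover have "openin (top_of_set (UNIV \<times> T)) ((- C) \<times> T)"
    using assms(2) by (auto simp: openin_open open_Compl intro!: exI[of _ "(- C) \<times> UNIV"] open_Times)
  ultimately show ?thesis
    using continuous_on_Un_local_open[of "U \<times> T" "(- C) \<times> T" f] assms(4) eq by simp
qed

lemma has_field_derivative_translate:
  fixes f :: "'a::real_normed_vector \<Rightarrow> real"
  assumes "\<And>y. ((\<lambda>h. f (y + h *\<^sub>R i)) has_field_derivative f' y) (at 0)"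
  shows "((\<lambda>h. f (y + h *\<^sub>R i)) has_field_derivative f' (y + h *\<^sub>R i)) (at h)"
proof -
  have "((\<lambda>k. f ((y + h *\<^sub>R i) + k *\<^sub>R i)) has_field_derivative f' (y + h *\<^sub>R i)) (at (0::real))"
    by (rule assms)
  then have "((\<lambda>k. f (y + (h + k) *\<^sub>R i)) has_field_derivative f' (y + h *\<^sub>R i)) (at (0::real))"
    by (simp add: algebra_simps)
  then show ?thesis
    by (subst DERIV_shift[of _ _ 0 h, simplified]) (simp add: add.commute)
qed

text \<open>
  Translation invariance makes the integral of every difference quotient of \<open>f\<close> vanish, and the
  quotients converge dominatedly to \<open>f'\<close>. This replaces Fubini and the one-dimensional fundamental
  theorem.
\<close>

lemma integral_directional_derivative_eq_0:
  fixes f f' :: "'a::euclidean_space \<Rightarrow> real"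
  assumes der: "\<And>y. ((\<lambda>h. f (y + h *\<^sub>R i)) has_field_derivative f' y) (at 0)"
    and cf: "continuous_on UNIV f" and cf': "continuous_on UNIV f'"
    and K: "compact K" "\<And>y. y \<notin> K \<Longrightarrow> f y = 0"
  shows "integral\<^sup>L lborel f' = 0"
proof -
  obtain r0 where r0: "K \<subseteq> cball 0 r0"
    using compact_imp_bounded[OF K(1)] unfolding bounded_iff by (auto simp: subset_iff)
  \<comment> \<open>Large enough that all difference quotients with step at most 1 are supported in \<open>B\<close>.\<close>
  define r where "r = max 0 r0 + norm i + 1"
  define B where "B = cball (0::'a) (r + norm i)"
  have supp: "f y = 0" if "norm y > max 0 r0" for y
  proof -
    have "y \<notin> K" using that r0 by (auto simp: subset_iff)
    then show ?thesis by (rule K(2))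
  qed
  have supp': "f' y = 0" if "norm y > max 0 r0" for y
  proof -
    have "eventually (\<lambda>h. norm (y + h *\<^sub>R i) > max 0 r0) (nhds (0::real))"
    proof -
      have "((\<lambda>h. norm (y + h *\<^sub>R i)) \<longlongrightarrow> norm (y + 0 *\<^sub>R i)) (nhds (0::real))"
        by (intro tendsto_intros filterlim_ident)
      from order_tendstoD(1)[OF this, of "max 0 r0"] that show ?thesis by simp
    qed
    then have "eventually (\<lambda>h. f (y + h *\<^sub>R i) = 0) (nhds (0::real))"
      by eventually_elim (rule supp)
    from DERIV_cong_ev[OF refl this refl, THEN iffD1, OF der[of y]] show ?thesis
      by (metis DERIV_const DERIV_unique)
  qed
  have "compact (f' ` B)" using cf' by (intro compact_continuous_image) (auto simp: B_def intro: continuous_on_subset)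
  then obtain M where M: "\<And>y. y \<in> B \<Longrightarrow> \<bar>f' y\<bar> \<le> M"
    using compact_imp_bounded[of "f' ` B"] unfolding bounded_iff by auto
  have M': "\<bar>f' y\<bar> \<le> max M 0" for y
  proof (cases "y \<in> B")
    case False
    then have "norm y > max 0 r0" unfolding B_def r_def by auto (smt (verit) norm_ge_zero)+
    then show ?thesis using supp' by simp
  qed (use M[of y] in auto)
  define d where "d n y = (f (y + (1 / real (Suc n)) *\<^sub>R i) - f y) / (1 / real (Suc n))" for n y
  have fi: "integrable lborel f" by (rule integrable_continuous_compact_support[OF cf K])
  have fs: "integrable lborel (\<lambda>y. f (y + c *\<^sub>R i))" "(LINT y|lborel. f (y + c *\<^sub>R i)) = integral\<^sup>L lborel f" for c
  proof -
    have "integrable (distr lborel borel ((+) (c *\<^sub>R i))) f" using fi by (simp add: lborel_distr_plus)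
    then show "integrable lborel (\<lambda>y. f (y + c *\<^sub>R i))"
      by (subst (asm) integrable_distr_eq) (auto simp: add.commute borel_measurable_continuous_onI[OF cf])
    have "integral\<^sup>L lborel f = integral\<^sup>L (distr lborel borel ((+) (c *\<^sub>R i))) f" by (simp add: lborel_distr_plus)
    also have "\<dots> = (LINT y|lborel. f (y + c *\<^sub>R i))"
      by (subst integral_distr) (auto simp: add.commute borel_measurable_continuous_onI[OF cf])
    finally show "(LINT y|lborel. f (y + c *\<^sub>R i)) = integral\<^sup>L lborel f" by simp
  qed
  have d0: "integral\<^sup>L lborel (d n) = 0" for n
    unfolding d_def using fs fi by (simp del: of_nat_Suc)
  have dbound: "\<bar>d n y\<bar> \<le> max M 0 * indicator B y" for n y
  proof (cases "y \<in> B")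
    case True
    define h where "h = 1 / real (Suc n)"
    have h: "h > 0" unfolding h_def by simp
    have "\<exists>z>0. z < h \<and> f (y + h *\<^sub>R i) - f (y + 0 *\<^sub>R i) = (h - 0) * f' (y + z *\<^sub>R i)"
      by (rule MVT2[OF h]) (auto intro: has_field_derivative_translate[OF der])
    then obtain z where "f (y + h *\<^sub>R i) - f y = h * f' (y + z *\<^sub>R i)" by auto
    then have "d n y = f' (y + z *\<^sub>R i)" unfolding d_def h_def[symmetric] using h by simp
    then show ?thesis using M' True by simp
  next
    case False
    have "norm ((1 / real (Suc n)) *\<^sub>R i) \<le> norm i"
      using mult_left_le_one_le[of "norm i" "1 / real (Suc n)"] by simp
    moreover have "norm y > r + norm i" using False by (auto simp: B_def)
    moreover have "norm (y + (1 / real (Suc n)) *\<^sub>R i) \<ge> norm y - norm ((1 / real (Suc n)) *\<^sub>R i)"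
      by (rule norm_diff_ineq)
    ultimately have "f (y + (1 / real (Suc n)) *\<^sub>R i) = 0" "f y = 0"
      using norm_ge_zero[of i] unfolding r_def by (intro supp; linarith)+
    then show ?thesis by (simp add: d_def False)
  qed
  have "(\<lambda>n. integral\<^sup>L lborel (d n)) \<longlonglongrightarrow> integral\<^sup>L lborel f'"
  proof (rule integral_dominated_convergence[where w="\<lambda>y. max M 0 * indicator B y"])
    show "f' \<in> borel_measurable lborel" using borel_measurable_continuous_onI[OF cf'] by simp
    show "d n \<in> borel_measurable lborel" for n unfolding d_def using fs(1) fi by (intro borel_measurable_integrable) auto
    show "integrable lborel (\<lambda>y. max M 0 * indicator B y)"
      using emeasure_bounded_finite[OF bounded_cball, of "0::'a" "r + norm i"]
      by (intro integrable_mult_right integrable_real_indicator) (auto simp: B_def)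
    show "AE y in lborel. (\<lambda>n. d n y) \<longlonglongrightarrow> f' y"
    proof (rule AE_I2)
      fix y
      have "((\<lambda>h. (f (y + h *\<^sub>R i) - f y) / h) \<longlongrightarrow> f' y) (at 0)"
        using der[of y] by (simp add: has_field_derivative_iff)
      moreover have "filterlim (\<lambda>n. 1 / real (Suc n)) (at 0) sequentially"
        unfolding filterlim_at using LIMSEQ_inverse_real_of_nat by (auto simp: inverse_eq_divide)
      ultimately show "(\<lambda>n. d n y) \<longlonglongrightarrow> f' y" unfolding d_def by (rule filterlim_compose)
    qed
    show "AE y in lborel. norm (d n y) \<le> max M 0 * indicator B y" for n using dbound by simp
  qed
  moreover have "(\<lambda>n. integral\<^sup>L lborel (d n)) \<longlonglongrightarrow> 0" by (simp add: d0)
  ultimately show ?thesis using LIMSEQ_unique by blast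
qed

section \<open>The heat kernel\<close>

definition heat_kernel :: "real \<Rightarrow> 'a::euclidean_space \<Rightarrow> real" where
  "heat_kernel s y = (4 * pi * s) powr (- (DIM('a) / 2)) * exp (- (y \<bullet> y) / (4 * s))"

lemma heat_kernel_pos: "0 < s \<Longrightarrow> 0 < heat_kernel s y"
  by (simp add: heat_kernel_def)

lemma heat_kernel_integral:
  assumes s: "0 < s"
  shows "integrable lborel (heat_kernel s :: 'a::euclidean_space \<Rightarrow> real)"
    and "integral\<^sup>L lborel (heat_kernel s :: 'a \<Rightarrow> real) = 1"
proof -
  have eq: "heat_kernel s y = (\<Prod>b\<in>Basis. normal_density 0 (sqrt (2 * s)) (y \<bullet> b))" for y :: 'a
  proof -
    have "(\<Prod>b\<in>(Basis::'a set). normal_density 0 (sqrt (2 * s)) (y \<bullet> b)) =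
        (\<Prod>b\<in>(Basis::'a set). ((4 * pi * s) powr (- (1/2))) * exp (- (y \<bullet> b)\<^sup>2 / (4 * s)))"
      using s by (intro prod.cong) (auto simp: normal_density_def powr_minus powr_half_sqrt inverse_eq_divide)
    also have "\<dots> = ((4 * pi * s) powr (- (1/2))) ^ DIM('a) * exp (\<Sum>b\<in>(Basis::'a set). - (y \<bullet> b)\<^sup>2 / (4 * s))"
      by (simp add: prod.distrib exp_sum)
    also have "(\<Sum>b\<in>(Basis::'a set). - (y \<bullet> b)\<^sup>2 / (4 * s)) = - (y \<bullet> y) / (4 * s)"
      by (subst euclidean_inner) (simp add: sum_negf sum_divide_distrib power2_eq_square)
    also have "((4 * pi * s) powr (- (1/2))) ^ DIM('a) = (4 * pi * s) powr (- (DIM('a) / 2))"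
      using s by (subst powr_realpow[symmetric]) (auto simp: powr_powr)
    finally show ?thesis by (simp add: heat_kernel_def)
  qed
  have "(\<integral>\<^sup>+ y. ennreal (heat_kernel s (y::'a)) \<partial>lborel) =
      (\<integral>\<^sup>+ y. (\<Prod>b\<in>Basis. ennreal (normal_density 0 (sqrt (2 * s)) (y \<bullet> b))) \<partial>(lborel::'a measure))"
    by (simp add: eq prod_ennreal)
  also have "\<dots> = (\<Prod>b\<in>(Basis::'a set). \<integral>\<^sup>+ x. ennreal (normal_density 0 (sqrt (2 * s)) x) \<partial>lborel)"
    by (rule nn_integral_lborel_prod) auto
  also have "\<dots> = 1"
    using s by (subst nn_integral_eq_integral) (auto simp: integrable_normal_density integral_normal_density)
  finally have nn: "(\<integral>\<^sup>+ y. ennreal (heat_kernel s (y::'a)) \<partial>lborel) = 1" .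
  have m: "heat_kernel s \<in> borel_measurable (borel :: 'a measure)"
    unfolding heat_kernel_def by measurable
  show "integrable lborel (heat_kernel s :: 'a \<Rightarrow> real)"
    using nn m s by (intro integrableI_nonneg) (auto simp: heat_kernel_pos less_imp_le)
  show "integral\<^sup>L lborel (heat_kernel s :: 'a \<Rightarrow> real) = 1"
    using nn m s by (subst integral_eq_nn_integral) (auto simp: heat_kernel_pos less_imp_le)
qed

lemma heat_kernel_shift:
  fixes x :: "'a::euclidean_space"
  assumes s: "0 < s"
  shows "integrable lborel (\<lambda>y. heat_kernel s (y - x))"
    and "(LINT y|lborel. heat_kernel s (y - x)) = 1"
proof -
  have m: "heat_kernel s \<in> borel_measurable (borel :: 'a measure)"
    unfolding heat_kernel_def by measurable
  have m': "(\<lambda>y. heat_kernel s (y - x)) \<in> borel_measurable (borel :: 'a measure)"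
    using m by measurable
  have e: "distr lborel borel (\<lambda>y. y - x) = lborel"
  proof -
    have "(\<lambda>y. y - x) = (+) (- x)" by auto
    then show ?thesis using lborel_distr_plus[of "- x"] by simp
  qed
  show "integrable lborel (\<lambda>y. heat_kernel s (y - x))"
    using heat_kernel_integral(1)[OF s, where 'a='a] m
    by (subst (asm) e[symmetric], subst (asm) integrable_distr_eq) auto
  show "(LINT y|lborel. heat_kernel s (y - x)) = 1"
    using heat_kernel_integral(2)[OF s, where 'a='a] m
    by (subst (asm) e[symmetric], subst (asm) integral_distr) auto
qed

lemma heat_kernel_deriv_space:
  assumes "i \<in> Basis" and s: "s \<noteq> 0"
  shows "((\<lambda>h. heat_kernel s (y + h *\<^sub>R i)) has_field_derivative
      (- (y \<bullet> i) / (2 * s) * heat_kernel s y)) (at 0)"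
proof -
  have i: "i \<bullet> i = 1" using assms by (simp add: inner_Basis)
  show ?thesis
    unfolding heat_kernel_def using s
    by (auto intro!: derivative_eq_intros simp: inner_add_left inner_add_right i inner_commute[of i y] field_simps)
qed

lemma heat_kernel_deriv_space2:
  assumes "i \<in> Basis" and s: "s \<noteq> 0"
  shows "((\<lambda>h. - ((y + h *\<^sub>R i) \<bullet> i) / (2 * s) * heat_kernel s (y + h *\<^sub>R i)) has_field_derivative
      (((y \<bullet> i)\<^sup>2 / (4 * s\<^sup>2) - 1 / (2 * s)) * heat_kernel s y)) (at 0)"
proof -
  have i: "i \<bullet> i = 1" using assms by (simp add: inner_Basis)
  have "((\<lambda>h. (- ((y + h *\<^sub>R i) \<bullet> i) / (2 * s)) * heat_kernel s (y + h *\<^sub>R i)) has_field_derivative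
      (- 1 / (2 * s)) * heat_kernel s (y + 0 *\<^sub>R i) + (- (y \<bullet> i) / (2 * s) * heat_kernel s y) * (- ((y + 0 *\<^sub>R i) \<bullet> i) / (2 * s))) (at 0)"
    by (rule DERIV_mult[OF _ heat_kernel_deriv_space[OF assms]])
       (use s in \<open>auto intro!: derivative_eq_intros simp: inner_add_left i\<close>)
  then show ?thesis by (rule DERIV_cong) (auto simp: power2_eq_square algebra_simps)
qed

text \<open>
  The sum on the right is the Laplacian, by \<open>heat_kernel_deriv_space2\<close>: this is the heat equation.
\<close>

lemma heat_kernel_deriv_time:
  fixes y :: "'a::euclidean_space"
  assumes s: "0 < s"
  shows "((\<lambda>s. heat_kernel s y) has_field_derivative
      (\<Sum>i\<in>Basis. ((y \<bullet> i)\<^sup>2 / (4 * s\<^sup>2) - 1 / (2 * s)) * heat_kernel s y)) (at s)"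
proof -
  have sum: "(\<Sum>i\<in>Basis. ((y \<bullet> i)\<^sup>2 / (4 * s\<^sup>2) - 1 / (2 * s)) * heat_kernel s y)
      = ((y \<bullet> y) / (4 * s\<^sup>2) - DIM('a) / (2 * s)) * heat_kernel s y"
    by (subst euclidean_inner)
       (simp add: sum_distrib_right[symmetric] sum_subtractf sum_divide_distrib power2_eq_square)
  have p: "((\<lambda>s. (4 * pi * s) powr (- (DIM('a) / 2))) has_field_derivative
      - (DIM('a) / 2) * (4 * pi * s) powr (- (DIM('a) / 2) - 1) * (4 * pi)) (at s)"
    using s by (auto intro!: derivative_eq_intros simp: field_simps)
  have e: "((\<lambda>s. exp (- (y \<bullet> y) / (4 * s))) has_field_derivative
      exp (- (y \<bullet> y) / (4 * s)) * ((y \<bullet> y) / (4 * s\<^sup>2))) (at s)"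
    using s by (auto intro!: derivative_eq_intros simp: field_simps power2_eq_square)
  have "(4 * pi * s) powr (- (DIM('a) / 2) - 1) = (4 * pi * s) powr (- (DIM('a) / 2)) / (4 * pi * s)"
    using s by (simp add: powr_diff)
  then show ?thesis
    unfolding sum unfolding heat_kernel_def
    using s by (intro DERIV_cong[OF DERIV_mult[OF p e]]) (simp add: field_simps power2_eq_square)
qed

text \<open>
  Exponentials absorb powers; all Gaussian estimates below are instances.
\<close>

lemma powr_le_exp:
  fixes k :: real
  assumes "0 \<le> k"
  shows "\<exists>C>0. \<forall>z\<ge>0. z powr k \<le> C * exp z"
proof -
  obtain n :: nat where n: "k \<le> real n" "n > 0"
  proof
    show "k \<le> real (Suc (nat \<lceil>k\<rceil>))" by linarith
  qed simp
  have "z powr k \<le> (1 + real n ^ n) * exp z" if z: "z \<ge> 0" for z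
  proof (cases "z \<le> 1")
    case True
    have "z powr k \<le> 1" using z True assms by (simp add: powr_le1)
    also have "1 \<le> (1 + real n ^ n) * exp z"
      using mult_mono[of 1 "1 + real n ^ n" 1 "exp z"] z by simp
    finally show ?thesis .
  next
    case False
    have "z powr k \<le> z powr real n" using False n by (intro powr_mono) auto
    also have "\<dots> = z ^ n" using False by (simp add: powr_realpow)
    also have "\<dots> = real n ^ n * (z / real n) ^ n" using n by (simp add: power_divide)
    also have "\<dots> \<le> real n ^ n * (1 + z / real n) ^ n"
      using z by (intro mult_left_mono power_mono) auto
    also have "\<dots> \<le> real n ^ n * exp z"
      using z n by (intro mult_left_mono exp_ge_one_plus_x_over_n_power_n) auto
    also have "\<dots> \<le> (1 + real n ^ n) * exp z" by (simp add: distrib_right)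
    finally show ?thesis .
  qed
  then show ?thesis by (intro exI[of _ "1 + real n ^ n"]) (auto intro: add_pos_nonneg)
qed

text \<open>
  A Gaussian factor is split off, to be spent on polynomial weights or on distance from the centre.
\<close>

lemma heat_kernel_double:
  fixes y :: "'a::euclidean_space"
  assumes s: "0 < s"
  shows "heat_kernel s y = 2 powr (DIM('a) / 2) * exp (- (y \<bullet> y) / (8 * s)) * heat_kernel (2 * s) y"
proof -
  have "(4 * pi * (2 * s)) powr (- (DIM('a) / 2)) = 2 powr (- (DIM('a) / 2)) * (4 * pi * s) powr (- (DIM('a) / 2))"
    using s by (simp add: powr_mult[symmetric] mult_ac)
  moreover have "2 powr (DIM('a) / 2) * (2::real) powr (- (DIM('a) / 2)) = 1"
    by (simp add: powr_minus)
  moreover have "exp (- (y \<bullet> y) / (4 * s)) = exp (- (y \<bullet> y) / (8 * s)) * exp (- (y \<bullet> y) / (4 * (2 * s)))"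
    using s by (simp add: exp_add[symmetric] field_simps)
  ultimately show ?thesis by (simp add: heat_kernel_def)
qed

text \<open>
  A moment of the kernel in the natural variable \<open>y / sqrt s\<close> costs only a doubling of the variance, so
  that the mean of the drift cost needs no integral other than the total mass.
\<close>

lemma heat_kernel_moment:
  fixes k :: real
  assumes k: "0 \<le> k"
  shows "\<exists>C>0. \<forall>s>0. \<forall>y::'a::euclidean_space.
    (norm y / sqrt s) powr k * heat_kernel s y \<le> C * heat_kernel (2 * s) y"
proof -
  obtain C where C: "C > 0" "\<And>z. z \<ge> 0 \<Longrightarrow> z powr (k / 2) \<le> C * exp z"
    using powr_le_exp[of "k / 2"] k by auto
  have "(norm y / sqrt s) powr k * heat_kernel s y \<le> (2 powr (DIM('a) / 2) * 8 powr (k / 2) * C) * heat_kernel (2 * s) y"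
    if s: "s > 0" for s and y :: 'a
  proof -
    define z where "z = (y \<bullet> y) / (8 * s)"
    have z: "z \<ge> 0" using s by (simp add: z_def)
    have "(norm y / sqrt s)\<^sup>2 = 8 * z" using s by (simp add: z_def power_divide dot_square_norm)
    moreover have "(norm y / sqrt s) powr k = ((norm y / sqrt s)\<^sup>2) powr (k / 2)"
      using s by (cases "y = 0") (auto simp: powr_powr powr_realpow[symmetric] simp del: powr_numeral)
    ultimately have "(norm y / sqrt s) powr k = 8 powr (k / 2) * z powr (k / 2)"
      using z by (simp add: powr_mult)
    also have "\<dots> \<le> 8 powr (k / 2) * (C * exp z)"
      by (intro mult_left_mono C z) auto
    finally have "(norm y / sqrt s) powr k * exp (- z) \<le> 8 powr (k / 2) * C"
      by (simp add: exp_minus field_simps)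
    then have "2 powr (DIM('a) / 2) * heat_kernel (2 * s) y * ((norm y / sqrt s) powr k * exp (- z))
        \<le> 2 powr (DIM('a) / 2) * heat_kernel (2 * s) y * (8 powr (k / 2) * C)"
      using heat_kernel_pos[of "2 * s" y] s by (intro mult_left_mono) auto
    then show ?thesis
      by (subst heat_kernel_double[OF s]) (simp add: z_def mult_ac)
  qed
  then show ?thesis
    by (intro exI[of _ "2 powr (DIM('a) / 2) * 8 powr (k / 2) * C"]) (use C in auto)
qed

text \<open>
  Away from its centre the gradient of the kernel is bounded uniformly down to \<open>s = 0\<close>. The errors
  caused by a cutoff that is constant near the centre are therefore harmless.
\<close>

lemma heat_kernel_gradient_away:
  assumes rho: "0 < \<rho>"
  shows "\<exists>C>0. \<forall>s>0. \<forall>y::'a::euclidean_space. \<rho> \<le> norm y \<longrightarrow> norm y / s * heat_kernel s y \<le> C"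
proof -
  define k where "k = DIM('a) / 2"
  obtain C where C: "C > 0" "\<And>z. z \<ge> 0 \<Longrightarrow> z powr (k + 1) \<le> C * exp z"
    using powr_le_exp[of "k + 1"] by (auto simp: k_def)
  have "norm y / s * heat_kernel s y \<le> 4 / \<rho> * (pi * \<rho>\<^sup>2) powr (- k) * C"
    if s: "s > 0" and y: "\<rho> \<le> norm y" for s and y :: 'a
  proof -
    define z where "z = (y \<bullet> y) / (4 * s)"
    have ny: "norm y > 0" using y rho by linarith
    have z: "z > 0" using s ny by (simp add: z_def)
    have s_eq: "s = (norm y)\<^sup>2 / (4 * z)" using s ny by (simp add: z_def dot_square_norm)
    have "norm y / s = 4 * z / norm y" using ny z by (simp add: s_eq power2_eq_square)
    also have "\<dots> \<le> 4 * z / \<rho>" using rho y z ny by (intro divide_left_mono) auto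
    finally have 1: "norm y / s \<le> 4 / \<rho> * z" by simp
    have "4 * pi * s = pi * (norm y)\<^sup>2 / z" using z by (simp add: s_eq)
    then have "(4 * pi * s) powr (- k) = (pi * (norm y)\<^sup>2 / z) powr (- k)" by (rule arg_cong)
    also have "\<dots> = (pi * (norm y)\<^sup>2) powr (- k) / z powr (- k)" by (rule powr_divide)
    also have "\<dots> = (pi * (norm y)\<^sup>2) powr (- k) * z powr k" by (simp add: powr_minus divide_inverse)
    also have "\<dots> \<le> (pi * \<rho>\<^sup>2) powr (- k) * z powr k"
      using rho y by (intro mult_right_mono powr_mono2') (auto simp: k_def intro!: mult_left_mono power_mono)
    finally have 2: "(4 * pi * s) powr (- k) \<le> (pi * \<rho>\<^sup>2) powr (- k) * z powr k" .
    have "norm y / s * heat_kernel s y = norm y / s * ((4 * pi * s) powr (- k) * exp (- z))"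
      by (simp add: heat_kernel_def k_def z_def)
    also have "\<dots> \<le> (4 / \<rho> * z) * ((pi * \<rho>\<^sup>2) powr (- k) * z powr k * exp (- z))"
      using s z rho by (intro mult_mono 1 2) auto
    also have "\<dots> = 4 / \<rho> * (pi * \<rho>\<^sup>2) powr (- k) * (z powr (k + 1) * exp (- z))"
      using z by (simp add: powr_add)
    also have "\<dots> \<le> 4 / \<rho> * (pi * \<rho>\<^sup>2) powr (- k) * C"
      using C(2)[of z] z rho by (intro mult_left_mono) (auto simp: exp_minus field_simps)
    finally show ?thesis .
  qed
  then show ?thesis
    by (intro exI[of _ "4 / \<rho> * (pi * \<rho>\<^sup>2) powr (- k) * C"]) (use C rho in auto)
qed

section \<open>Cutoff functions\<close>

lemma DERIV_pos_part_power:
  assumes k: "2 \<le> k"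
  shows "((\<lambda>v::real. max 0 v ^ k) has_field_derivative (real k * max 0 v ^ (k - 1))) (at v)"
proof -
  consider "v > 0" | "v < 0" | "v = 0" by linarith
  then show ?thesis
  proof cases
    case 1
    have "eventually (\<lambda>x. x > 0) (nhds v)" using 1 eventually_nhds_in_open[of "{0<..}" v] by simp
    then have "eventually (\<lambda>x. max 0 x ^ k = x ^ k) (nhds v)" by eventually_elim simp
    from DERIV_cong_ev[OF refl this refl] show ?thesis
      using 1 by (auto intro!: derivative_eq_intros)
  next
    case 2
    have "eventually (\<lambda>x. x < 0) (nhds v)" using 2 eventually_nhds_in_open[of "{..<0}" v] by simp
    then have "eventually (\<lambda>x. max 0 x ^ k = 0) (nhds v)" by eventually_elim (use k in simp)
    from DERIV_cong_ev[OF refl this refl] show ?thesis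
      using 2 k by (simp add: power_0_left)
  next
    case 3
    have "((\<lambda>h::real. max 0 h ^ k / h) \<longlongrightarrow> 0) (at 0)"
    proof (rule Lim_null_comparison)
      show "eventually (\<lambda>h::real. norm (max 0 h ^ k / h) \<le> \<bar>h\<bar>) (at 0)"
        unfolding eventually_at
      proof (intro exI[of _ 1] conjI ballI impI)
        fix h :: real assume h: "h \<noteq> 0 \<and> dist h 0 < 1"
        show "norm (max 0 h ^ k / h) \<le> \<bar>h\<bar>"
        proof (cases "h > 0")
          case True
          have "h ^ k \<le> h ^ 2" using h True k by (intro power_decreasing) auto
          then show ?thesis using True by (simp add: power2_eq_square field_simps)
        qed (use k in \<open>simp add: power_0_left\<close>)
      qed simp
      show "((\<lambda>h::real. \<bar>h\<bar>) \<longlongrightarrow> 0) (at 0)" by (intro tendsto_rabs_zero tendsto_ident_at)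
    qed
    then show ?thesis using 3 k by (simp add: has_field_derivative_iff power_0_left)
  qed
qed

text \<open>
  The cutoff is a high power of a Lipschitz radial profile. For \<open>g^k\<close> with \<open>k \<ge> p\<close>, the gradient is of order
  \<open>g^(k - 1)\<close> and \<open>p (k - 1) \<ge> k (p - 1)\<close>; this is exactly what makes the confining drift
  \<open>\<nabla>\<zeta> / \<zeta>\<close> have finite cost, with a constant independent of the centre.
\<close>

lemma cutoff_exists:
  fixes p :: real
  assumes ab: "0 < a" "a < b" and p: "1 < p"
  shows "\<exists>C>0. \<forall>c::'a::euclidean_space. \<exists>\<zeta> Z.
    (\<forall>y. (\<zeta> has_derivative (\<lambda>h. Z y \<bullet> h)) (at y)) \<and> continuous_on UNIV Z \<and>
    (\<forall>y. 0 \<le> \<zeta> y \<and> \<zeta> y \<le> 1 \<and> norm (Z y) \<le> C \<and> norm (Z y) powr p \<le> C * \<zeta> y powr (p - 1) \<and>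
       (norm (y - c) \<le> a \<longrightarrow> \<zeta> y = 1 \<and> Z y = 0) \<and> (b \<le> norm (y - c) \<longrightarrow> \<zeta> y = 0 \<and> Z y = 0))"
proof -
  obtain k :: nat where k: "p \<le> real k" "2 \<le> k"
  proof
    show "p \<le> real (2 + nat \<lceil>p\<rceil>)" by linarith
  qed simp
  \<comment> \<open>The profile \<open>g\<close> equals 1 for \<open>u \<le> 0\<close> and 0 for \<open>u \<ge> 1\<close>; its kink at \<open>u = 1\<close> disappears in the power \<open>f\<close>.\<close>
  define D where "D = b\<^sup>2 - a\<^sup>2"
  have D: "D > 0" using ab by (simp add: D_def power_strict_mono)
  define g :: "real \<Rightarrow> real" where "g u = max 0 (1 - max 0 u ^ 2)" for u
  define f where "f u = g u ^ k" for u
  define f' where "f' u = - (2 * real k * max 0 u * g u ^ (k - 1))" for u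
  have f': "(f has_field_derivative f' u) (at u)" for u
  proof -
    have "((\<lambda>u. 1 - max 0 u ^ 2) has_field_derivative - (2 * max 0 u)) (at u)"
      using DERIV_diff[OF DERIV_const[of 1] DERIV_pos_part_power[of 2 u]] by simp
    from DERIV_chain2[OF DERIV_pos_part_power[OF k(2)] this] show ?thesis
      unfolding f_def f'_def g_def by (rule DERIV_cong) simp
  qed
  have cf': "continuous_on UNIV f'" unfolding f'_def g_def by (intro continuous_intros)
  have g01: "0 \<le> g u" "g u \<le> 1" for u by (auto simp: g_def)
  have f'b: "\<bar>f' u\<bar> \<le> 2 * real k * g u ^ (k - 1)" for u
  proof (cases "max 0 u \<le> 1")
    case True
    then have "\<bar>f' u\<bar> = 2 * real k * max 0 u * g u ^ (k - 1)" using g01[of u] by (simp add: f'_def abs_mult)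
    also have "\<dots> \<le> 2 * real k * 1 * g u ^ (k - 1)"
      using True g01[of u] by (intro mult_right_mono mult_left_mono) auto
    finally show ?thesis by simp
  next
    case False
    then have "g u = 0" by (simp add: g_def)
    then show ?thesis using k by (simp add: f'_def power_0_left)
  qed
  define A where "A = 2 * real k * (2 * b / D)"
  have A: "A > 0" using k ab D by (simp add: A_def)
  define C where "C = max A (A powr p)"
  show ?thesis
  proof (intro exI[of _ C] conjI allI)
    show "C > 0" using A by (simp add: C_def)
    fix c :: 'a
    define u where "u y = ((y - c) \<bullet> (y - c) - a\<^sup>2) / D" for y
    define \<zeta> where "\<zeta> y = f (u y)" for y
    define Z where "Z y = (f' (u y) * (2 / D)) *\<^sub>R (y - c)" for y
    have Zb: "norm (Z y) \<le> A * g (u y) ^ (k - 1)" for y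
    proof (cases "norm (y - c) \<le> b")
      case True
      have "norm (Z y) = \<bar>f' (u y)\<bar> * (2 / D) * norm (y - c)" using D by (simp add: Z_def abs_mult)
      also have "\<dots> \<le> (2 * real k * g (u y) ^ (k - 1)) * (2 / D) * b"
        using f'b D True ab g01 by (intro mult_mono) auto
      finally show ?thesis by (simp add: A_def mult_ac)
    next
      case False
      then have "u y \<ge> 1" using D ab by (simp add: u_def D_def dot_square_norm power_mono)
      then have "g (u y) = 0" by (simp add: g_def) 
      then show ?thesis using k by (simp add: Z_def f'_def power_0_left)
    qed
    show "\<exists>\<zeta> Z. (\<forall>y. (\<zeta> has_derivative (\<lambda>h. Z y \<bullet> h)) (at y)) \<and> continuous_on UNIV Z \<and>
      (\<forall>y. 0 \<le> \<zeta> y \<and> \<zeta> y \<le> 1 \<and> norm (Z y) \<le> C \<and> norm (Z y) powr p \<le> C * \<zeta> y powr (p - 1) \<and>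
       (norm (y - c) \<le> a \<longrightarrow> \<zeta> y = 1 \<and> Z y = 0) \<and> (b \<le> norm (y - c) \<longrightarrow> \<zeta> y = 0 \<and> Z y = 0))"
    proof (intro exI[of _ \<zeta>] exI[of _ Z] conjI allI impI)
      fix y
      have "(u has_derivative (\<lambda>h. (2 / D) * ((y - c) \<bullet> h))) (at y)"
        unfolding u_def using D by (auto intro!: derivative_eq_intros simp: inner_commute field_simps)
      from has_derivative_compose[OF this f'[unfolded has_field_derivative_def]]
      show "(\<zeta> has_derivative (\<lambda>h. Z y \<bullet> h)) (at y)"
        unfolding \<zeta>_def Z_def by (simp add: mult_ac)
      show "0 \<le> \<zeta> y" "\<zeta> y \<le> 1" using g01[of "u y"] by (auto simp: \<zeta>_def f_def power_le_one)
      have "A * g (u y) ^ (k - 1) \<le> A * 1"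
        using A g01[of "u y"] by (intro mult_left_mono power_le_one) auto
      with Zb[of y] show "norm (Z y) \<le> C" by (simp add: C_def)
      show "norm (Z y) powr p \<le> C * \<zeta> y powr (p - 1)"
      proof (cases "g (u y) = 0")
        case True
        then have "norm (Z y) = 0" using Zb[of y] k by (simp add: power_0_left)
        then show ?thesis using p \<open>0 < C\<close> by simp
      next
        case False
        then have g: "0 < g (u y)" "g (u y) \<le> 1" using g01[of "u y"] by auto
        have "norm (Z y) powr p \<le> (A * g (u y) ^ (k - 1)) powr p"
          using Zb p by (intro powr_mono2) auto
        also have "\<dots> = A powr p * g (u y) powr (real (k - 1) * p)"
          using A g by (simp add: powr_mult powr_realpow[symmetric] powr_powr)
        also have "g (u y) powr (real (k - 1) * p) \<le> g (u y) powr (real k * (p - 1))"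
        proof (rule powr_mono')
          show "real k * (p - 1) \<le> real (k - 1) * p" using k by (simp add: of_nat_diff algebra_simps)
        qed (use g in auto)
        also have "g (u y) powr (real k * (p - 1)) = \<zeta> y powr (p - 1)"
          using g by (simp add: \<zeta>_def f_def powr_realpow[symmetric] powr_powr)
        finally have "norm (Z y) powr p \<le> A powr p * \<zeta> y powr (p - 1)" using A by simp
        also have "\<dots> \<le> C * \<zeta> y powr (p - 1)" by (intro mult_right_mono) (auto simp: C_def)
        finally show ?thesis .
      qed
      { assume "norm (y - c) \<le> a"
        then have "u y \<le> 0" using D by (simp add: u_def dot_square_norm divide_le_0_iff power_mono)
        then show "\<zeta> y = 1" "Z y = 0" by (auto simp: \<zeta>_def f_def Z_def f'_def g_def) }
      { assume "b \<le> norm (y - c)"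
        then have "u y \<ge> 1" using D ab by (simp add: u_def D_def dot_square_norm power_mono)
        then have "g (u y) = 0" by (simp add: g_def)
        then show "\<zeta> y = 0" "Z y = 0" using k by (auto simp: \<zeta>_def f_def Z_def f'_def power_0_left) }
    next
      show "continuous_on UNIV Z" unfolding Z_def u_def
        by (intro continuous_intros continuous_on_compose2[OF cf']) (use D in auto)
    qed
  qed
qed

section \<open>Duality for subsolutions\<close>

text \<open>
  The inequality, unlike the equation, survives mollification.
\<close>

definition classical_subsolution ::
    "real \<Rightarrow> real \<Rightarrow> 'a::euclidean_space set \<Rightarrow> real set \<Rightarrow> ('a \<times> real \<Rightarrow> real) \<Rightarrow> bool" where
  "classical_subsolution \<nu> q U J w \<longleftrightarrow> C21_on (U \<times> J) w \<and> (\<forall>z\<in>U \<times> J. 0 \<le> w z \<and>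
     pderivative (0, 1) w z - \<nu> * laplacian_x w z + norm (grad_x w z) powr q \<le> 0)"

lemma C1_along_has_derivative:
  assumes "C1_along v S f" "z \<in> S"
  shows "((\<lambda>h. f (z + h *\<^sub>R v)) has_field_derivative pderivative v f z) (at 0)"
  using assms unfolding C1_along_def pderivative_def
  by (auto intro: field_differentiable_derivI)

lemma grad_x_inner: "i \<in> Basis \<Longrightarrow> grad_x w z \<bullet> i = pderivative (i, 0) w z"
  by (simp add: grad_x_def inner_sum_left inner_Basis sum.If_cases if_distrib cong: if_cong)

text \<open>
  The test function is \<open>\<zeta> \<psi>\<close> with \<open>\<psi>_t = - (\<nu> + a) \<Delta>\<psi>\<close>, where \<open>P = \<nabla>\<psi>\<close>, \<open>Z = \<nabla>\<zeta>\<close> and \<open>PP i\<close> is the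
  second derivative of \<open>\<psi>\<close> in direction \<open>i\<close>. The part \<open>\<nu>\<close> of the speed cancels the diffusion of \<open>w\<close>; the
  extra speed \<open>a\<close> is transport by a drift, paid for by \<open>E\<close>. Integration by parts moves all second
  derivatives away from the cutoff, so a \<open>C^1\<close> cutoff suffices, and the only term in which \<open>w\<close> itself is left is the
  one with \<open>Z \<bullet> P\<close>.
\<close>

lemma duality_step:
  fixes w :: "'a::euclidean_space \<times> real \<Rightarrow> real"
  assumes U: "open U" and J: "{s..t} \<subseteq> J" "s \<le> t" and K: "compact K" "K \<subseteq> U"
    and sub: "classical_subsolution \<nu> q U J w"
    and zeta: "\<And>y. (\<zeta> has_derivative (\<lambda>h. Z y \<bullet> h)) (at y)" "continuous_on UNIV Z" "\<And>y. 0 \<le> \<zeta> y"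
      "\<And>y. y \<notin> K \<Longrightarrow> \<zeta> y = 0" "\<And>y. y \<notin> K \<Longrightarrow> Z y = 0"
    and psi0: "\<And>\<sigma> y. \<sigma> \<in> {s..t} \<Longrightarrow> 0 \<le> \<psi> \<sigma> y"
    and psi1: "\<And>\<sigma> y i. \<sigma> \<in> {s..t} \<Longrightarrow> i \<in> Basis \<Longrightarrow>
        ((\<lambda>h. \<psi> \<sigma> (y + h *\<^sub>R i)) has_field_derivative P \<sigma> y \<bullet> i) (at 0)"
    and psi2: "\<And>\<sigma> y i. \<sigma> \<in> {s..t} \<Longrightarrow> i \<in> Basis \<Longrightarrow>
        ((\<lambda>h. P \<sigma> (y + h *\<^sub>R i) \<bullet> i) has_field_derivative PP i \<sigma> y) (at 0)"
    and psit: "\<And>\<sigma> y. \<sigma> \<in> {s..t} \<Longrightarrow>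
        ((\<lambda>\<sigma>. \<psi> \<sigma> y) has_field_derivative - (\<nu> + a \<sigma>) * (\<Sum>i\<in>Basis. PP i \<sigma> y)) (at \<sigma> within {s..t})"
    and cont: "continuous_on (UNIV \<times> {s..t}) (\<lambda>z. \<psi> (snd z) (fst z))"
      "continuous_on (UNIV \<times> {s..t}) (\<lambda>z. P (snd z) (fst z))"
      "\<And>i. i \<in> Basis \<Longrightarrow> continuous_on (UNIV \<times> {s..t}) (\<lambda>z. PP i (snd z) (fst z))"
      "continuous_on {s..t} a"
    and E: "\<And>\<sigma> y p. \<sigma> \<in> {s..t} \<Longrightarrow>
        p \<bullet> ((a \<sigma> * \<zeta> y) *\<^sub>R P \<sigma> y - (\<nu> * \<psi> \<sigma> y) *\<^sub>R Z y) - norm p powr q * (\<zeta> y * \<psi> \<sigma> y) \<le> E \<sigma> y"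
      "\<And>\<sigma>. \<sigma> \<in> {s..t} \<Longrightarrow> integrable lborel (E \<sigma>)"
    and bound: "\<And>\<sigma>. \<sigma> \<in> {s..t} \<Longrightarrow>
        (\<nu> + a \<sigma>) * (LINT y|lborel. w (y, \<sigma>) * (Z y \<bullet> P \<sigma> y)) + integral\<^sup>L lborel (E \<sigma>) \<le> \<kappa>"
  shows "(LINT y|lborel. w (y, t) * (\<zeta> y * \<psi> t y)) \<le> (LINT y|lborel. w (y, s) * (\<zeta> y * \<psi> s y)) + \<kappa> * (t - s)"
proof (cases "s = t")
  case False
  then have st: "s < t" using J by simp
  let ?T = "{s..t}"
  have C21: "C21_on (U \<times> J) w" and wpos: "\<And>y \<sigma>. y \<in> U \<Longrightarrow> \<sigma> \<in> J \<Longrightarrow> 0 \<le> w (y, \<sigma>)"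
    and ineq: "\<And>z. z \<in> U \<times> J \<Longrightarrow> pderivative (0, 1) w z - \<nu> * laplacian_x w z + norm (grad_x w z) powr q \<le> 0"
    using sub by (auto simp: classical_subsolution_def)
  define wt where "wt = pderivative (0, 1) w"
  define wi where "wi i = pderivative (i, 0) w" for i
  define wii where "wii i = pderivative (i, 0) (wi i)" for i
  have sUT: "U \<times> ?T \<subseteq> U \<times> J" using J by auto
  have cw: "continuous_on (U \<times> ?T) w" and cwt: "continuous_on (U \<times> ?T) wt"
    and cwi: "\<And>i. i \<in> Basis \<Longrightarrow> continuous_on (U \<times> ?T) (wi i)"
    and cwii: "\<And>i. i \<in> Basis \<Longrightarrow> continuous_on (U \<times> ?T) (wii i)"
    using C21 continuous_on_subset[OF _ sUT] unfolding C21_on_def C1_along_def wt_def wi_def wii_def by blast+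
  have dwt: "((\<lambda>\<sigma>. w (y, \<sigma>)) has_field_derivative wt (y, \<sigma>)) (at \<sigma>)" if "y \<in> U" "\<sigma> \<in> ?T" for y \<sigma>
  proof -
    have "((\<lambda>h. w ((y, \<sigma>) + h *\<^sub>R (0, 1))) has_field_derivative wt (y, \<sigma>)) (at 0)"
      unfolding wt_def by (rule C1_along_has_derivative) (use C21 that J in \<open>auto simp: C21_on_def\<close>)
    then show ?thesis by (subst DERIV_shift[of _ _ 0 \<sigma>, simplified]) (simp add: add.commute)
  qed
  have dwi: "((\<lambda>h. w (y + h *\<^sub>R i, \<sigma>)) has_field_derivative wi i (y, \<sigma>)) (at 0)"
    if "y \<in> U" "\<sigma> \<in> ?T" "i \<in> Basis" for y \<sigma> i
  proof -
    have "((\<lambda>h. w ((y, \<sigma>) + h *\<^sub>R (i, 0))) has_field_derivative wi i (y, \<sigma>)) (at 0)"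
      unfolding wi_def by (rule C1_along_has_derivative) (use C21 that J in \<open>auto simp: C21_on_def\<close>)
    then show ?thesis by simp
  qed
  have dwii: "((\<lambda>h. wi i (y + h *\<^sub>R i, \<sigma>)) has_field_derivative wii i (y, \<sigma>)) (at 0)"
    if "y \<in> U" "\<sigma> \<in> ?T" "i \<in> Basis" for y \<sigma> i
  proof -
    have "((\<lambda>h. wi i ((y, \<sigma>) + h *\<^sub>R (i, 0))) has_field_derivative wii i (y, \<sigma>)) (at 0)"
      unfolding wii_def by (rule C1_along_has_derivative) (use C21 that J in \<open>auto simp: C21_on_def wi_def\<close>)
    then show ?thesis by simp
  qed
  have dz: "((\<lambda>h. \<zeta> (y + h *\<^sub>R i)) has_field_derivative Z y \<bullet> i) (at 0)" for y i
  proof -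
    have "((\<lambda>h. \<zeta> (y + h *\<^sub>R i)) has_derivative (\<lambda>h. Z (y + 0 *\<^sub>R i) \<bullet> (h *\<^sub>R i))) (at 0)"
      by (rule has_derivative_compose[of "\<lambda>h. y + h *\<^sub>R i", OF _ zeta(1)]) (auto intro!: derivative_eq_intros)
    then show ?thesis by (simp add: has_field_derivative_def mult_commute_abs)
  qed
  have cz: "continuous_on UNIV \<zeta>"
    using zeta(1) by (meson continuous_at_imp_continuous_on has_derivative_continuous)
  have cz': "continuous_on A (\<lambda>z. \<zeta> (fst z))" "continuous_on A (\<lambda>z. Z (fst z))" for A :: "('a \<times> real) set"
    by (intro continuous_on_compose2[OF cz] continuous_on_compose2[OF zeta(2)] continuous_intros; simp)+
  have ca': "continuous_on (B \<times> ?T) (\<lambda>z. a (snd z))" for B :: "'a set"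
    by (rule continuous_on_compose2[OF cont(4)]) (auto intro!: continuous_intros)
  have csub: "continuous_on (U \<times> ?T) f" if "continuous_on (UNIV \<times> ?T) f" for f :: "'a \<times> real \<Rightarrow> 'b::topological_space"
    using that by (rule continuous_on_subset) auto
  note cU = cw cwt cwi cwii cz' ca' csub[OF cont(1)] csub[OF cont(2)] csub[OF cont(3)]
  have glue: "continuous_on (UNIV \<times> ?T) f" if "continuous_on (U \<times> ?T) f" "\<And>y \<sigma>. y \<notin> K \<Longrightarrow> f (y, \<sigma>) = 0" for f :: "'a \<times> real \<Rightarrow> real"
    by (rule continuous_on_extend_by_zero[OF U compact_imp_closed[OF K(1)] K(2) that(1)]) (use that(2) in auto)
  have slice: "continuous_on UNIV (\<lambda>y. f (y, \<sigma>))" if "continuous_on (UNIV \<times> ?T) f" "\<sigma> \<in> ?T" for f :: "'a \<times> real \<Rightarrow> real" and \<sigma>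
    by (rule continuous_on_compose2[OF that(1)]) (use that(2) in \<open>auto intro!: continuous_intros\<close>)
  define F where "F z = w z * (\<zeta> (fst z) * \<psi> (snd z) (fst z))" for z
  define F' where "F' z = wt z * (\<zeta> (fst z) * \<psi> (snd z) (fst z))
      + w z * (\<zeta> (fst z) * (- (\<nu> + a (snd z)) * (\<Sum>i\<in>Basis. PP i (snd z) (fst z))))" for z
  \<comment> \<open>The vector field whose divergence carries all second derivatives; \<open>g i\<close> is the derivative of its \<open>i\<close>-th component.\<close>
  define f where "f i z = \<nu> * (\<zeta> (fst z) * (\<psi> (snd z) (fst z) * wi i z))
      - (\<nu> + a (snd z)) * (w z * (\<zeta> (fst z) * (P (snd z) (fst z) \<bullet> i)))" for i z
  define g where "g i z =
      \<nu> * ((Z (fst z) \<bullet> i) * (\<psi> (snd z) (fst z) * wi i z)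
        + \<zeta> (fst z) * ((P (snd z) (fst z) \<bullet> i) * wi i z + \<psi> (snd z) (fst z) * wii i z))
      - (\<nu> + a (snd z)) * (wi i z * (\<zeta> (fst z) * (P (snd z) (fst z) \<bullet> i))
        + w z * ((Z (fst z) \<bullet> i) * (P (snd z) (fst z) \<bullet> i) + \<zeta> (fst z) * PP i (snd z) (fst z)))" for i z
  define H where "H z = w z * (Z (fst z) \<bullet> P (snd z) (fst z))" for z
  have cF: "continuous_on (UNIV \<times> ?T) F" 
    by (rule glue) (auto simp: F_def zeta intro!: continuous_intros cU)
  have cF': "continuous_on (UNIV \<times> ?T) F'"
    by (rule glue) (auto simp: F'_def zeta intro!: continuous_intros cU)
  have cf: "continuous_on (UNIV \<times> ?T) (f i)" if "i \<in> Basis" for i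
    by (rule glue) (auto simp: f_def[abs_def] zeta intro!: continuous_intros cU that)
  have cg: "continuous_on (UNIV \<times> ?T) (g i)" if "i \<in> Basis" for i
    by (rule glue) (auto simp: g_def[abs_def] zeta intro!: continuous_intros cU that)
  have cH: "continuous_on (UNIV \<times> ?T) H"
    by (rule glue) (auto simp: H_def zeta intro!: continuous_intros cU)
  obtain \<alpha> \<beta> where box: "K \<subseteq> cbox \<alpha> \<beta>"
    using bounded_subset_cbox_symmetric[OF compact_imp_bounded[OF K(1)]] by metis
  have toL: "integrable lborel (\<lambda>y. G (y, \<sigma>))" "integral (cbox \<alpha> \<beta>) (\<lambda>y. G (y, \<sigma>)) = (LINT y|lborel. G (y, \<sigma>))"
    if G: "continuous_on (UNIV \<times> ?T) G" "\<And>y \<sigma>. y \<notin> K \<Longrightarrow> G (y, \<sigma>) = 0" "\<sigma> \<in> ?T" for G :: "'a \<times> real \<Rightarrow> real" and \<sigma>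
  proof -
    show i: "integrable lborel (\<lambda>y. G (y, \<sigma>))"
      by (rule integrable_continuous_compact_support[OF slice[OF G(1,3)] K(1)]) (rule G(2))
    have "(LINT y|lborel. G (y, \<sigma>)) = integral UNIV (\<lambda>y. G (y, \<sigma>))"
      using i by (simp add: integral_lborel)
    also have "\<dots> = integral UNIV (\<lambda>y. if y \<in> cbox \<alpha> \<beta> then G (y, \<sigma>) else 0)"
      using box G(2) by (intro arg_cong2[where f=integral] refl) (auto simp: fun_eq_iff)
    also have "\<dots> = integral (cbox \<alpha> \<beta>) (\<lambda>y. G (y, \<sigma>))" by (simp add: integral_restrict_UNIV)
    finally show "integral (cbox \<alpha> \<beta>) (\<lambda>y. G (y, \<sigma>)) = (LINT y|lborel. G (y, \<sigma>))" ..
  qed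
  have zeros: "\<And>y \<sigma>. y \<notin> K \<Longrightarrow> F (y, \<sigma>) = 0" "\<And>y \<sigma>. y \<notin> K \<Longrightarrow> F' (y, \<sigma>) = 0"
    "\<And>y \<sigma> i. y \<notin> K \<Longrightarrow> f i (y, \<sigma>) = 0" "\<And>y \<sigma> i. y \<notin> K \<Longrightarrow> g i (y, \<sigma>) = 0" "\<And>y \<sigma>. y \<notin> K \<Longrightarrow> H (y, \<sigma>) = 0"
    by (auto simp: F_def F'_def f_def g_def H_def zeta)
  have dF: "((\<lambda>\<sigma>. F (y, \<sigma>)) has_field_derivative F' (y, \<sigma>)) (at \<sigma> within ?T)" if "\<sigma> \<in> ?T" for y \<sigma>
  proof (cases "y \<in> U")
    case True
    have w': "((\<lambda>\<sigma>. w (y, \<sigma>)) has_field_derivative wt (y, \<sigma>)) (at \<sigma> within ?T)"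
      using dwt[OF True that] by (rule DERIV_subset) simp
    show ?thesis unfolding F_def F'_def fst_conv snd_conv
      by (rule DERIV_cong[OF DERIV_mult[OF w' DERIV_cmult[OF psit[OF that]]]]) (simp add: algebra_simps)
  next
    case False
    then have y: "y \<notin> K" using K by auto
    show ?thesis unfolding zeros(1,2)[OF y] by (rule DERIV_const)
  qed
  have h': "((\<lambda>\<sigma>. integral (cbox \<alpha> \<beta>) (\<lambda>y. F (y, \<sigma>))) has_field_derivative
      integral (cbox \<alpha> \<beta>) (\<lambda>y. F' (y, \<sigma>))) (at \<sigma> within ?T)" if "\<sigma> \<in> ?T" for \<sigma>
  proof (rule leibniz_rule_field_derivative[where U = ?T and f = "\<lambda>\<sigma> y. F (y, \<sigma>)" and fx = "\<lambda>\<sigma> y. F' (y, \<sigma>)"])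
    show "(\<lambda>y. F (y, \<sigma>)) integrable_on cbox \<alpha> \<beta>" if "\<sigma> \<in> ?T" for \<sigma>
      using slice[OF cF that] by (intro integrable_continuous) (auto intro: continuous_on_subset)
    show "continuous_on (?T \<times> cbox \<alpha> \<beta>) (\<lambda>(\<sigma>, y). F' (y, \<sigma>))"
      unfolding split_beta by (rule continuous_on_compose2[OF cF']) (auto intro!: continuous_intros)
  qed (use dF that in auto)
  have main: "integral (cbox \<alpha> \<beta>) (\<lambda>y. F' (y, \<sigma>)) \<le> \<kappa>" if \<sigma>: "\<sigma> \<in> ?T" for \<sigma>
  proof -
    have div0: "(LINT y|lborel. g i (y, \<sigma>)) = 0" if i: "i \<in> Basis" for i
    proof (rule integral_directional_derivative_eq_0[where f = "\<lambda>y. f i (y, \<sigma>)" and i = i and K = K])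
      fix y
      show "((\<lambda>h. f i (y + h *\<^sub>R i, \<sigma>)) has_field_derivative g i (y, \<sigma>)) (at 0)"
      proof (cases "y \<in> U")
        case True
        note d = dwi[OF True \<sigma> i] dwii[OF True \<sigma> i] dz[of y i] psi1[OF \<sigma> i, of y] psi2[OF \<sigma> i, of y]
        show ?thesis unfolding f_def g_def fst_conv snd_conv
          by (rule DERIV_cong[OF DERIV_diff[OF DERIV_cmult[OF DERIV_mult[OF d(3) DERIV_mult[OF d(4,2)]]]
              DERIV_cmult[OF DERIV_mult[OF d(1) DERIV_mult[OF d(3,5)]]]]]) (simp add: algebra_simps)
      next
        case False
        then have y: "y \<in> - K" using K by auto
        have "eventually (\<lambda>h. y + h *\<^sub>R i \<in> - K) (nhds (0::real))"
        proof -
          have "((\<lambda>h. y + h *\<^sub>R i) \<longlongrightarrow> y + 0 *\<^sub>R i) (nhds (0::real))" by (intro tendsto_intros filterlim_ident)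
          then show ?thesis using compact_imp_closed[OF K(1)] y by (intro topological_tendstoD) auto
        qed
        then have "eventually (\<lambda>h. f i (y + h *\<^sub>R i, \<sigma>) = 0) (nhds (0::real))"
          by eventually_elim (use zeros in auto)
        from DERIV_cong_ev[OF refl this refl] show ?thesis using zeros y by simp
      qed
    qed (use slice[OF cf[OF i] \<sigma>] slice[OF cg[OF i] \<sigma>] K zeros in auto)
    have gi: "integrable lborel (\<lambda>y. g i (y, \<sigma>))" if "i \<in> Basis" for i
      using toL(1)[OF cg[OF that] _ \<sigma>] zeros by auto
    have Hi: "integrable lborel (\<lambda>y. H (y, \<sigma>))" using toL(1)[OF cH _ \<sigma>] zeros by auto
    have F'i: "integrable lborel (\<lambda>y. F' (y, \<sigma>))" using toL(1)[OF cF' _ \<sigma>] zeros by auto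
    have pt: "F' (y, \<sigma>) \<le> (\<Sum>i\<in>Basis. g i (y, \<sigma>)) + (\<nu> + a \<sigma>) * H (y, \<sigma>) + E \<sigma> y" for y
    proof (cases "y \<in> U")
      case True
      define p where "p = grad_x w (y, \<sigma>)"
      have pi: "p \<bullet> i = wi i (y, \<sigma>)" if "i \<in> Basis" for i using that by (simp add: p_def grad_x_inner wi_def)
      have lap: "laplacian_x w (y, \<sigma>) = (\<Sum>i\<in>Basis. wii i (y, \<sigma>))" by (simp add: laplacian_x_def wii_def wi_def)
      have sg: "(\<Sum>i\<in>Basis. g i (y, \<sigma>)) = 
         \<nu> * \<psi> \<sigma> y * (p \<bullet> Z y) + \<nu> * \<zeta> y * (p \<bullet> P \<sigma> y) + \<nu> * \<zeta> y * \<psi> \<sigma> y * laplacian_x w (y, \<sigma>)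
         - (\<nu> + a \<sigma>) * (\<zeta> y * (p \<bullet> P \<sigma> y) + H (y, \<sigma>) + w (y, \<sigma>) * \<zeta> y * (\<Sum>i\<in>Basis. PP i \<sigma> y))"
      proof -
        have pv: "p \<bullet> v = (\<Sum>i\<in>Basis. wi i (y, \<sigma>) * (v \<bullet> i))" for v
          by (subst euclidean_inner) (simp add: pi)
        have Hs: "H (y, \<sigma>) = w (y, \<sigma>) * (\<Sum>i\<in>Basis. (Z y \<bullet> i) * (P \<sigma> y \<bullet> i))"
          by (simp add: H_def euclidean_inner[of "Z y" "P \<sigma> y"])
        have "(\<Sum>i\<in>Basis. g i (y, \<sigma>)) = (\<Sum>i\<in>Basis.
           \<nu> * \<psi> \<sigma> y * (wi i (y, \<sigma>) * (Z y \<bullet> i)) + \<nu> * \<zeta> y * (wi i (y, \<sigma>) * (P \<sigma> y \<bullet> i))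
           + \<nu> * \<zeta> y * \<psi> \<sigma> y * wii i (y, \<sigma>)
           - (\<nu> + a \<sigma>) * (\<zeta> y * (wi i (y, \<sigma>) * (P \<sigma> y \<bullet> i))
             + w (y, \<sigma>) * ((Z y \<bullet> i) * (P \<sigma> y \<bullet> i)) + w (y, \<sigma>) * \<zeta> y * PP i \<sigma> y))"
          unfolding g_def fst_conv snd_conv by (intro sum.cong refl) algebra
        then show ?thesis
          unfolding pv lap Hs by (simp only: sum.distrib sum_subtractf sum_distrib_left[symmetric])
      qed
      have "p \<bullet> ((a \<sigma> * \<zeta> y) *\<^sub>R P \<sigma> y - (\<nu> * \<psi> \<sigma> y) *\<^sub>R Z y) - norm p powr q * (\<zeta> y * \<psi> \<sigma> y) \<le> E \<sigma> y"
        by (rule E(1)[OF \<sigma>])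
      then have e: "a \<sigma> * \<zeta> y * (p \<bullet> P \<sigma> y) - \<nu> * \<psi> \<sigma> y * (p \<bullet> Z y) - norm p powr q * (\<zeta> y * \<psi> \<sigma> y) \<le> E \<sigma> y"
        by (simp add: inner_diff_right)
      have "wt (y, \<sigma>) \<le> \<nu> * laplacian_x w (y, \<sigma>) - norm p powr q"
        using ineq[of "(y, \<sigma>)"] True \<sigma> J by (auto simp: wt_def p_def)
      then have "wt (y, \<sigma>) * (\<zeta> y * \<psi> \<sigma> y) \<le> (\<nu> * laplacian_x w (y, \<sigma>) - norm p powr q) * (\<zeta> y * \<psi> \<sigma> y)"
        by (intro mult_right_mono mult_nonneg_nonneg zeta psi0 \<sigma>)
      then show ?thesis unfolding sg using e by (simp add: F'_def algebra_simps)
    next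
      case False
      then have y: "y \<notin> K" using K by auto
      have "0 \<le> E \<sigma> y" using E(1)[OF \<sigma>, of 0 y] zeta(4)[OF y] by simp
      then show ?thesis using zeros y by simp
    qed
    have "integral (cbox \<alpha> \<beta>) (\<lambda>y. F' (y, \<sigma>)) = (LINT y|lborel. F' (y, \<sigma>))"
      using toL(2)[OF cF' _ \<sigma>] zeros by auto
    also have "\<dots> \<le> (LINT y|lborel. (\<Sum>i\<in>Basis. g i (y, \<sigma>)) + (\<nu> + a \<sigma>) * H (y, \<sigma>) + E \<sigma> y)"
      by (intro integral_mono F'i pt Bochner_Integration.integrable_add Bochner_Integration.integrable_sum
          integrable_mult_right gi Hi E(2)[OF \<sigma>])
    also have "\<dots> = (\<Sum>i\<in>Basis. LINT y|lborel. g i (y, \<sigma>)) + (\<nu> + a \<sigma>) * (LINT y|lborel. H (y, \<sigma>)) + integral\<^sup>L lborel (E \<sigma>)"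
      using gi Hi E(2)[OF \<sigma>] by (simp add: Bochner_Integration.integral_add Bochner_Integration.integral_sum)
    also have "\<dots> \<le> \<kappa>" using div0 bound[OF \<sigma>] by (simp add: H_def)
    finally show ?thesis .
  qed
  have "\<exists>x\<in>{s<..<t}. integral (cbox \<alpha> \<beta>) (\<lambda>y. F (y, t)) - integral (cbox \<alpha> \<beta>) (\<lambda>y. F (y, s)) =
      integral (cbox \<alpha> \<beta>) (\<lambda>y. F' (y, x)) * (t - s)"
    by (rule mvt_simple[OF st, where f' = "\<lambda>x h. integral (cbox \<alpha> \<beta>) (\<lambda>y. F' (y, x)) * h"])
       (use h' in \<open>auto simp: has_field_derivative_def\<close>)
  then obtain x where x: "x \<in> {s<..<t}" and eq: "integral (cbox \<alpha> \<beta>) (\<lambda>y. F (y, t)) - integral (cbox \<alpha> \<beta>) (\<lambda>y. F (y, s)) =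
      integral (cbox \<alpha> \<beta>) (\<lambda>y. F' (y, x)) * (t - s)" by blast
  then have "x \<in> ?T" by simp
  have "integral (cbox \<alpha> \<beta>) (\<lambda>y. F' (y, x)) * (t - s) \<le> \<kappa> * (t - s)"
    using main[OF \<open>x \<in> ?T\<close>] st by (intro mult_right_mono) auto
  then have "integral (cbox \<alpha> \<beta>) (\<lambda>y. F (y, t)) \<le> integral (cbox \<alpha> \<beta>) (\<lambda>y. F (y, s)) + \<kappa> * (t - s)"
    using eq by linarith
  then show ?thesis using toL(2)[OF cF, of t] toL(2)[OF cF, of s] zeros st by (simp add: F_def)
qed simp

section \<open>Local mass and pointwise bounds for subsolutions\<close>

lemma Young_inner:
  fixes p b :: "'a::real_inner"
  assumes q: "1 < q"
  shows "p \<bullet> b \<le> norm p powr q + norm b powr (q / (q - 1))"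
proof -
  define q' where "q' = q / (q - 1)"
  have q': "1 < q'" "1 / q + 1 / q' = 1" using q by (auto simp: q'_def field_simps)
  have "p \<bullet> b \<le> norm p * norm b" by (rule norm_cauchy_schwarz)
  also have "\<dots> \<le> norm p powr q / q + norm b powr q' / q'"
    using q q' by (intro Youngs_inequality) auto
  also have "\<dots> \<le> norm p powr q + norm b powr q'"
    using q q' mult_left_mono[of 1 q "norm p powr q"] mult_left_mono[of 1 q' "norm b powr q'"]
    by (intro add_mono) (auto simp: divide_le_eq)
  finally show ?thesis by (simp add: q'_def)
qed

lemma powr_add_le:
  fixes u v :: real
  assumes "0 \<le> u" "0 \<le> v" "0 \<le> p"
  shows "(u + v) powr p \<le> 2 powr p * (u powr p + v powr p)"
proof -
  have "(u + v) powr p \<le> (2 * max u v) powr p" using assms by (intro powr_mono2) auto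
  also have "\<dots> = 2 powr p * max u v powr p" using assms by (simp add: powr_mult)
  also have "\<dots> \<le> 2 powr p * (u powr p + v powr p)"
    by (intro mult_left_mono) (auto simp: max_def)
  finally show ?thesis .
qed

text \<open>
  The integrand of the duality step is \<open>z \<psi> (p \<bullet> b - |p|^q)\<close> for the drift \<open>b = a m - \<nu> Z / z\<close>, where
  \<open>\<psi> m\<close> is the gradient of \<open>\<psi>\<close>. By Young's inequality it is at most \<open>z \<psi> |b|^q'\<close>, and the bound on
  \<open>|Z|^q'\<close> removes the singularity at the edge of the cutoff.
\<close>

lemma drift_cost_bound:
  fixes p m Z :: "'a::real_inner"
  assumes q: "1 < q" and q': "q' = q / (q - 1)" and nu: "0 \<le> \<nu>" "\<nu> \<le> 1"
    and z: "0 \<le> z" "z \<le> 1" "norm Z powr q' \<le> C * z powr (q' - 1)" and psi: "0 \<le> \<psi>" and C: "0 \<le> C"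
  shows "p \<bullet> ((a * z) *\<^sub>R (\<psi> *\<^sub>R m) - (\<nu> * \<psi>) *\<^sub>R Z) - norm p powr q * (z * \<psi>)
    \<le> 2 powr q' * \<psi> * (norm (a *\<^sub>R m) powr q' + C)"
proof (cases "z = 0")
  case True
  then have "Z = 0" using z q q' by (simp add: powr_def split: if_splits)
  then show ?thesis using True psi C by simp
next
  case False
  then have zp: "z > 0" using z by simp
  have q'1: "q' > 1" using q by (simp add: q' field_simps)
  define b where "b = a *\<^sub>R m - (\<nu> / z) *\<^sub>R Z"
  have eq: "(a * z) *\<^sub>R (\<psi> *\<^sub>R m) - (\<nu> * \<psi>) *\<^sub>R Z = (z * \<psi>) *\<^sub>R b"
    using zp by (simp add: b_def scaleR_diff_right mult_ac)
  have "norm b \<le> norm (a *\<^sub>R m) + norm ((\<nu> / z) *\<^sub>R Z)" unfolding b_def by (rule norm_triangle_ineq4)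
  also have "norm ((\<nu> / z) *\<^sub>R Z) = \<nu> * (norm Z / z)" using nu zp by simp
  also have "\<dots> \<le> norm Z / z" using nu zp by (intro mult_left_le_one_le) auto
  finally have "norm b powr q' \<le> (norm (a *\<^sub>R m) + norm Z / z) powr q'"
    using q'1 by (intro powr_mono2) auto
  also have "\<dots> \<le> 2 powr q' * (norm (a *\<^sub>R m) powr q' + (norm Z / z) powr q')"
    using q'1 zp by (intro powr_add_le) auto
  finally have b: "norm b powr q' \<le> 2 powr q' * (norm (a *\<^sub>R m) powr q' + (norm Z / z) powr q')" .
  have "z * (norm Z / z) powr q' = z * (norm Z powr q' / z powr q')" using zp by (simp add: powr_divide)
  also have "\<dots> \<le> z * (C * z powr (q' - 1) / z powr q')"
    using zp z by (intro mult_left_mono divide_right_mono) auto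
  also have "\<dots> = C" using zp by (simp add: powr_diff)
  finally have Zb: "z * (norm Z / z) powr q' \<le> C" .
  have "z * norm b powr q' \<le> z * (2 powr q' * (norm (a *\<^sub>R m) powr q' + (norm Z / z) powr q'))"
    using b zp by (intro mult_left_mono) auto
  also have "\<dots> = 2 powr q' * (z * norm (a *\<^sub>R m) powr q' + z * (norm Z / z) powr q')"
    by (simp add: algebra_simps)
  also have "\<dots> \<le> 2 powr q' * (norm (a *\<^sub>R m) powr q' + C)"
    using z Zb by (intro mult_left_mono add_mono mult_left_le_one_le) auto
  finally have zb: "z * norm b powr q' \<le> 2 powr q' * (norm (a *\<^sub>R m) powr q' + C)" .
  have "p \<bullet> ((a * z) *\<^sub>R (\<psi> *\<^sub>R m) - (\<nu> * \<psi>) *\<^sub>R Z) - norm p powr q * (z * \<psi>)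
      = (z * \<psi>) * (p \<bullet> b - norm p powr q)" unfolding eq by (simp add: algebra_simps)
  also have "\<dots> \<le> (z * \<psi>) * norm b powr q'"
    using Young_inner[OF q, of p b] zp psi by (intro mult_left_mono) (auto simp: q')
  also have "\<dots> = \<psi> * (z * norm b powr q')" by simp
  also have "\<dots> \<le> \<psi> * (2 powr q' * (norm (a *\<^sub>R m) powr q' + C))"
    by (rule mult_left_mono[OF zb psi])
  finally show ?thesis by (simp add: mult_ac)
qed

lemma subsolution_slice_continuous:
  assumes "classical_subsolution \<nu> q U J w" "\<sigma> \<in> J" "A \<subseteq> U"
  shows "continuous_on A (\<lambda>y. w (y, \<sigma>))"
proof -
  have "continuous_on (U \<times> J) w" using assms by (auto simp: classical_subsolution_def C21_on_def)
  then show ?thesis by (rule continuous_on_compose2) (use assms in \<open>auto intro!: continuous_intros\<close>)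
qed

lemma subsolution_slice_integrable:
  fixes w :: "'a::euclidean_space \<times> real \<Rightarrow> real"
  assumes "classical_subsolution \<nu> q U J w" "\<sigma> \<in> J" "compact A" "A \<subseteq> U"
  shows "set_integrable lborel A (\<lambda>y. w (y, \<sigma>))"
  unfolding set_integrable_def
  by (rule borel_integrable_compact[OF assms(3) subsolution_slice_continuous[OF assms(1,2,4)]])

text \<open>
  Duality with \<open>\<psi> = 1\<close>: only the confining drift is paid for, at a bounded rate.
\<close>

lemma local_mass_bound:
  fixes q a b :: real
  assumes q: "1 < q" and ab: "0 < a" "a < b"
  shows "\<exists>C>0. \<forall>\<nu> U J w (x0::'a::euclidean_space) s t. 0 < \<nu> \<and> \<nu> \<le> 1 \<and> open U \<and> cball x0 b \<subseteq> U \<and>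
      {s..t} \<subseteq> J \<and> s \<le> t \<and> classical_subsolution \<nu> q U J w \<longrightarrow>
      (LINT y:cball x0 a|lborel. w (y, t)) \<le> (LINT y:cball x0 b|lborel. w (y, s)) + C * (t - s)"
proof -
  define q' where "q' = q / (q - 1)"
  have q'1: "q' > 1" using q by (simp add: q'_def field_simps)
  obtain C where C: "C > 0" and cut: "\<And>c::'a. \<exists>\<zeta> Z.
    (\<forall>y. (\<zeta> has_derivative (\<lambda>h. Z y \<bullet> h)) (at y)) \<and> continuous_on UNIV Z \<and>
    (\<forall>y. 0 \<le> \<zeta> y \<and> \<zeta> y \<le> 1 \<and> norm (Z y) \<le> C \<and> norm (Z y) powr q' \<le> C * \<zeta> y powr (q' - 1) \<and>
       (norm (y - c) \<le> a \<longrightarrow> \<zeta> y = 1 \<and> Z y = 0) \<and> (b \<le> norm (y - c) \<longrightarrow> \<zeta> y = 0 \<and> Z y = 0))"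
    using cutoff_exists[OF ab q'1, where 'a='a] by blast
  define V where "V = measure lborel (cball (0::'a) b)"
  have V: "measure lborel (cball x b) = V" for x :: 'a
    using ab by (simp add: V_def content_cball)
  define C' where "C' = 2 powr q' * C * V + 1"
  have C': "C' > 0" using C by (simp add: C'_def V_def add_nonneg_pos)
  show ?thesis
  proof (intro exI[of _ C'] conjI C' allI impI; elim conjE)
    fix \<nu> U J w and x0 :: 'a and s t :: real
    assume nu: "0 < \<nu>" "\<nu> \<le> 1" and U: "open U" "cball x0 b \<subseteq> U" and J: "{s..t} \<subseteq> J" "s \<le> t"
      and sub: "classical_subsolution \<nu> q U J w"
    have sJ: "s \<in> J" "t \<in> J" using J by auto
    obtain \<zeta> Z where z: "\<And>y. (\<zeta> has_derivative (\<lambda>h. Z y \<bullet> h)) (at y)" "continuous_on UNIV Z"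
      and z01: "\<And>y. 0 \<le> \<zeta> y" "\<And>y. \<zeta> y \<le> 1" "\<And>y. norm (Z y) powr q' \<le> C * \<zeta> y powr (q' - 1)"
      and zin: "\<And>y. norm (y - x0) \<le> a \<Longrightarrow> \<zeta> y = 1"
      and zout: "\<And>y. b \<le> norm (y - x0) \<Longrightarrow> \<zeta> y = 0 \<and> Z y = 0"
      using cut[of x0] by blast
    have wpos: "0 \<le> w (y, \<sigma>)" if "y \<in> cball x0 b" "\<sigma> \<in> J" for y \<sigma>
      using sub U that by (auto simp: classical_subsolution_def)
    have cz: "continuous_on UNIV \<zeta>"
      using z(1) by (meson continuous_at_imp_continuous_on has_derivative_continuous)
    have out: "y \<notin> cball x0 b \<Longrightarrow> b \<le> norm (y - x0)" for y by (simp add: dist_norm norm_minus_commute)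
    define E where "E \<sigma> y = 2 powr q' * C * indicator (cball x0 b) y" for \<sigma> :: real and y
    have "(LINT y|lborel. w (y, t) * (\<zeta> y * 1)) \<le> (LINT y|lborel. w (y, s) * (\<zeta> y * 1)) + 2 powr q' * C * V * (t - s)"
    proof (rule duality_step[where U = U and J = J and K = "cball x0 b" and P = "\<lambda>_ _. 0" and PP = "\<lambda>_ _ _. 0"
          and a = "\<lambda>_. 0" and \<nu> = \<nu> and q = q and Z = Z and E = E and \<psi> = "\<lambda>_ _. 1"])
      fix \<sigma> y p assume "\<sigma> \<in> {s..t}"
      show "p \<bullet> ((0 * \<zeta> y) *\<^sub>R 0 - (\<nu> * 1) *\<^sub>R Z y) - norm p powr q * (\<zeta> y * 1) \<le> E \<sigma> y"
      proof (cases "y \<in> cball x0 b")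
        case True
        have "p \<bullet> ((0 * \<zeta> y) *\<^sub>R (1 *\<^sub>R 0) - (\<nu> * 1) *\<^sub>R Z y) - norm p powr q * (\<zeta> y * 1)
            \<le> 2 powr q' * 1 * (norm (0 *\<^sub>R (0::'a)) powr q' + C)"
          using nu z01 C by (intro drift_cost_bound[OF q q'_def]) auto
        then show ?thesis using True q'1 by (simp add: E_def)
      next
        case False
        then show ?thesis using zout[OF out[OF False]] by (simp add: E_def)
      qed
    next
      show "integrable lborel (E \<sigma>)" for \<sigma>
        unfolding E_def using emeasure_bounded_finite[OF bounded_cball, of x0 b]
        by (intro integrable_mult_right integrable_real_indicator) auto
      show "(\<nu> + 0) * (LINT y|lborel. w (y, \<sigma>) * (Z y \<bullet> 0)) + integral\<^sup>L lborel (E \<sigma>) \<le> 2 powr q' * C * V" for \<sigma>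
        using V by (simp add: E_def[abs_def])
    qed (use U J sub z z01 zout out in \<open>auto intro!: continuous_intros derivative_eq_intros\<close>)
    then have le: "(LINT y|lborel. w (y, t) * \<zeta> y) \<le> (LINT y|lborel. w (y, s) * \<zeta> y) + 2 powr q' * C * V * (t - s)" by simp
    have int: "integrable lborel (\<lambda>y. w (y, \<sigma>) * \<zeta> y)" if "\<sigma> \<in> J" for \<sigma>
    proof -
      have "integrable lborel (\<lambda>y. indicator (cball x0 b) y *\<^sub>R (w (y, \<sigma>) * \<zeta> y))"
        by (intro borel_integrable_compact continuous_intros continuous_on_subset[OF cz] compact_cball
            subsolution_slice_continuous[OF sub that U(2)] subset_UNIV)
      also have "(\<lambda>y. indicator (cball x0 b) y *\<^sub>R (w (y, \<sigma>) * \<zeta> y)) = (\<lambda>y. w (y, \<sigma>) * \<zeta> y)"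
        using zout out by (auto simp: fun_eq_iff indicator_def)
      finally show ?thesis .
    qed
    have "cball x0 a \<subseteq> U" using U ab by auto
    then have "(LINT y:cball x0 a|lborel. w (y, t)) \<le> (LINT y|lborel. w (y, t) * \<zeta> y)"
      unfolding set_lebesgue_integral_def
    proof (intro integral_mono int sJ)
      show "indicator (cball x0 a) y *\<^sub>R w (y, t) \<le> w (y, t) * \<zeta> y" for y
      proof (cases "y \<in> cball x0 a")
        case True
        then have "norm (y - x0) \<le> a" by (simp add: dist_norm norm_minus_commute)
        then show ?thesis using True zin by simp
      next
        case False
        have "0 \<le> w (y, t) * \<zeta> y"
          using zout[OF out, of y] z01[of y] wpos[OF _ sJ(2), of y] by (cases "y \<in> cball x0 b") auto
        then show ?thesis using False by simp
      qed
    qed (use subsolution_slice_integrable[OF sub sJ(2) compact_cball, of x0 a] in \<open>auto simp: set_integrable_def\<close>)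
    moreover have "(LINT y|lborel. w (y, s) * \<zeta> y) \<le> (LINT y:cball x0 b|lborel. w (y, s))"
      unfolding set_lebesgue_integral_def
      using subsolution_slice_integrable[OF sub sJ(1) compact_cball U(2)]
    proof (intro integral_mono int sJ)
      show "w (y, s) * \<zeta> y \<le> indicator (cball x0 b) y *\<^sub>R w (y, s)" for y
        using zout[OF out, of y] z01[of y] wpos[OF _ sJ(1), of y]
        by (cases "y \<in> cball x0 b") (auto simp: mult_right_le_one_le)
    qed (auto simp: set_integrable_def)
    moreover have "2 powr q' * C * V * (t - s) \<le> C' * (t - s)"
      using J by (intro mult_right_mono) (auto simp: C'_def)
    ultimately show "(LINT y:cball x0 a|lborel. w (y, t)) \<le> (LINT y:cball x0 b|lborel. w (y, s)) + C' * (t - s)"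
      using le by linarith
  qed
qed

text \<open>
  Outside a ball of radius \<open>d\<close> the kernel is at most \<open>exp (- d^2 / (8 \<kappa>))\<close> times the kernel of twice the
  variance, so knowing the total mass is enough.
\<close>

lemma heat_kernel_approximate_identity:
  fixes f :: "'a::euclidean_space \<Rightarrow> real"
  assumes f: "isCont f x" "\<And>y. 0 \<le> f y" and int: "\<And>\<kappa>. 0 < \<kappa> \<Longrightarrow> integrable lborel (\<lambda>y. f y * heat_kernel \<kappa> (y - x))"
    and le: "\<And>\<kappa>. 0 < \<kappa> \<Longrightarrow> (LINT y|lborel. f y * heat_kernel \<kappa> (y - x)) \<le> B"
  shows "f x \<le> B"
proof (rule field_le_epsilon)
  fix e :: real assume e: "e > 0"
  define c where "c = f x - e"
  have B0: "0 \<le> B" using le[of 1] f(2) by (intro order_trans[OF _ le[of 1]] integral_nonneg) (auto simp: heat_kernel_pos less_imp_le)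
  show "f x \<le> B + e"
  proof (cases "c \<le> 0")
    case True then show ?thesis using B0 by (simp add: c_def)
  next
    case False
    obtain d where d: "d > 0" "\<And>y. dist y x < d \<Longrightarrow> dist (f y) (f x) < e"
      using f(1) e unfolding continuous_at_eps_delta by blast
    define k where "k = 2 powr (DIM('a) / 2)"
    have "c - c * (k * exp (- d\<^sup>2 / (8 * \<kappa>))) \<le> B" if \<kappa>: "\<kappa> > 0" for \<kappa>
    proof -
      have pt: "c * heat_kernel \<kappa> (y - x) - c * (k * exp (- d\<^sup>2 / (8 * \<kappa>))) * heat_kernel (2 * \<kappa>) (y - x)
          \<le> f y * heat_kernel \<kappa> (y - x)" for y
      proof (cases "dist y x < d")
        case True
        then have "c \<le> f y" using d(2)[OF True] by (auto simp: c_def dist_real_def)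
        then have "c * heat_kernel \<kappa> (y - x) \<le> f y * heat_kernel \<kappa> (y - x)"
          using heat_kernel_pos[OF \<kappa>, of "y - x"] by (intro mult_right_mono) auto
        moreover have "0 \<le> c * (k * exp (- d\<^sup>2 / (8 * \<kappa>))) * heat_kernel (2 * \<kappa>) (y - x)"
          using heat_kernel_pos[of "2 * \<kappa>" "y - x"] \<kappa> False by (auto simp: k_def)
        ultimately show ?thesis by linarith
      next
        case False': False
        then have "d\<^sup>2 \<le> (norm (y - x))\<^sup>2" using d(1) by (intro power_mono) (auto simp: dist_norm)
        then have "exp (- ((y - x) \<bullet> (y - x)) / (8 * \<kappa>)) \<le> exp (- d\<^sup>2 / (8 * \<kappa>))"
          using \<kappa> by (simp add: dot_square_norm divide_right_mono)
        then have "heat_kernel \<kappa> (y - x) \<le> k * exp (- d\<^sup>2 / (8 * \<kappa>)) * heat_kernel (2 * \<kappa>) (y - x)"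
          using heat_kernel_pos[of "2 * \<kappa>" "y - x"] \<kappa>
          by (subst heat_kernel_double[OF \<kappa>]) (auto simp: k_def intro!: mult_right_mono)
        then have "c * heat_kernel \<kappa> (y - x) \<le> c * (k * exp (- d\<^sup>2 / (8 * \<kappa>)) * heat_kernel (2 * \<kappa>) (y - x))"
          using False by (intro mult_left_mono) auto
        moreover have "0 \<le> f y * heat_kernel \<kappa> (y - x)" using f(2)[of y] heat_kernel_pos[OF \<kappa>, of "y - x"] by simp
        ultimately show ?thesis by (simp add: mult_ac)
      qed
      have 2: "2 * \<kappa> > 0" using \<kappa> by simp
      have "(LINT y|lborel. c * heat_kernel \<kappa> (y - x) - c * (k * exp (- d\<^sup>2 / (8 * \<kappa>))) * heat_kernel (2 * \<kappa>) (y - x))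
          \<le> (LINT y|lborel. f y * heat_kernel \<kappa> (y - x))"
        by (intro integral_mono pt int \<kappa> Bochner_Integration.integrable_diff integrable_mult_right heat_kernel_shift 2)
      then show ?thesis using heat_kernel_shift[OF \<kappa>, of x] heat_kernel_shift[OF 2, of x] le[OF \<kappa>] by simp
    qed
    then have "eventually (\<lambda>\<kappa>. c - c * (k * exp (- d\<^sup>2 / (8 * \<kappa>))) \<le> B) (at_right 0)"
      by (auto simp: eventually_at_right_less eventually_at intro!: exI[of _ 1])
    moreover have "((\<lambda>\<kappa>. c - c * (k * exp (- d\<^sup>2 / (8 * \<kappa>)))) \<longlongrightarrow> c - c * (k * 0)) (at_right 0)"
    proof -
      have "filterlim (\<lambda>\<kappa>. inverse \<kappa> * (d\<^sup>2 / 8)) at_top (at_right (0::real))"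
        using d by (intro filterlim_at_top_mult_tendsto_pos[OF tendsto_const] filterlim_inverse_at_top_right) auto
      then have "filterlim (\<lambda>\<kappa>. - (d\<^sup>2 / (8 * \<kappa>))) at_bot (at_right (0::real))"
        by (subst filterlim_uminus_at_top[symmetric]) (simp add: field_simps)
      then have "((\<lambda>\<kappa>. exp (- (d\<^sup>2 / (8 * \<kappa>)))) \<longlongrightarrow> 0) (at_right 0)"
        by (rule filterlim_compose[OF exp_at_bot])
      then have "((\<lambda>\<kappa>. c - c * (k * exp (- (d\<^sup>2 / (8 * \<kappa>))))) \<longlongrightarrow> c - c * (k * 0)) (at_right 0)"
        by (intro tendsto_diff tendsto_const tendsto_mult_left)
      then show ?thesis by simp
    qed
    ultimately have "c \<le> B"
      by (intro tendsto_upperbound[where F="at_right (0::real)"]) auto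
    then show ?thesis by (simp add: c_def)
  qed
qed

text \<open>
  Controls a linear quantity by an \<open>R\<close>-th power at a free level \<open>A\<close>; integrated, it takes the place of
  Hoelder's inequality.
\<close>

lemma le_level_plus_powr:
  fixes w A R :: real
  assumes "0 < A" "1 \<le> R"
  shows "w \<le> A + A powr (1 - R) * w powr R"
proof (cases "w \<le> A")
  case True
  then show ?thesis by (simp add: add_increasing2)
next
  case False
  have "w = w powr (1 - R) * w powr R" using False assms by (simp add: powr_add[symmetric])
  also have "\<dots> \<le> A powr (1 - R) * w powr R"
    using False assms by (intro mult_right_mono powr_mono2') auto
  finally show ?thesis using assms by linarith
qed

text \<open>
  Duality with a Gaussian of variance \<open>S \<sigma> = \<kappa> + \<nu> (t - \<sigma>) + r^2 ((t - \<sigma>) / (t - s))^2\<close> centred at \<open>x\<close>.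
  The linear term is the free diffusion. The quadratic term is the transport: it spreads the Gaussian
  to width at least \<open>r\<close> at time \<open>s\<close>, where the density is at most \<open>r^(-N)\<close>, and its speed \<open>a\<close> satisfies
  \<open>a / sqrt S \<le> 2 r / (t - s)\<close>, so the drift costs \<open>r^q' (t - s)^(1 - q')\<close> in total. The cutoff
  contributes the term with the local mass \<open>M\<close>. Finally \<open>\<kappa>\<close> tends to \<open>0\<close>.
\<close>

lemma local_pointwise_bound:
  fixes q \<eta> :: real
  assumes q: "1 < q" and eta: "0 < a0" "a0 < b0"
  shows "\<exists>C>0. \<forall>\<nu> U J w (x::'a::euclidean_space) s t r A R M. 0 < \<nu> \<and> \<nu> \<le> 1 \<and> open U \<and> cball x b0 \<subseteq> U \<and>
      {s..t} \<subseteq> J \<and> s < t \<and> classical_subsolution \<nu> q U J w \<and> 0 < r \<and> 0 < A \<and> 1 \<le> R \<and>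
      (\<forall>\<sigma>\<in>{s..t}. (LINT y:cball x b0|lborel. w (y, \<sigma>)) \<le> M) \<longrightarrow>
      w (x, t) \<le> A + A powr (1 - R) * r powr (- real DIM('a)) * (LINT y:cball x b0|lborel. w (y, s) powr R)
        + C * ((t - s) + r\<^sup>2) * M + C * ((t - s) + r powr (q / (q - 1)) * (t - s) powr (1 - q / (q - 1)))"
proof -
  define q' where "q' = q / (q - 1)"
  have q'1: "q' > 1" using q by (simp add: q'_def field_simps)
  obtain Cz where Cz: "Cz > 0" and cut: "\<And>c::'a. \<exists>\<zeta> Z.
    (\<forall>y. (\<zeta> has_derivative (\<lambda>h. Z y \<bullet> h)) (at y)) \<and> continuous_on UNIV Z \<and>
    (\<forall>y. 0 \<le> \<zeta> y \<and> \<zeta> y \<le> 1 \<and> norm (Z y) \<le> Cz \<and> norm (Z y) powr q' \<le> Cz * \<zeta> y powr (q' - 1) \<and>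
       (norm (y - c) \<le> a0 \<longrightarrow> \<zeta> y = 1 \<and> Z y = 0) \<and> (b0 \<le> norm (y - c) \<longrightarrow> \<zeta> y = 0 \<and> Z y = 0))"
    using cutoff_exists[OF eta q'1, where 'a='a] by blast
  obtain Cm where Cm: "Cm > 0" and mom: "\<And>s (y::'a). s > 0 \<Longrightarrow>
      (norm y / sqrt s) powr q' * heat_kernel s y \<le> Cm * heat_kernel (2 * s) y"
    using heat_kernel_moment[of q', where 'a='a] q'1 by auto
  obtain Cg where Cg: "Cg > 0" and away: "\<And>s (y::'a). s > 0 \<Longrightarrow> a0 \<le> norm y \<Longrightarrow> norm y / s * heat_kernel s y \<le> Cg"
    using heat_kernel_gradient_away[of a0, where 'a='a] eta by auto
  define C1 where "C1 = 2 * (Cz * Cg)"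
  define C2 where "C2 = 2 powr q' * (Cz + 2 powr q' * Cm)"
  define C where "C = C1 + C2"
  have C1: "C1 > 0" and C2: "C2 > 0" using Cz Cg Cm by (auto simp: C1_def C2_def intro!: mult_pos_pos add_pos_pos)
  have C: "C > 0" using C1 C2 by (simp add: C_def)
  show ?thesis unfolding q'_def[symmetric]
  proof (intro exI[of _ C] conjI C allI impI; elim conjE)
    fix \<nu> U J w and x :: 'a and s t r A R M :: real
    assume nu: "0 < \<nu>" "\<nu> \<le> 1" and U: "open U" "cball x b0 \<subseteq> U" and J: "{s..t} \<subseteq> J" and st: "s < t"
      and sub: "classical_subsolution \<nu> q U J w" and r: "0 < r" and A: "0 < A" and R: "1 \<le> R"
      and M: "\<forall>\<sigma>\<in>{s..t}. (LINT y:cball x b0|lborel. w (y, \<sigma>)) \<le> M"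
    define l where "l = t - s"
    have l: "l > 0" using st by (simp add: l_def)
    have sJ: "s \<in> J" "t \<in> J" using J st by auto
    obtain \<zeta> Z where z: "\<And>y. (\<zeta> has_derivative (\<lambda>h. Z y \<bullet> h)) (at y)" "continuous_on UNIV Z"
      and z01: "\<And>y. 0 \<le> \<zeta> y" "\<And>y. \<zeta> y \<le> 1" "\<And>y. norm (Z y) powr q' \<le> Cz * \<zeta> y powr (q' - 1)" "\<And>y. norm (Z y) \<le> Cz"
      and zin: "\<And>y. norm (y - x) \<le> a0 \<Longrightarrow> \<zeta> y = 1 \<and> Z y = 0"
      and zout: "\<And>y. b0 \<le> norm (y - x) \<Longrightarrow> \<zeta> y = 0 \<and> Z y = 0"
      using cut[of x] by blast
    have out: "y \<notin> cball x b0 \<Longrightarrow> b0 \<le> norm (y - x)" for y by (simp add: dist_norm norm_minus_commute)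
    have wpos: "0 \<le> w (y, \<sigma>)" if "y \<in> cball x b0" "\<sigma> \<in> J" for y \<sigma>
      using sub U that by (auto simp: classical_subsolution_def)
    have cz: "continuous_on UNIV \<zeta>"
      using z(1) by (meson continuous_at_imp_continuous_on has_derivative_continuous)
    have wzcont: "continuous_on UNIV (\<lambda>y. w (y, \<sigma>) * \<zeta> y)" if "\<sigma> \<in> J" for \<sigma>
    proof -
      have c: "continuous_on (U \<times> {\<sigma>}) (\<lambda>z. w (fst z, \<sigma>) * \<zeta> (fst z))"
        by (intro continuous_intros continuous_on_compose2[OF cz]
            continuous_on_compose2[OF subsolution_slice_continuous[OF sub that order_refl]]) auto
      have "continuous_on (UNIV \<times> {\<sigma>}) (\<lambda>z. w (fst z, \<sigma>) * \<zeta> (fst z))"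
        by (rule continuous_on_extend_by_zero[OF U(1) closed_cball U(2) c]) (use zout out in auto)
      from continuous_on_compose2[OF this, of UNIV "\<lambda>y. (y, \<sigma>)"] show ?thesis
        by (simp add: continuous_on_Pair image_subset_iff)
    qed
    have M0: "0 \<le> M"
    proof -
      have "0 \<le> (LINT y:cball x b0|lborel. w (y, s))"
        unfolding set_lebesgue_integral_def by (intro Bochner_Integration.integral_nonneg) (auto simp: indicator_def wpos sJ)
      then show ?thesis using M st by (auto intro: order_trans)
    qed
    \<comment> \<open>The speed of the quadratic part of the variance: \<open>S' = - (\<nu> + a)\<close>.\<close>
    define a where "a \<sigma> = 2 * r\<^sup>2 * (t - \<sigma>) / l\<^sup>2" for \<sigma>
    \<comment> \<open>An upper bound, independent of \<open>\<sigma>\<close> and \<open>\<kappa>\<close>, for the rate in the duality step.\<close>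
    define K0 where "K0 = (1 + 2 * r\<^sup>2 / l) * (Cz * Cg * M) + C2 * (1 + (r / l) powr q')"
    define I where "I = (LINT y:cball x b0|lborel. w (y, s) powr R)"
    have Iint: "set_integrable lborel (cball x b0) (\<lambda>y. w (y, s) powr R)"
      unfolding set_integrable_def
      by (intro borel_integrable_compact compact_cball continuous_on_powr' continuous_intros
          subsolution_slice_continuous[OF sub sJ(1) U(2)]) (use R wpos sJ in auto)
    have main: "(LINT y|lborel. w (y, t) * \<zeta> y * heat_kernel \<kappa> (y - x)) \<le>
        A + A powr (1 - R) * r powr (- real DIM('a)) * I + K0 * l"
      and mainint: "integrable lborel (\<lambda>y. w (y, t) * \<zeta> y * heat_kernel \<kappa> (y - x))" if \<kappa>: "\<kappa> > 0" for \<kappa>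
    proof -
      define S where "S \<sigma> = \<kappa> + \<nu> * (t - \<sigma>) + r\<^sup>2 * ((t - \<sigma>) / l)\<^sup>2" for \<sigma>
      have S: "S \<sigma> \<ge> \<kappa>" "S \<sigma> > 0" if "\<sigma> \<in> {s..t}" for \<sigma>
        using that nu \<kappa> by (auto simp: S_def intro!: add_pos_nonneg)
      have S2: "S \<sigma> \<ge> (r * ((t - \<sigma>) / l))\<^sup>2" if "\<sigma> \<in> {s..t}" for \<sigma>
        using mult_nonneg_nonneg[of \<nu> "t - \<sigma>"] that nu \<kappa> by (simp add: S_def power_mult_distrib power_divide)
      have S': "(S has_field_derivative - (\<nu> + a \<sigma>)) (at \<sigma> within {s..t})" for \<sigma>
        unfolding S_def a_def using l by (auto intro!: derivative_eq_intros simp: power2_eq_square field_simps)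
      have Ss: "S s \<ge> r\<^sup>2" using S2[of s] st l by (simp add: l_def)
      have Scont: "continuous_on {s..t} S" using S' by (rule DERIV_continuous_on)
      define \<psi> where "\<psi> \<sigma> y = heat_kernel (S \<sigma>) (y - x)" for \<sigma> y
      define P where "P \<sigma> y = \<psi> \<sigma> y *\<^sub>R ((- 1 / (2 * S \<sigma>)) *\<^sub>R (y - x))" for \<sigma> y
      define PP where "PP i \<sigma> y = (((y - x) \<bullet> i)\<^sup>2 / (4 * (S \<sigma>)\<^sup>2) - 1 / (2 * S \<sigma>)) * \<psi> \<sigma> y" for i \<sigma> y
      define E where "E \<sigma> y = 2 powr q' * (Cz * \<psi> \<sigma> y + (a \<sigma> / sqrt (S \<sigma>)) powr q' * (Cm * heat_kernel (2 * S \<sigma>) (y - x)))" for \<sigma> y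
      have a0: "0 \<le> a \<sigma>" if "\<sigma> \<in> {s..t}" for \<sigma> using that by (simp add: a_def)
      have psipos: "0 < \<psi> \<sigma> y" if "\<sigma> \<in> {s..t}" for \<sigma> y unfolding \<psi>_def by (rule heat_kernel_pos[OF S(2)[OF that]])
      have psi1: "((\<lambda>h. \<psi> \<sigma> (y + h *\<^sub>R i)) has_field_derivative P \<sigma> y \<bullet> i) (at 0)" if "\<sigma> \<in> {s..t}" "i \<in> Basis" for \<sigma> y i
      proof -
        have "S \<sigma> \<noteq> 0" using S(2)[OF that(1)] by simp
        from heat_kernel_deriv_space[OF that(2) this, of "y - x"]
        have "((\<lambda>h. \<psi> \<sigma> (y + h *\<^sub>R i)) has_field_derivative
            (- ((y - x) \<bullet> i) / (2 * S \<sigma>) * \<psi> \<sigma> y)) (at 0)"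
          unfolding \<psi>_def by (simp only: add_diff_eq diff_add_eq)
        then show ?thesis by (rule DERIV_cong) (simp add: P_def)
      qed
      have psi2: "((\<lambda>h. P \<sigma> (y + h *\<^sub>R i) \<bullet> i) has_field_derivative PP i \<sigma> y) (at 0)" if "\<sigma> \<in> {s..t}" "i \<in> Basis" for \<sigma> y i
      proof -
        have "S \<sigma> \<noteq> 0" using S(2)[OF that(1)] by simp
        from heat_kernel_deriv_space2[OF that(2) this, of "y - x"]
        have "((\<lambda>h. - ((y - x + h *\<^sub>R i) \<bullet> i) / (2 * S \<sigma>) * heat_kernel (S \<sigma>) (y - x + h *\<^sub>R i)) has_field_derivative PP i \<sigma> y) (at 0)"
          unfolding PP_def \<psi>_def .
        moreover have "(\<lambda>h. P \<sigma> (y + h *\<^sub>R i) \<bullet> i) = (\<lambda>h. - ((y - x + h *\<^sub>R i) \<bullet> i) / (2 * S \<sigma>) * heat_kernel (S \<sigma>) (y - x + h *\<^sub>R i))"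
        proof
          fix h
          have e: "y + h *\<^sub>R i - x = y - x + h *\<^sub>R i" by simp
          show "P \<sigma> (y + h *\<^sub>R i) \<bullet> i = - ((y - x + h *\<^sub>R i) \<bullet> i) / (2 * S \<sigma>) * heat_kernel (S \<sigma>) (y - x + h *\<^sub>R i)"
            unfolding P_def \<psi>_def e by simp
        qed
        ultimately show ?thesis by simp
      qed
      have psit: "((\<lambda>\<sigma>. \<psi> \<sigma> y) has_field_derivative - (\<nu> + a \<sigma>) * (\<Sum>i\<in>Basis. PP i \<sigma> y)) (at \<sigma> within {s..t})"
        if "\<sigma> \<in> {s..t}" for \<sigma> y
        using DERIV_chain2[OF heat_kernel_deriv_time[OF S(2)[OF that], of "y - x"] S'[of \<sigma>]]
        by (simp add: \<psi>_def PP_def mult.commute)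
      have Sc: "continuous_on (UNIV \<times> {s..t}) (\<lambda>z::'a \<times> real. S (snd z))"
        by (rule continuous_on_compose2[OF Scont]) (auto intro!: continuous_intros)
      have Snz: "S (snd z) \<noteq> 0" if "z \<in> UNIV \<times> {s..t}" for z :: "'a \<times> real" using S(2)[of "snd z"] that by auto
      have cpsi: "continuous_on (UNIV \<times> {s..t}) (\<lambda>z. \<psi> (snd z) (fst z))"
        unfolding \<psi>_def heat_kernel_def using Snz by (intro continuous_intros Sc) auto
      have bd: "(\<nu> + a \<sigma>) * (LINT y|lborel. w (y, \<sigma>) * (Z y \<bullet> P \<sigma> y)) + integral\<^sup>L lborel (E \<sigma>) \<le> K0"
        and Eint: "integrable lborel (E \<sigma>)" if \<sigma>: "\<sigma> \<in> {s..t}" for \<sigma>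
      proof -
        have \<sigma>J: "\<sigma> \<in> J" using J \<sigma> by auto
        have S2p: "2 * S \<sigma> > 0" using S(2)[OF \<sigma>] by simp
        note hk = heat_kernel_shift[OF S(2)[OF \<sigma>], of x] heat_kernel_shift[OF S2p, of x]
        show "integrable lborel (E \<sigma>)" unfolding E_def[abs_def] \<psi>_def using hk by auto
        have "integral\<^sup>L lborel (E \<sigma>) = 2 powr q' * (Cz + (a \<sigma> / sqrt (S \<sigma>)) powr q' * Cm)"
          unfolding E_def[abs_def] \<psi>_def using hk by simp
        also have "\<dots> \<le> C2 * (1 + (r / l) powr q')"
        proof -
          have "a \<sigma> / sqrt (S \<sigma>) \<le> 2 * (r / l)"
          proof (cases "\<sigma> = t")
            case True
            then show ?thesis using r l by (simp add: a_def)
          next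
            case False
            then have th: "t - \<sigma> > 0" using \<sigma> by simp
            have "r * ((t - \<sigma>) / l) \<le> sqrt (S \<sigma>)" using S2[OF \<sigma>] r l th by (intro real_le_rsqrt) auto
            then have "a \<sigma> / sqrt (S \<sigma>) \<le> a \<sigma> / (r * ((t - \<sigma>) / l))"
              using a0[OF \<sigma>] r l th S(2)[OF \<sigma>] by (intro divide_left_mono mult_pos_pos divide_pos_pos) auto
            also have "\<dots> = 2 * (r / l)" using r l th by (simp add: a_def power2_eq_square field_simps)
            finally show ?thesis .
          qed
          then have "(a \<sigma> / sqrt (S \<sigma>)) powr q' \<le> (2 * (r / l)) powr q'"
            using a0[OF \<sigma>] S(2)[OF \<sigma>] q'1 by (intro powr_mono2) auto
          also have "\<dots> = 2 powr q' * (r / l) powr q'" by (rule powr_mult)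
          finally have "Cz + (a \<sigma> / sqrt (S \<sigma>)) powr q' * Cm \<le> Cz + 2 powr q' * (r / l) powr q' * Cm"
            using Cm by (intro add_left_mono mult_right_mono) auto
          also have "\<dots> \<le> (Cz + 2 powr q' * Cm) * (1 + (r / l) powr q')"
            using Cz Cm by (simp add: algebra_simps)
          finally show ?thesis unfolding C2_def by (simp add: mult.assoc mult_left_mono)
        qed
        finally have Eb: "integral\<^sup>L lborel (E \<sigma>) \<le> C2 * (1 + (r / l) powr q')" .
        have ptw: "w (y, \<sigma>) * (Z y \<bullet> P \<sigma> y) \<le> Cz * Cg * (indicator (cball x b0) y *\<^sub>R w (y, \<sigma>))" for y
        proof (cases "norm (y - x) \<le> a0 \<or> b0 \<le> norm (y - x)")
          case True
          then have "Z y = 0" using zin zout by blast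
          then show ?thesis using Cz Cg wpos[of y \<sigma>] \<sigma>J by (auto simp: indicator_def)
        next
          case False
          then have y: "y \<in> cball x b0" "a0 \<le> norm (y - x)" by (auto simp: dist_norm norm_minus_commute)
          have "norm (P \<sigma> y) = norm (y - x) / (2 * S \<sigma>) * \<psi> \<sigma> y"
            unfolding P_def norm_scaleR using psipos[OF \<sigma>, of y] S(2)[OF \<sigma>] by simp
          also have "\<dots> = (norm (y - x) / S \<sigma> * heat_kernel (S \<sigma>) (y - x)) / 2" by (simp add: \<psi>_def)
          also have "\<dots> \<le> Cg" using away[OF S(2)[OF \<sigma>] y(2)] Cg by simp
          finally have "Z y \<bullet> P \<sigma> y \<le> Cz * Cg"
            using norm_cauchy_schwarz[of "Z y" "P \<sigma> y"] z01(4)[of y] Cz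
            by (meson mult_mono norm_ge_zero order_trans less_imp_le)
          then have "w (y, \<sigma>) * (Z y \<bullet> P \<sigma> y) \<le> w (y, \<sigma>) * (Cz * Cg)"
            by (intro mult_left_mono wpos y \<sigma>J)
          then show ?thesis using y by (simp add: mult_ac)
        qed
        have "(LINT y|lborel. w (y, \<sigma>) * (Z y \<bullet> P \<sigma> y)) \<le> Cz * Cg * M"
        proof (cases "integrable lborel (\<lambda>y. w (y, \<sigma>) * (Z y \<bullet> P \<sigma> y))")
          case True
          have "(LINT y|lborel. w (y, \<sigma>) * (Z y \<bullet> P \<sigma> y)) \<le> (LINT y|lborel. Cz * Cg * (indicator (cball x b0) y *\<^sub>R w (y, \<sigma>)))"
            using subsolution_slice_integrable[OF sub \<sigma>J compact_cball U(2)]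
            by (intro integral_mono True ptw) (simp add: set_integrable_def)
          also have "\<dots> = Cz * Cg * (LINT y:cball x b0|lborel. w (y, \<sigma>))" by (simp add: set_lebesgue_integral_def)
          also have "\<dots> \<le> Cz * Cg * M" using M \<sigma> Cz Cg by (intro mult_left_mono) auto
          finally show ?thesis .
        next
          case False
          then show ?thesis using Cz Cg M0 by (simp add: not_integrable_integral_eq)
        qed
        then have "(\<nu> + a \<sigma>) * (LINT y|lborel. w (y, \<sigma>) * (Z y \<bullet> P \<sigma> y)) \<le> (\<nu> + a \<sigma>) * (Cz * Cg * M)"
          using nu a0[OF \<sigma>] by (intro mult_left_mono) auto
        also have "\<dots> \<le> (1 + 2 * r\<^sup>2 / l) * (Cz * Cg * M)"
        proof (intro mult_right_mono add_mono nu)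
          have "a \<sigma> = 2 * r\<^sup>2 / l * ((t - \<sigma>) / l)" by (simp add: a_def power2_eq_square)
          also have "\<dots> \<le> 2 * r\<^sup>2 / l * 1" using \<sigma> l by (intro mult_left_mono) (auto simp: l_def)
          finally show "a \<sigma> \<le> 2 * r\<^sup>2 / l" by simp
        qed (use Cz Cg M0 in auto)
        finally show "(\<nu> + a \<sigma>) * (LINT y|lborel. w (y, \<sigma>) * (Z y \<bullet> P \<sigma> y)) + integral\<^sup>L lborel (E \<sigma>) \<le> K0"
          using Eb by (simp add: K0_def)
      qed
      have Epos: "p \<bullet> ((a \<sigma> * \<zeta> y) *\<^sub>R P \<sigma> y - (\<nu> * \<psi> \<sigma> y) *\<^sub>R Z y) - norm p powr q * (\<zeta> y * \<psi> \<sigma> y) \<le> E \<sigma> y"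
        if \<sigma>: "\<sigma> \<in> {s..t}" for \<sigma> y p
      proof -
        have "p \<bullet> ((a \<sigma> * \<zeta> y) *\<^sub>R P \<sigma> y - (\<nu> * \<psi> \<sigma> y) *\<^sub>R Z y) - norm p powr q * (\<zeta> y * \<psi> \<sigma> y)
            \<le> 2 powr q' * \<psi> \<sigma> y * (norm (a \<sigma> *\<^sub>R ((- 1 / (2 * S \<sigma>)) *\<^sub>R (y - x))) powr q' + Cz)"
          unfolding P_def using nu z01 Cz psipos[OF \<sigma>, of y]
          by (intro drift_cost_bound[OF q q'_def]) (auto simp: less_imp_le)
        also have "\<dots> \<le> E \<sigma> y"
        proof -
          have "norm (a \<sigma> *\<^sub>R ((- 1 / (2 * S \<sigma>)) *\<^sub>R (y - x))) = a \<sigma> / sqrt (S \<sigma>) * (norm (y - x) / sqrt (S \<sigma>)) / 2"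
            unfolding norm_scaleR using a0[OF \<sigma>] S(2)[OF \<sigma>] real_sqrt_mult_self[of "S \<sigma>"] by simp
          also have "\<dots> \<le> a \<sigma> / sqrt (S \<sigma>) * (norm (y - x) / sqrt (S \<sigma>))"
          proof -
            have "0 \<le> a \<sigma> / sqrt (S \<sigma>) * (norm (y - x) / sqrt (S \<sigma>))" using a0[OF \<sigma>] S(2)[OF \<sigma>] by simp
            moreover have "v / 2 \<le> v" if "0 \<le> v" for v :: real using that by simp
            ultimately show ?thesis by blast
          qed
          finally have "norm (a \<sigma> *\<^sub>R ((- 1 / (2 * S \<sigma>)) *\<^sub>R (y - x))) powr q' \<le>
              (a \<sigma> / sqrt (S \<sigma>) * (norm (y - x) / sqrt (S \<sigma>))) powr q'"
            using q'1 by (intro powr_mono2) auto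
          also have "\<dots> = (a \<sigma> / sqrt (S \<sigma>)) powr q' * (norm (y - x) / sqrt (S \<sigma>)) powr q'"
            by (rule powr_mult)
          finally have "\<psi> \<sigma> y * norm (a \<sigma> *\<^sub>R ((- 1 / (2 * S \<sigma>)) *\<^sub>R (y - x))) powr q' \<le>
              \<psi> \<sigma> y * ((a \<sigma> / sqrt (S \<sigma>)) powr q' * (norm (y - x) / sqrt (S \<sigma>)) powr q')"
            using psipos[OF \<sigma>, of y] by (intro mult_left_mono) auto
          also have "\<dots> = (a \<sigma> / sqrt (S \<sigma>)) powr q' * ((norm (y - x) / sqrt (S \<sigma>)) powr q' * \<psi> \<sigma> y)" by simp
          also have "\<dots> \<le> (a \<sigma> / sqrt (S \<sigma>)) powr q' * (Cm * heat_kernel (2 * S \<sigma>) (y - x))"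
            unfolding \<psi>_def by (intro mult_left_mono mom S(2)[OF \<sigma>]) auto
          finally show ?thesis by (simp add: E_def mult.assoc distrib_left mult.commute[of Cz])
        qed
        finally show ?thesis .
      qed
      have dual: "(LINT y|lborel. w (y, t) * (\<zeta> y * \<psi> t y)) \<le> (LINT y|lborel. w (y, s) * (\<zeta> y * \<psi> s y)) + K0 * (t - s)"
      proof (rule duality_step[where U = U and J = J and K = "cball x b0" and P = P and PP = PP
          and a = a and \<nu> = \<nu> and q = q and Z = Z and E = E])
        show "continuous_on (UNIV \<times> {s..t}) (\<lambda>z. P (snd z) (fst z))"
          unfolding P_def using Snz by (intro continuous_intros Sc cpsi) auto
        show "continuous_on (UNIV \<times> {s..t}) (\<lambda>z. PP i (snd z) (fst z))" for i
          unfolding PP_def using Snz by (intro continuous_intros Sc cpsi) auto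
        show "continuous_on {s..t} a" unfolding a_def using l by (intro continuous_intros) auto
      qed (use U J st sub z z01 zout out psi1 psi2 psit cpsi Epos Eint bd psipos in \<open>auto simp: less_imp_le\<close>)
      have psis: "\<psi> s y \<le> r powr (- real DIM('a))" for y
      proof -
        have "\<psi> s y \<le> (4 * pi * S s) powr (- (DIM('a) / 2)) * 1"
          unfolding \<psi>_def heat_kernel_def using S(2)[of s] st by (intro mult_left_mono) auto
        also have "\<dots> \<le> (r\<^sup>2) powr (- (DIM('a) / 2))"
        proof -
          have "1 * r\<^sup>2 \<le> (4 * pi) * S s" using Ss pi_gt3 r by (intro mult_mono) auto
          then show ?thesis using r by (simp, intro powr_mono2') auto
        qed
        also have "\<dots> = r powr (- real DIM('a))"
          using r by (simp add: powr_powr powr_realpow[symmetric] del: powr_numeral)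
        finally show ?thesis .
      qed
      have sst: "s \<in> {s..t}" "t \<in> {s..t}" using st by auto
      have int: "integrable lborel (\<lambda>y. w (y, \<sigma>) * \<zeta> y * \<psi> \<sigma> y)" if \<sigma>: "\<sigma> \<in> {s..t}" for \<sigma>
      proof (rule integrable_continuous_compact_support[OF _ compact_cball[of x b0]])
        have "continuous_on UNIV (\<psi> \<sigma>)"
          using continuous_on_compose2[OF cpsi, of UNIV "\<lambda>y. (y, \<sigma>)"] \<sigma>
          by (simp add: continuous_on_Pair image_subset_iff)
        then show "continuous_on UNIV (\<lambda>y. w (y, \<sigma>) * \<zeta> y * \<psi> \<sigma> y)"
          using continuous_on_mult[OF wzcont[of \<sigma>]] J \<sigma> by auto
      qed (use zout out in auto)
      have "(LINT y|lborel. w (y, s) * \<zeta> y * \<psi> s y) \<le>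
          (LINT y|lborel. A * \<psi> s y + A powr (1 - R) * r powr (- real DIM('a)) * (indicator (cball x b0) y *\<^sub>R w (y, s) powr R))"
      proof (intro integral_mono int sst Bochner_Integration.integrable_add integrable_mult_right)
        show "integrable lborel (\<psi> s)" unfolding \<psi>_def by (rule heat_kernel_shift(1)[OF S(2)[OF sst(1)]])
        show "integrable lborel (\<lambda>y. indicator (cball x b0) y *\<^sub>R w (y, s) powr R)" using Iint by (simp add: set_integrable_def)
        show "w (y, s) * \<zeta> y * \<psi> s y \<le> A * \<psi> s y + A powr (1 - R) * r powr (- real DIM('a)) * (indicator (cball x b0) y *\<^sub>R w (y, s) powr R)" for y
        proof (cases "y \<in> cball x b0")
          case True
          have "w (y, s) * \<zeta> y * \<psi> s y \<le> w (y, s) * \<psi> s y"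
            using wpos[OF True sJ(1)] z01[of y] psipos[OF sst(1), of y] by (intro mult_right_mono) (auto simp: mult_right_le_one_le)
          also have "\<dots> \<le> (A + A powr (1 - R) * w (y, s) powr R) * \<psi> s y"
            using le_level_plus_powr[OF A R, of "w (y, s)"] psipos[OF sst(1), of y] by (intro mult_right_mono) auto
          also have "\<dots> = A * \<psi> s y + A powr (1 - R) * w (y, s) powr R * \<psi> s y" by (simp add: algebra_simps)
          also have "\<dots> \<le> A * \<psi> s y + A powr (1 - R) * w (y, s) powr R * r powr (- real DIM('a))"
            using psis[of y] by (intro add_left_mono mult_left_mono) auto
          finally show ?thesis using True by (simp add: mult_ac)
        next
          case False
          then show ?thesis using zout[OF out[OF False]] A psipos[OF sst(1), of y] by simp
        qed
      qed
      also have "\<dots> = A + A powr (1 - R) * r powr (- real DIM('a)) * I"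
        using heat_kernel_shift[OF S(2)[OF sst(1)], of x] Iint
        by (simp add: \<psi>_def I_def set_integrable_def set_lebesgue_integral_def)
      finally have init: "(LINT y|lborel. w (y, s) * \<zeta> y * \<psi> s y) \<le> A + A powr (1 - R) * r powr (- real DIM('a)) * I" .
      have Stk: "S t = \<kappa>" by (simp add: S_def)
      show "(LINT y|lborel. w (y, t) * \<zeta> y * heat_kernel \<kappa> (y - x)) \<le>
        A + A powr (1 - R) * r powr (- real DIM('a)) * I + K0 * l"
        using dual init by (simp add: \<psi>_def Stk l_def mult.assoc)
      show "integrable lborel (\<lambda>y. w (y, t) * \<zeta> y * heat_kernel \<kappa> (y - x))"
        using int[OF sst(2)] by (simp add: \<psi>_def Stk)
    qed
    have "w (x, t) * \<zeta> x \<le> A + A powr (1 - R) * r powr (- real DIM('a)) * I + K0 * l"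
    proof (rule heat_kernel_approximate_identity[where f = "\<lambda>y. w (y, t) * \<zeta> y"])
      show "isCont (\<lambda>y. w (y, t) * \<zeta> y) x" using wzcont[OF sJ(2)] by (simp add: continuous_on_eq_continuous_at)
      show "0 \<le> w (y, t) * \<zeta> y" for y
        using wpos[OF _ sJ(2), of y] z01(1)[of y] zout[OF out, of y] by (cases "y \<in> cball x b0") auto
    qed (use main mainint in auto)
    moreover have "\<zeta> x = 1" using zin[of x] eta by simp
    moreover have "K0 * l \<le> C * (l + r\<^sup>2) * M + C * (l + r powr q' * l powr (1 - q'))"
    proof -
      have 1: "(r / l) powr q' * l = r powr q' * l powr (1 - q')"
        using r l by (simp add: powr_divide powr_diff)
      have "K0 * l = (l + 2 * r\<^sup>2) * (Cz * Cg * M) + C2 * (l + (r / l) powr q' * l)"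
        using l by (simp add: K0_def field_simps)
      also have "\<dots> = (l + 2 * r\<^sup>2) * (Cz * Cg * M) + C2 * (l + r powr q' * l powr (1 - q'))" unfolding 1 ..
      also have "\<dots> \<le> C * (l + r\<^sup>2) * M + C * (l + r powr q' * l powr (1 - q'))"
      proof (intro add_mono mult_right_mono)
        have "(l + 2 * r\<^sup>2) * (Cz * Cg * M) \<le> (2 * l + 2 * r\<^sup>2) * (Cz * Cg * M)"
          using l Cz Cg M0 by (intro mult_right_mono) auto
        also have "\<dots> = C1 * (l + r\<^sup>2) * M" by (simp add: C1_def algebra_simps)
        also have "\<dots> \<le> C * (l + r\<^sup>2) * M" using l M0 C2 by (intro mult_right_mono) (auto simp: C_def)
        finally show "(l + 2 * r\<^sup>2) * (Cz * Cg * M) \<le> C * (l + r\<^sup>2) * M" .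
      qed (use l C1 in \<open>auto simp: C_def\<close>)
      finally show ?thesis .
    qed
    ultimately show "w (x, t) \<le> A + A powr (1 - R) * r powr (- real DIM('a)) * (LINT y:cball x b0|lborel. w (y, s) powr R)
        + C * (t - s + r\<^sup>2) * M + C * (t - s + r powr q' * (t - s) powr (1 - q'))"
      by (simp add: I_def l_def)
  qed
qed

text \<open>
  The constant is to be uniform in the viscosity, the domain, the subsolution, the centre, the times
  and the scale \<open>r\<close>. Naming the property allows it to be passed as a single hypothesis.
\<close>

definition subsolution_constant ::
    "'a::euclidean_space itself \<Rightarrow> real \<Rightarrow> real \<Rightarrow> real \<Rightarrow> real \<Rightarrow> real \<Rightarrow> bool" where
  "subsolution_constant _ q \<eta> \<tau> R C \<longleftrightarrow>
     (\<forall>\<nu> U J w (x0::'a) s t r m. 0 < \<nu> \<and> \<nu> \<le> 1 \<and> open U \<and> cball x0 (7 * \<eta> / 8) \<subseteq> U \<and>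
      {s..t} \<subseteq> J \<and> s < t \<and> t - s \<le> \<tau> \<and> classical_subsolution \<nu> q U J w \<and> 0 < r \<and> r \<le> \<eta> \<and> 0 \<le> m \<and>
      (LINT y:cball x0 (7 * \<eta> / 8)|lborel. w (y, s) powr R) \<le> m powr R \<longrightarrow>
      (\<forall>x\<in>ball x0 (\<eta> / 2). w (x, t) \<le> C * (r powr (- (real DIM('a) / R)) * (m + (t - s))
          + r powr (q / (q - 1)) * (t - s) powr (1 - q / (q - 1)))))"

lemma subsolution_constantD:
  fixes x0 :: "'a::euclidean_space"
  assumes "subsolution_constant TYPE('a) q \<eta> \<tau> R C"
    and "0 < \<nu>" "\<nu> \<le> 1" "open U" "cball x0 (7 * \<eta> / 8) \<subseteq> U"
      "{s..t} \<subseteq> J" "s < t" "t - s \<le> \<tau>" "classical_subsolution \<nu> q U J w" "0 < r" "r \<le> \<eta>" "0 \<le> m"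
      "(LINT y:cball x0 (7 * \<eta> / 8)|lborel. w (y, s) powr R) \<le> m powr R" "x \<in> ball x0 (\<eta> / 2)"
  shows "w (x, t) \<le> C * (r powr (- (real DIM('a) / R)) * (m + (t - s)) + r powr (q / (q - 1)) * (t - s) powr (1 - q / (q - 1)))"
  by (rule assms(1)[unfolded subsolution_constant_def, rule_format, of \<nu> U x0 s t J w r m x])
     (simp_all only: assms(2-) simp_thms)

text \<open>
  The local mass needed by \<open>local_pointwise_bound\<close> is supplied by \<open>local_mass_bound\<close>. The level
  \<open>A = r^(-N/R) (m + t - s)\<close> balances the two contributions of the initial data, and the
  remaining errors are of lower order because \<open>r \<le> \<eta>\<close> and \<open>t - s \<le> \<tau>\<close>.
\<close>

lemma subsolution_bound:
  fixes q \<eta> \<tau> R :: real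
  assumes q: "1 < q" and eta: "0 < \<eta>" and tau: "0 < \<tau>" and R: "1 \<le> R"
  shows "\<exists>C>0. subsolution_constant TYPE('a::euclidean_space) q \<eta> \<tau> R C"
proof -
  define q' where "q' = q / (q - 1)"
  define N where "N = real DIM('a)"
  obtain C1 where C1: "C1 > 0" and mass: "\<And>\<nu> U J w (x0::'a) s t. 0 < \<nu> \<Longrightarrow> \<nu> \<le> 1 \<Longrightarrow> open U \<Longrightarrow> cball x0 (7 * \<eta> / 8) \<subseteq> U \<Longrightarrow>
      {s..t} \<subseteq> J \<Longrightarrow> s \<le> t \<Longrightarrow> classical_subsolution \<nu> q U J w \<Longrightarrow>
      (LINT y:cball x0 (3 * \<eta> / 4)|lborel. w (y, t)) \<le> (LINT y:cball x0 (7 * \<eta> / 8)|lborel. w (y, s)) + C1 * (t - s)"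
    using local_mass_bound[OF q, of "3 * \<eta> / 4" "7 * \<eta> / 8", where 'a='a] eta by auto
  obtain C2 where C2: "C2 > 0" and pt: "\<And>\<nu> U J w (x::'a) s t r A R M. 0 < \<nu> \<Longrightarrow> \<nu> \<le> 1 \<Longrightarrow> open U \<Longrightarrow> cball x (\<eta> / 4) \<subseteq> U \<Longrightarrow>
      {s..t} \<subseteq> J \<Longrightarrow> s < t \<Longrightarrow> classical_subsolution \<nu> q U J w \<Longrightarrow> 0 < r \<Longrightarrow> 0 < A \<Longrightarrow> 1 \<le> R \<Longrightarrow>
      (\<forall>\<sigma>\<in>{s..t}. (LINT y:cball x (\<eta> / 4)|lborel. w (y, \<sigma>)) \<le> M) \<Longrightarrow>
      w (x, t) \<le> A + A powr (1 - R) * r powr (- N) * (LINT y:cball x (\<eta> / 4)|lborel. w (y, s) powr R)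
        + C2 * ((t - s) + r\<^sup>2) * M + C2 * ((t - s) + r powr q' * (t - s) powr (1 - q'))"
    using local_pointwise_bound[OF q, of "\<eta> / 8" "\<eta> / 4", where 'a='a] eta unfolding N_def q'_def by auto
  define V where "V = measure lborel (cball (0::'a) (7 * \<eta> / 8))"
  have V: "measure lborel (cball x (7 * \<eta> / 8)) = V" for x :: 'a using eta by (simp add: V_def content_cball)
  have V0: "0 \<le> V" by (simp add: V_def)
  define C3 where "C3 = V + 1 + C1"
  define e where "e = \<eta> powr (N / R)"
  define C where "C = 2 + e * (C2 * C3 * (\<tau> + \<eta>\<^sup>2) + C2) + C2"
  have C3: "C3 > 0" using V0 C1 by (simp add: C3_def)
  have e: "e > 0" using eta by (simp add: e_def)
  have C: "C > 0" unfolding C_def using e C2 C3 tau eta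
    by (intro add_pos_pos mult_pos_pos) (auto intro!: add_pos_pos mult_pos_pos)
  show ?thesis unfolding subsolution_constant_def q'_def[symmetric] N_def[symmetric]
  proof (intro exI[of _ C] conjI C allI impI ballI; elim conjE)
    fix \<nu> U J w and x0 :: 'a and s t r m :: real and x
    assume nu: "0 < \<nu>" "\<nu> \<le> 1" and U: "open U" "cball x0 (7 * \<eta> / 8) \<subseteq> U" and J: "{s..t} \<subseteq> J" and st: "s < t"
      and tau': "t - s \<le> \<tau>" and sub: "classical_subsolution \<nu> q U J w" and r: "0 < r" "r \<le> \<eta>" and m: "0 \<le> m"
      and init: "(LINT y:cball x0 (7 * \<eta> / 8)|lborel. w (y, s) powr R) \<le> m powr R" and x: "x \<in> ball x0 (\<eta> / 2)"
    define l where "l = t - s"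
    have l: "0 < l" "l \<le> \<tau>" using st tau' by (auto simp: l_def)
    define M where "M = m + l"
    have M: "0 < M" "m \<le> M" "l \<le> M" using m l by (auto simp: M_def)
    have sJ: "s \<in> J" using J st by auto
    have wpos: "0 \<le> w (y, \<sigma>)" if "y \<in> U" "\<sigma> \<in> J" for y \<sigma>
      using sub that by (auto simp: classical_subsolution_def)
    have sub1: "cball x (\<eta> / 4) \<subseteq> cball x0 (3 * \<eta> / 4)"
      using x by (intro cball_subset_cball_iff[THEN iffD2] disjI1) (auto simp: dist_commute)
    have sub2: "cball x0 (3 * \<eta> / 4) \<subseteq> cball x0 (7 * \<eta> / 8)" using eta by auto
    have Rint: "set_integrable lborel A (\<lambda>y. w (y, s) powr R)" if "compact A" "A \<subseteq> U" for A
      unfolding set_integrable_def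
      by (intro borel_integrable_compact that continuous_on_powr' continuous_intros
          subsolution_slice_continuous[OF sub sJ that(2)]) (use R wpos sJ that in auto)
    have mR: "m powr R \<le> M powr R" using m M R by (intro powr_mono2) auto
    have mass0: "(LINT y:cball x0 (7 * \<eta> / 8)|lborel. w (y, s)) \<le> (V + 1) * M"
    proof -
      have ci: "set_integrable lborel (cball x0 (7 * \<eta> / 8)) (\<lambda>y. M)"
        unfolding set_integrable_def by (intro borel_integrable_compact compact_cball continuous_intros)
      have ri: "set_integrable lborel (cball x0 (7 * \<eta> / 8)) (\<lambda>y. M powr (1 - R) * w (y, s) powr R)"
        using Rint[OF compact_cball U(2)] by (intro set_integrable_mult_right) auto
      have "(LINT y:cball x0 (7 * \<eta> / 8)|lborel. w (y, s)) \<le>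
          (LINT y:cball x0 (7 * \<eta> / 8)|lborel. M + M powr (1 - R) * w (y, s) powr R)"
        by (intro set_integral_mono subsolution_slice_integrable[OF sub sJ compact_cball U(2)] set_integral_add ci ri le_level_plus_powr M(1) R)
      also have "\<dots> = (LINT y:cball x0 (7 * \<eta> / 8)|lborel. M) + (LINT y:cball x0 (7 * \<eta> / 8)|lborel. M powr (1 - R) * w (y, s) powr R)"
        by (rule set_integral_add[OF ci ri])
      also have "(LINT y:cball x0 (7 * \<eta> / 8)|lborel. M) = V * M"
        using V[of x0] by (simp add: set_lebesgue_integral_def)
      also have "(LINT y:cball x0 (7 * \<eta> / 8)|lborel. M powr (1 - R) * w (y, s) powr R)
          = M powr (1 - R) * (LINT y:cball x0 (7 * \<eta> / 8)|lborel. w (y, s) powr R)" by simp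
      also have "\<dots> \<le> M powr (1 - R) * M powr R" using init mR by (intro mult_left_mono) auto
      also have "\<dots> = M" using M by (simp add: powr_add[symmetric])
      finally show ?thesis by (simp add: algebra_simps)
    qed
    have mono: "(LINT y:A|lborel. f y) \<le> (LINT y:B|lborel. f y)"
      if "A \<subseteq> B" "B \<subseteq> U" "compact A" "set_integrable lborel B f" "\<And>y. y \<in> U \<Longrightarrow> 0 \<le> f y" for A B and f :: "'a \<Rightarrow> real"
    proof -
      have "set_integrable lborel A f"
        by (rule set_integrable_subset[OF that(4) _ that(1)]) (use that(3) in \<open>auto simp: borel_compact\<close>)
      then show ?thesis using that unfolding set_lebesgue_integral_def set_integrable_def
        by (intro integral_mono) (auto simp: indicator_def)
    qed
    have massx: "(LINT y:cball x (\<eta> / 4)|lborel. w (y, \<sigma>)) \<le> C3 * M" if \<sigma>: "\<sigma> \<in> {s..t}" for \<sigma>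
    proof -
      have \<sigma>J: "\<sigma> \<in> J" using \<sigma> J by auto
      have "(LINT y:cball x (\<eta> / 4)|lborel. w (y, \<sigma>)) \<le> (LINT y:cball x0 (3 * \<eta> / 4)|lborel. w (y, \<sigma>))"
        using sub1 sub2 U by (intro mono subsolution_slice_integrable[OF sub \<sigma>J]) (auto intro: wpos \<sigma>J)
      also have "\<dots> \<le> (LINT y:cball x0 (7 * \<eta> / 8)|lborel. w (y, s)) + C1 * (\<sigma> - s)"
        using \<sigma> J by (intro mass[OF nu U _ _ sub]) auto
      also have "\<dots> \<le> (V + 1) * M + C1 * M"
        using mass0 \<sigma> M C1 by (intro add_mono mult_left_mono) (auto simp: l_def)
      finally show ?thesis by (simp add: C3_def algebra_simps)
    qed
    define A where "A = r powr (- (N / R)) * M"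
    have A: "A > 0" using r M by (simp add: A_def)
    have AR: "A powr (1 - R) * r powr (- N) * M powr R = A"
    proof -
      have "A powr R = r powr (- N) * M powr R" using R by (simp add: A_def powr_mult powr_powr)
      moreover have "A powr (1 - R) * A powr R = A" using A by (simp add: powr_add[symmetric])
      ultimately show ?thesis by (simp add: mult.assoc)
    qed
    have "w (x, t) \<le> A + A powr (1 - R) * r powr (- N) * (LINT y:cball x (\<eta> / 4)|lborel. w (y, s) powr R)
        + C2 * ((t - s) + r\<^sup>2) * (C3 * M) + C2 * ((t - s) + r powr q' * (t - s) powr (1 - q'))"
      using sub1 sub2 U(2) massx by (intro pt[OF nu U(1) _ J st sub r(1) A R]) auto
    also have "(LINT y:cball x (\<eta> / 4)|lborel. w (y, s) powr R) \<le> M powr R"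
    proof -
      have "(LINT y:cball x (\<eta> / 4)|lborel. w (y, s) powr R) \<le> (LINT y:cball x0 (7 * \<eta> / 8)|lborel. w (y, s) powr R)"
        using sub1 sub2 U by (intro mono Rint) auto
      then show ?thesis using init mR by linarith
    qed
    then have "A + A powr (1 - R) * r powr (- N) * (LINT y:cball x (\<eta> / 4)|lborel. w (y, s) powr R)
        + C2 * ((t - s) + r\<^sup>2) * (C3 * M) + C2 * ((t - s) + r powr q' * (t - s) powr (1 - q'))
      \<le> A + A powr (1 - R) * r powr (- N) * M powr R
        + C2 * ((t - s) + r\<^sup>2) * (C3 * M) + C2 * ((t - s) + r powr q' * (t - s) powr (1 - q'))"
      by (intro add_mono mult_left_mono order_refl) auto
    also have "\<dots> = 2 * A + C2 * C3 * (l + r\<^sup>2) * M + C2 * l + C2 * (r powr q' * l powr (1 - q'))"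
      unfolding AR l_def[symmetric] by (simp add: algebra_simps)
    also have "\<dots> \<le> 2 * A + C2 * C3 * (\<tau> + \<eta>\<^sup>2) * (e * A) + C2 * (e * A) + C2 * (r powr q' * l powr (1 - q'))"
    proof -
      have "M \<le> e * A"
      proof -
        have "1 = r powr (N / R) * r powr (- (N / R))" using r by (simp add: powr_add[symmetric])
        also have "\<dots> \<le> e * r powr (- (N / R))"
          unfolding e_def using r R by (intro mult_right_mono powr_mono2) (auto simp: N_def)
        finally have "1 * M \<le> e * r powr (- (N / R)) * M" using M by (intro mult_right_mono) auto
        then show ?thesis by (simp add: A_def mult_ac)
      qed
      moreover have "r\<^sup>2 \<le> \<eta>\<^sup>2" using r by (intro power_mono) auto
      ultimately show ?thesis using l M C2 C3 tau
        by (intro add_mono mult_mono mult_left_mono order_refl) (auto intro: order_trans)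
    qed
    also have "\<dots> = (2 + e * (C2 * C3 * (\<tau> + \<eta>\<^sup>2) + C2)) * A + C2 * (r powr q' * l powr (1 - q'))"
      by (simp add: algebra_simps)
    also have "\<dots> \<le> C * A + C * (r powr q' * l powr (1 - q'))"
    proof (intro add_mono mult_right_mono)
      have "0 \<le> e * (C2 * C3 * (\<tau> + \<eta>\<^sup>2) + C2)" using e C2 C3 tau by (intro mult_nonneg_nonneg add_nonneg_nonneg) auto
      then show "C2 \<le> C" by (simp add: C_def)
    qed (use A C2 in \<open>auto simp: C_def\<close>)
    finally show "w (x, t) \<le> C * (r powr (- (N / R)) * (m + (t - s)) + r powr q' * (t - s) powr (1 - q'))"
      by (simp add: A_def M_def l_def algebra_simps)
  qed
qed

section \<open>Optimisation of the spatial scale\<close>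

text \<open>
  With \<open>D = q R + N (q - 1)\<close> the two terms are equal for \<open>r0 = (m + t)^(R (q - 1) / D) t^(R / D)\<close>, and their
  common value is the first term of the bound. If \<open>r0 > \<eta>\<close>, then \<open>r = \<eta>\<close> bounds \<open>v\<close> by a multiple of
  \<open>m + t\<close>, and \<open>(m + t)^(q - 1) t\<close> is bounded below. For \<open>m \<le> t\<close> everything is bounded in terms of \<open>\<tau>\<close>
  and the first term suffices; for \<open>m > t\<close> the lower bound turns \<open>m\<close> into the second term.
\<close>

lemma decay_bound_optimize:
  fixes N q R \<eta> \<epsilon> \<tau> C0 :: real
  assumes q: "1 < q" and R: "1 \<le> R" "q - 1 < R" and pos: "0 < \<eta>" "0 < \<epsilon>" "0 < \<tau>" "0 < C0" "0 < N"
  shows "\<exists>C>0. \<forall>t m v. 0 < t \<and> t \<le> \<tau> \<and> 0 \<le> m \<and>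
     (\<forall>r. 0 < r \<and> r \<le> \<eta> \<longrightarrow> v \<le> C0 * (r powr (- (N / R)) * (m + t) + r powr (q / (q - 1)) * t powr (1 - q / (q - 1))))
     \<longrightarrow> v \<le> decay_bound N q R \<epsilon> C t m"
proof -
  define q' where "q' = q / (q - 1)"
  define D where "D = q * R + N * (q - 1)"
  have D: "D > 0" unfolding D_def using q R pos by (intro add_pos_pos mult_pos_pos) auto
  have R0: "R > 0" and q0: "q - 1 > 0" using R q by auto
  \<comment> \<open>\<open>k\<close> is positive by the hypothesis \<open>q - 1 < R\<close>, and \<open>c\<close> is the lower bound for \<open>(m + t)^(q - 1) t\<close>.\<close>
  define k where "k = 1 / (R + 1 - q)"
  have k: "k > 0" using R by (simp add: k_def)
  define c where "c = \<eta> powr (D / R)"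
  have c: "c > 0" using pos by (simp add: c_def)
  define e where "e = \<eta> powr (- (N / R))"
  have e: "e > 0" using pos by (simp add: e_def)
  define B1 where "B1 = 2 powr (N * (q - 1) / D) * \<tau> powr (N * q / D)"
  define B2 where "B2 = 2 * (2 powr (q - 1) * \<tau> powr \<epsilon> / c) powr k"
  define C where "C = 2 * C0 + 2 * C0 * e * B1 + 2 * C0 * e * B2"
  have B: "B1 > 0" "B2 > 0" using pos c by (auto simp: B1_def B2_def)
  have C: "C > 0" using pos e B by (auto simp: C_def intro!: add_pos_pos mult_pos_pos)
  have parts: "2 * C0 * e * B1 \<ge> 0" "2 * C0 * e * B2 \<ge> 0" "2 * C0 \<ge> 0" using pos e B by auto
  show ?thesis unfolding q'_def[symmetric]
  proof (intro exI[of _ C] conjI C allI impI; elim conjE)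
    fix t m v :: real
    assume t: "0 < t" "t \<le> \<tau>" and m: "0 \<le> m"
      and v: "\<forall>r. 0 < r \<and> r \<le> \<eta> \<longrightarrow> v \<le> C0 * (r powr (- (N / R)) * (m + t) + r powr q' * t powr (1 - q'))"
    define M where "M = m + t"
    have M: "M > 0" using t m by (simp add: M_def)
    define X where "X = t powr (- (N / D)) * M powr (R * q / D)"
    define Y where "Y = t powr ((1 - \<epsilon>) * k) * m powr (R * k)"
    have XY: "0 \<le> X" "0 \<le> Y" by (auto simp: X_def Y_def)
    have goal_eq: "decay_bound N q R \<epsilon> C t m = C * X + C * Y"
      by (simp add: decay_bound_def X_def Y_def D_def M_def k_def add.commute)
    define r0 where "r0 = M powr (R * (q - 1) / D) * t powr (R / D)"
    have r0: "r0 > 0" using M t by (simp add: r0_def)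
    have r01: "r0 powr (- (N / R)) * M = X"
    proof -
      have "r0 powr (- (N / R)) = M powr (- (N * (q - 1) / D)) * t powr (- (N / D))"
      proof -
        have "R * (q - 1) / D * - (N / R) = - (N * (q - 1) / D)" "R / D * - (N / R) = - (N / D)"
          using R0 by simp_all
        then show ?thesis by (simp only: r0_def powr_mult powr_powr)
      qed
      then have "r0 powr (- (N / R)) * M = M powr (- (N * (q - 1) / D)) * M powr 1 * t powr (- (N / D))" using M by simp
      also have "\<dots> = M powr (1 - N * (q - 1) / D) * t powr (- (N / D))" by (simp only: powr_add[symmetric]) simp
      also have "1 - N * (q - 1) / D = R * q / D" using D by (simp add: D_def field_simps)
      finally show ?thesis by (simp add: X_def)
    qed
    have r02: "r0 powr q' * t powr (1 - q') = X"
    proof -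
      have "r0 powr q' = M powr (R * q / D) * t powr (R * q / (D * (q - 1)))"
      proof -
        have "R * (q - 1) / D * q' = R * q / D" "R / D * q' = R * q / (D * (q - 1))"
          using q0 by (simp_all add: q'_def)
        then show ?thesis by (simp only: r0_def powr_mult powr_powr)
      qed
      then have "r0 powr q' * t powr (1 - q') = M powr (R * q / D) * (t powr (R * q / (D * (q - 1)) + (1 - q')))"
        by (simp add: powr_add)
      also have "R * q / (D * (q - 1)) + (1 - q') = - (N / D)"
      proof -
        have eq: "1 - q' = - (1 / (q - 1))" using q0 by (simp add: q'_def field_simps)
        have "R * q / (D * (q - 1)) + (1 - q') = (R * q - D) / (D * (q - 1))"
          unfolding eq using q0 D by (simp add: diff_divide_distrib)
        also have "R * q - D = - (N * (q - 1))" by (simp add: D_def)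
        also have "- (N * (q - 1)) / (D * (q - 1)) = - (N / D)" using q0 by simp
        finally show ?thesis .
      qed
      finally show ?thesis by (simp add: X_def)
    qed
    show "v \<le> decay_bound N q R \<epsilon> C t m"
    proof (cases "r0 \<le> \<eta>")
      case True
      then have "v \<le> C0 * (r0 powr (- (N / R)) * (m + t) + r0 powr q' * t powr (1 - q'))" using v r0 by blast
      then have "v \<le> C0 * (X + X)" unfolding r02 using r01 by (simp add: M_def)
      also have "\<dots> = 2 * C0 * X" by simp
      also have "\<dots> \<le> C * X" using parts XY by (intro mult_right_mono) (auto simp: C_def)
      finally show ?thesis unfolding goal_eq using C XY by (simp add: add_increasing2)
    next
      case False
      have v1: "v \<le> 2 * C0 * e * M"
      proof -
        have "\<eta> powr (q' + N / R) \<le> r0 powr (q' + N / R)" using False pos R0 q0 q by (intro powr_mono2) (auto simp: q'_def)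
        then have "\<eta> powr (q' + N / R) * (t powr (1 - q') * \<eta> powr (- (N / R))) \<le> r0 powr (q' + N / R) * (t powr (1 - q') * \<eta> powr (- (N / R)))"
          by (intro mult_right_mono) auto
        moreover have "\<eta> powr (q' + N / R) * (t powr (1 - q') * \<eta> powr (- (N / R))) = \<eta> powr q' * t powr (1 - q')"
          using pos by (simp add: powr_add powr_minus)
        moreover have "r0 powr (q' + N / R) * (t powr (1 - q') * \<eta> powr (- (N / R))) = M * e"
        proof -
          have "r0 powr (q' + N / R) * t powr (1 - q') = r0 powr (N / R) * (r0 powr q' * t powr (1 - q'))" by (simp add: powr_add)
          also have "\<dots> = r0 powr (N / R) * r0 powr (- (N / R)) * M" unfolding r02 r01[symmetric] by simp
          also have "\<dots> = M" using r0 by (simp add: powr_add[symmetric])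
          finally show ?thesis by (simp add: e_def mult.assoc[symmetric])
        qed
        ultimately have le: "\<eta> powr q' * t powr (1 - q') \<le> e * M" by (simp add: mult.commute)
        have "v \<le> C0 * (e * M + \<eta> powr q' * t powr (1 - q'))" unfolding e_def M_def using v pos(1) by blast
        also have "\<dots> \<le> C0 * (e * M + e * M)" using le pos by (intro mult_left_mono add_left_mono) auto
        finally show ?thesis by (simp add: mult_ac)
      qed
      have Mt: "c \<le> M powr (q - 1) * t"
      proof -
        have "c \<le> r0 powr (D / R)" unfolding c_def using False pos R0 D by (intro powr_mono2) auto
        also have "\<dots> = M powr (q - 1) * t" 
        proof -
          have "R * (q - 1) / D * (D / R) = q - 1" "R / D * (D / R) = 1" using R0 D by simp_all
          then show ?thesis using t by (simp only: r0_def powr_mult powr_powr) simp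
        qed
        finally show ?thesis .
      qed
      show ?thesis
      proof (cases "m \<le> t")
        case True
        have "M = M powr (R * q / D) * M powr (N * (q - 1) / D)"
        proof -
          have "R * q / D + N * (q - 1) / D = 1" using D by (simp add: D_def add_divide_distrib[symmetric] mult.commute)
          then show ?thesis using M by (simp add: powr_add[symmetric])
        qed
        also have "M powr (N * (q - 1) / D) \<le> (2 * t) powr (N * (q - 1) / D)"
          using True M pos q0 D by (intro powr_mono2) (auto simp: M_def)
        also have "(2 * t) powr (N * (q - 1) / D) = 2 powr (N * (q - 1) / D) * (t powr (N * q / D) * t powr (- (N / D)))"
        proof -
          have "N * (q - 1) / D = N * q / D + - (N / D)" by (simp add: diff_divide_distrib right_diff_distrib)
          then have "t powr (N * (q - 1) / D) = t powr (N * q / D) * t powr (- (N / D))" by (simp only: powr_add)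
          then show ?thesis using t by (simp add: powr_mult)
        qed
        also have "\<dots> \<le> 2 powr (N * (q - 1) / D) * (\<tau> powr (N * q / D) * t powr (- (N / D)))"
          using t pos q D by (intro mult_left_mono mult_right_mono powr_mono2) auto
        finally have "M \<le> B1 * X" using M by (simp add: B1_def X_def mult_ac)
        then have "v \<le> 2 * C0 * e * (B1 * X)" using v1 pos e by (meson mult_left_mono order_trans less_imp_le mult_pos_pos zero_less_numeral)
        also have "\<dots> \<le> C * X" using parts XY by (simp add: C_def mult.assoc[symmetric]) (intro mult_right_mono, auto)
        finally show ?thesis unfolding goal_eq using C XY by (simp add: add_increasing2)
      next
        case False
        then have m0: "m > 0" and M2: "M \<le> 2 * m" using t by (auto simp: M_def)
        have "c \<le> (2 * m) powr (q - 1) * t"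
          using Mt M M2 q0 t by (elim order_trans) (intro mult_right_mono powr_mono2, auto)
        also have "\<dots> = 2 powr (q - 1) * m powr (q - 1) * t" using m0 by (simp add: powr_mult)
        finally have "c * m powr (- (q - 1)) \<le> 2 powr (q - 1) * m powr (q - 1) * t * m powr (- (q - 1))"
          by (rule mult_right_mono) simp
        also have "\<dots> = 2 powr (q - 1) * t * (m powr (q - 1) * m powr (- (q - 1)))" by (simp only: mult_ac)
        also have "m powr (q - 1) * m powr (- (q - 1)) = 1" using m0 by (simp only: powr_add[symmetric]) simp
        finally have "m powr (- (q - 1)) \<le> 2 powr (q - 1) * t / c"
          using c by (simp only: pos_le_divide_eq mult_1_right mult.commute[of c])
        also have "t = t powr \<epsilon> * t powr (1 - \<epsilon>)" using t by (simp add: powr_add[symmetric])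
        also have "2 powr (q - 1) * (t powr \<epsilon> * t powr (1 - \<epsilon>)) / c \<le> 2 powr (q - 1) * (\<tau> powr \<epsilon> * t powr (1 - \<epsilon>)) / c"
          using t pos c by (intro divide_right_mono mult_left_mono mult_right_mono powr_mono2) auto
        finally have "(m powr (- (q - 1))) powr k \<le> ((2 powr (q - 1) * \<tau> powr \<epsilon> / c) * t powr (1 - \<epsilon>)) powr k"
          using k by (intro powr_mono2) auto
        also have "\<dots> = (2 powr (q - 1) * \<tau> powr \<epsilon> / c) powr k * t powr ((1 - \<epsilon>) * k)"
          by (simp only: powr_mult[of "2 powr (q - 1) * \<tau> powr \<epsilon> / c"] powr_powr)
        finally have mk: "m powr (- (q - 1) * k) \<le> (2 powr (q - 1) * \<tau> powr \<epsilon> / c) powr k * t powr ((1 - \<epsilon>) * k)"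
          by (simp only: powr_powr)
        have "m = m powr (R * k) * m powr (- (q - 1) * k)"
        proof -
          have "R * k + - (q - 1) * k = (R + 1 - q) * k" by (simp add: algebra_simps)
          also have "\<dots> = 1" using k R by (simp add: k_def)
          finally show ?thesis using m0 by (simp add: powr_add[symmetric])
        qed
        also have "\<dots> \<le> m powr (R * k) * ((2 powr (q - 1) * \<tau> powr \<epsilon> / c) powr k * t powr ((1 - \<epsilon>) * k))"
          by (intro mult_left_mono mk) auto
        finally have "M \<le> B2 * Y" using M2 by (simp add: B2_def Y_def mult_ac)
        then have "v \<le> 2 * C0 * e * (B2 * Y)" using v1 pos e by (meson mult_left_mono order_trans less_imp_le mult_pos_pos zero_less_numeral)
        also have "\<dots> \<le> C * Y" using parts XY by (simp add: C_def mult.assoc[symmetric]) (intro mult_right_mono, auto)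
        finally show ?thesis unfolding goal_eq using C XY by (simp add: add_increasing)
      qed
    qed
  qed
qed

text \<open>
  First the initial time \<open>s\<close> tends to \<open>0\<close> with \<open>\<delta>\<close> fixed, then \<open>\<delta>\<close> tends to \<open>0\<close>.
\<close>

lemma bound_limit_initial_time:
  fixes v C0 \<rho> m c p t :: real
  assumes t: "0 < t"
    and le: "\<And>\<delta>. 0 < \<delta> \<Longrightarrow> \<exists>\<sigma>0>0. \<forall>s. 0 < s \<and> s < \<sigma>0 \<and> s < t \<longrightarrow> v \<le> C0 * (\<rho> * (m + \<delta> + (t - s)) + c * (t - s) powr p)"
  shows "v \<le> C0 * (\<rho> * (m + t) + c * t powr p)"
proof -
  have 1: "v \<le> C0 * (\<rho> * (m + \<delta> + t) + c * t powr p)" if d: "\<delta> > 0" for \<delta>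
  proof -
    obtain s0 where s0: "s0 > 0" "\<And>s. 0 < s \<Longrightarrow> s < s0 \<Longrightarrow> s < t \<Longrightarrow> v \<le> C0 * (\<rho> * (m + \<delta> + (t - s)) + c * (t - s) powr p)"
      using le[OF d] by auto
    have "((\<lambda>s. C0 * (\<rho> * (m + \<delta> + (t - s)) + c * (t - s) powr p)) \<longlongrightarrow> C0 * (\<rho> * (m + \<delta> + (t - 0)) + c * (t - 0) powr p)) (at_right 0)"
      using t by (intro tendsto_intros) auto
    moreover have "eventually (\<lambda>s. v \<le> C0 * (\<rho> * (m + \<delta> + (t - s)) + c * (t - s) powr p)) (at_right 0)"
      unfolding eventually_at_right_field using s0 t by (intro exI[of _ "min s0 t"]) auto
    ultimately show ?thesis by (intro tendsto_lowerbound[where F = "at_right (0::real)"]) auto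
  qed
  have "((\<lambda>\<delta>. C0 * (\<rho> * (m + \<delta> + t) + c * t powr p)) \<longlongrightarrow> C0 * (\<rho> * (m + 0 + t) + c * t powr p)) (at_right 0)"
    by (intro tendsto_intros)
  moreover have "eventually (\<lambda>\<delta>. v \<le> C0 * (\<rho> * (m + \<delta> + t) + c * t powr p)) (at_right 0)"
    unfolding eventually_at_right_field using 1 by (intro exI[of _ 1]) auto
  ultimately show ?thesis by (intro tendsto_lowerbound[where F = "at_right (0::real)"]) auto
qed

section \<open>Smooth compactly supported kernels\<close>

text \<open>
  Infinite differentiability on the line, stated coinductively: \<open>smooth1_family\<close> then proves it by
  exhibiting a set of functions that is closed under differentiation.
\<close>

coinductive smooth1 :: "(real \<Rightarrow> real) \<Rightarrow> bool" where
  "(\<And>x. (f has_field_derivative f' x) (at x)) \<Longrightarrow> smooth1 f' \<Longrightarrow> smooth1 f"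

lemma smooth1_family:
  assumes "f \<in> A" "\<And>h. h \<in> A \<Longrightarrow> \<exists>h'\<in>A. \<forall>x. (h has_field_derivative h' x) (at x)"
  shows "smooth1 f"
  using assms(1)
proof (coinduction arbitrary: f)
  case smooth1
  then show ?case using assms(2) by blast
qed

lemma smooth1_deriv: "smooth1 f \<Longrightarrow> \<exists>f'. smooth1 f' \<and> (\<forall>x. (f has_field_derivative f' x) (at x))"
  by (auto elim: smooth1.cases)

lemma smooth1_affine:
  assumes "smooth1 f"
  shows "smooth1 (\<lambda>x. f (a * x + b))"
proof -
  have "smooth1 (\<lambda>x. 1 * f (a * x + b))"
  proof (rule smooth1_family[of _ "{\<lambda>x. c * f (a * x + b) | c f. smooth1 f}"])
    fix h assume "h \<in> {\<lambda>x. c * f (a * x + b) | c f. smooth1 f}"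
    then obtain c f where h: "h = (\<lambda>x. c * f (a * x + b))" "smooth1 f" by auto
    obtain f' where f': "smooth1 f'" "\<And>x. (f has_field_derivative f' x) (at x)" using smooth1_deriv[OF h(2)] by auto
    have "(h has_field_derivative (c * a) * f' (a * x + b)) (at x)" for x
    proof -
      have "((\<lambda>x. a * x + b) has_field_derivative a) (at x)" by (auto intro!: derivative_eq_intros)
      from DERIV_cmult[OF DERIV_chain2[OF f'(2) this]] show ?thesis
        unfolding h by (rule DERIV_cong) simp
    qed
    then show "\<exists>h'\<in>{\<lambda>x. c * f (a * x + b) | c f. smooth1 f}. \<forall>x. (h has_field_derivative h' x) (at x)"
      using f'(1) by (intro bexI[of _ "\<lambda>x. (c * a) * f' (a * x + b)"]) auto
  next
    show "(\<lambda>x. 1 * f (a * x + b)) \<in> {\<lambda>x. c * f (a * x + b) | c f. smooth1 f}" using assms by blast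
  qed
  then show ?thesis by simp
qed

text \<open>
  The closure of products under the Leibniz rule.
\<close>

inductive_set sums_of_products :: "(real \<Rightarrow> real) set" where
  prod: "smooth1 f \<Longrightarrow> smooth1 g \<Longrightarrow> (\<lambda>x. f x * g x) \<in> sums_of_products"
| add: "f \<in> sums_of_products \<Longrightarrow> g \<in> sums_of_products \<Longrightarrow> (\<lambda>x. f x + g x) \<in> sums_of_products"

lemma smooth1_mult:
  assumes "smooth1 f" "smooth1 g"
  shows "smooth1 (\<lambda>x. f x * g x)"
proof (rule smooth1_family[of _ sums_of_products])
  show "\<exists>h'\<in>sums_of_products. \<forall>x. (h has_field_derivative h' x) (at x)" if "h \<in> sums_of_products" for h
    using that
  proof induction
    case (prod f g)
    obtain f' where f': "smooth1 f'" "\<And>x. (f has_field_derivative f' x) (at x)" using smooth1_deriv[OF prod(1)] by auto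
    obtain g' where g': "smooth1 g'" "\<And>x. (g has_field_derivative g' x) (at x)" using smooth1_deriv[OF prod(2)] by auto
    have "(\<lambda>x. f' x * g x + g' x * f x) \<in> sums_of_products"
      using prod f' g' by (intro sums_of_products.intros)
    then show ?case by (rule bexI[rotated]) (auto intro!: DERIV_mult f' g')
  next
    case (add f g)
    then obtain f' g' where "f' \<in> sums_of_products" "g' \<in> sums_of_products"
      "\<forall>x. (f has_field_derivative f' x) (at x)" "\<forall>x. (g has_field_derivative g' x) (at x)" by auto
    then show ?case by (intro bexI[of _ "\<lambda>x. f' x + g' x"]) (auto intro!: DERIV_add sums_of_products.add)
  qed
qed (rule sums_of_products.prod[OF assms])

definition flat :: "real \<Rightarrow> real" where
  "flat x = (if x > 0 then exp (- 1 / x) else 0)"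

text \<open>
  The functions \<open>p (1 / x) exp (- 1 / x)\<close>, extended by \<open>0\<close>, with \<open>p\<close> a polynomial, are closed under
  differentiation: the derivative has the polynomial \<open>(p - p') X^2\<close>.
\<close>

lemma smooth1_flat: "smooth1 flat"
proof -
  define fl :: "real poly \<Rightarrow> real \<Rightarrow> real" where "fl p x = (if x > 0 then poly p (1 / x) * exp (- 1 / x) else 0)" for p x
  have poly_exp: "((\<lambda>y. poly p y * exp (- y)) \<longlongrightarrow> 0) at_top" for p :: "real poly"
  proof -
    have "((\<lambda>y. \<Sum>i\<le>degree p. coeff p i * (y ^ i / exp y)) \<longlongrightarrow> (\<Sum>i\<le>degree p. coeff p i * 0)) at_top"
      by (intro tendsto_sum tendsto_mult_left tendsto_power_div_exp_0)
    then show ?thesis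
      by (simp add: poly_altdef sum_distrib_right exp_minus divide_inverse mult.assoc)
  qed
  have d: "(fl p has_field_derivative fl ((p - pderiv p) * [:0, 0, 1:]) x) (at x)" for p x
  proof -
    consider "x > 0" | "x < 0" | "x = 0" by linarith
    then show ?thesis
    proof cases
      case 1
      have ev: "eventually (\<lambda>x. fl p x = poly p (1 / x) * exp (- 1 / x)) (nhds x)"
        using eventually_nhds_in_open[of "{0<..}" x] 1 by (auto simp: fl_def elim!: eventually_mono)
      have "((\<lambda>x. poly p (1 / x) * exp (- 1 / x)) has_field_derivative fl ((p - pderiv p) * [:0, 0, 1:]) x) (at x)"
      proof -
        have i: "((\<lambda>x. 1 / x) has_field_derivative - (1 / x\<^sup>2)) (at x)"
          using 1 by (auto intro!: derivative_eq_intros simp: power2_eq_square)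
        have e: "((\<lambda>x. exp (- 1 / x)) has_field_derivative exp (- 1 / x) * (1 / x\<^sup>2)) (at x)"
          using 1 by (auto intro!: derivative_eq_intros simp: power2_eq_square)
        show ?thesis
          by (rule DERIV_cong[OF DERIV_mult[OF DERIV_chain2[OF poly_DERIV i] e]])
             (use 1 in \<open>simp add: fl_def power2_eq_square algebra_simps divide_inverse\<close>)
      qed
      then show ?thesis using DERIV_cong_ev[OF refl ev refl] by simp
    next
      case 2
      have ev: "eventually (\<lambda>x. fl p x = 0) (nhds x)"
        using eventually_nhds_in_open[of "{..<0}" x] 2 by (auto simp: fl_def elim!: eventually_mono)
      have "fl ((p - pderiv p) * [:0, 0, 1:]) x = 0" using 2 by (simp add: fl_def)
      then show ?thesis using DERIV_cong_ev[OF refl ev refl] by simp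
    next
      case 3
      have r: "((\<lambda>h. fl p h / h) \<longlongrightarrow> 0) (at_right 0)"
      proof -
        have "((\<lambda>h. poly (p * [:0, 1:]) (inverse h) * exp (- inverse h)) \<longlongrightarrow> 0) (at_right (0::real))"
          by (rule filterlim_compose[OF poly_exp filterlim_inverse_at_top_right])
        moreover have "eventually (\<lambda>h. poly (p * [:0, 1:]) (inverse h) * exp (- inverse h) = fl p h / h) (at_right 0)"
          unfolding eventually_at_right_field by (intro exI[of _ 1]) (auto simp: fl_def divide_inverse)
        ultimately show ?thesis by (rule Lim_transform_eventually)
      qed
      have l: "((\<lambda>h. fl p h / h) \<longlongrightarrow> 0) (at_left 0)"
        by (rule tendsto_eventually) (auto simp: eventually_at_left_field fl_def intro!: exI[of _ "-1"])
      have "((\<lambda>h. fl p h / h) \<longlongrightarrow> 0) (at 0)" using filterlim_split_at[OF l r] .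
      then show ?thesis unfolding 3 by (simp add: has_field_derivative_iff fl_def)
    qed
  qed
  have "smooth1 (fl 1)"
    by (rule smooth1_family[of _ "range fl"]) (use d in auto)
  moreover have "fl 1 = flat" by (auto simp: fl_def flat_def fun_eq_iff)
  ultimately show ?thesis by simp
qed

definition prod_fn :: "('b::euclidean_space \<Rightarrow> real \<Rightarrow> real) \<Rightarrow> 'b \<Rightarrow> real" where
  "prod_fn F z = (\<Prod>b\<in>Basis. F b (z \<bullet> b))"

text \<open>
  A product of functions of the single coordinates has all its mixed partial derivatives in the same
  class, which makes smoothness on the whole space a one-dimensional matter.
\<close>

definition tensor_smooth :: "('b::euclidean_space \<Rightarrow> real) set" where
  "tensor_smooth = {\<lambda>z. a * prod_fn F z | a F. \<forall>b. smooth1 (F b)}"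

lemma smooth1_continuous:
  assumes "smooth1 f" shows "continuous_on A f"
proof -
  obtain f' where "\<And>x. (f has_field_derivative f' x) (at x)" using smooth1_deriv[OF assms] by blast
  then show ?thesis by (intro DERIV_continuous_on[of _ f f']) (rule has_field_derivative_at_within)
qed

lemma tensor_smooth_continuous:
  assumes "k \<in> tensor_smooth" shows "continuous_on A k"
proof -
  obtain a F where k: "k = (\<lambda>z. a * prod_fn F z)" and F: "\<And>b. smooth1 (F b)"
    using assms by (auto simp: tensor_smooth_def)
  have "continuous_on A (\<lambda>z. F b (z \<bullet> b))" for b
    by (rule continuous_on_compose2[OF smooth1_continuous[OF F, of UNIV]]) (auto intro: continuous_on_inner)
  then show ?thesis unfolding k prod_fn_def by (intro continuous_on_mult continuous_on_const continuous_on_prod)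
qed

lemma tensor_smooth_deriv:
  fixes k :: "'b::euclidean_space \<Rightarrow> real"
  assumes "k \<in> tensor_smooth" "v \<in> Basis"
  shows "pderivative v k \<in> tensor_smooth \<and> (\<forall>z. ((\<lambda>h. k (z + h *\<^sub>R v)) has_field_derivative pderivative v k z) (at 0))"
proof -
  obtain a F where k: "k = (\<lambda>z. a * prod_fn F z)" and F: "\<And>b. smooth1 (F b)"
    using assms(1) by (auto simp: tensor_smooth_def)
  obtain f' where f': "smooth1 f'" "\<And>x. (F v has_field_derivative f' x) (at x)" using smooth1_deriv[OF F] by blast
  have d: "((\<lambda>h. k (z + h *\<^sub>R v)) has_field_derivative a * prod_fn (F(v := f')) z) (at 0)" for z
  proof -
    define c where "c = (\<Prod>b\<in>Basis - {v}. F b (z \<bullet> b))"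
    have 1: "(\<lambda>h. k (z + h *\<^sub>R v)) = (\<lambda>h. a * (F v (z \<bullet> v + h) * c))"
    proof
      fix h
      have "(\<Prod>b\<in>Basis - {v}. F b ((z + h *\<^sub>R v) \<bullet> b)) = c"
        unfolding c_def using assms(2) by (intro prod.cong) (auto simp: inner_add_left inner_Basis)
      then show "k (z + h *\<^sub>R v) = a * (F v (z \<bullet> v + h) * c)"
        unfolding k prod_fn_def using assms(2) by (subst prod.remove[of _ v]) (auto simp: inner_add_left inner_Basis)
    qed
    have "(\<Prod>b\<in>Basis - {v}. (F(v := f')) b (z \<bullet> b)) = c"
      unfolding c_def by (intro prod.cong) auto
    then have 2: "a * prod_fn (F(v := f')) z = a * (f' (z \<bullet> v) * c)"
      unfolding prod_fn_def using assms(2) by (subst prod.remove[of _ v]) auto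
    have "((\<lambda>h. F v (z \<bullet> v + h)) has_field_derivative f' (z \<bullet> v)) (at 0)"
      using f'(2)[of "z \<bullet> v"] DERIV_shift[of "F v" "f' (z \<bullet> v)" 0 "z \<bullet> v"] by (simp add: add.commute)
    from DERIV_cmult[OF DERIV_cmult_right[OF this]] show ?thesis unfolding 1 2 .
  qed
  then have "pderivative v k = (\<lambda>z. a * prod_fn (F(v := f')) z)"
    by (auto simp: pderivative_def fun_eq_iff intro!: DERIV_imp_deriv)
  moreover have "(\<lambda>z. a * prod_fn (F(v := f')) z) \<in> tensor_smooth"
  proof -
    have "\<forall>b. smooth1 ((F(v := f')) b)" using F f'(1) by simp
    then show ?thesis unfolding tensor_smooth_def by blast
  qed
  ultimately show ?thesis using d by simp
qed

lemma tensor_smooth_smooth: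
  fixes k :: "'b::euclidean_space \<Rightarrow> real"
  assumes "k \<in> tensor_smooth" shows "smooth k"
proof -
  have fold: "foldr pderivative vs k \<in> tensor_smooth" if "set vs \<subseteq> Basis" for vs
    using that by (induction vs) (auto simp: assms tensor_smooth_deriv)
  have "C1_along v UNIV f" if "f \<in> tensor_smooth" "v \<in> Basis" for f :: "'b \<Rightarrow> real" and v
    using tensor_smooth_deriv[OF that] tensor_smooth_continuous
    by (auto simp: C1_along_def field_differentiable_def)
  then show ?thesis using fold tensor_smooth_continuous[OF assms] by (auto simp: smooth_def)
qed

lemma tensor_smooth_reflect:
  fixes k :: "'b::euclidean_space \<Rightarrow> real"
  assumes "k \<in> tensor_smooth" shows "(\<lambda>z'. k (z - z')) \<in> tensor_smooth"
proof -
  obtain a F where k: "k = (\<lambda>z. a * prod_fn F z)" and F: "\<And>b. smooth1 (F b)"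
    using assms(1) by (auto simp: tensor_smooth_def)
  have "(\<lambda>z'. k (z - z')) = (\<lambda>z'. a * prod_fn (\<lambda>b y. F b ((- 1) * y + z \<bullet> b)) z')"
    by (simp add: k prod_fn_def inner_diff_left)
  moreover have "smooth1 (\<lambda>y. F b ((- 1) * y + z \<bullet> b))" for b by (rule smooth1_affine[OF F])
  ultimately show ?thesis unfolding tensor_smooth_def by blast
qed

text \<open>
  Test functions on the cylinder restrict to test functions at a fixed time, as needed for the weak
  gradient.
\<close>

lemma tensor_smooth_slice:
  fixes k :: "'a::euclidean_space \<times> real \<Rightarrow> real"
  assumes "k \<in> tensor_smooth" shows "(\<lambda>x. k (x, t)) \<in> tensor_smooth"
proof -
  obtain a F where k: "k = (\<lambda>z. a * prod_fn F z)" and F: "\<And>b. smooth1 (F b)"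
    using assms(1) by (auto simp: tensor_smooth_def)
  have "k (x, t) = (a * F (0, 1) t) * prod_fn (\<lambda>i. F (i, 0)) x" for x
  proof -
    have "prod_fn F (x, t) = (\<Prod>b\<in>(\<lambda>i. (i, 0)) ` Basis. F b ((x, t) \<bullet> b)) * (\<Prod>b\<in>{(0, 1)}. F b ((x, t) \<bullet> b))"
      unfolding prod_fn_def Basis_prod_def by (subst prod.union_disjoint) auto
    also have "(\<Prod>b\<in>(\<lambda>i. (i, 0)) ` Basis. F b ((x, t) \<bullet> b)) = prod_fn (\<lambda>i. F (i, 0)) x"
      unfolding prod_fn_def by (subst prod.reindex) (auto simp: inj_on_def)
    finally show ?thesis by (simp add: k)
  qed
  then show ?thesis using F unfolding tensor_smooth_def by blast
qed

lemma mollifier_exists: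
  assumes d: "0 < d"
  shows "\<exists>k::'b::euclidean_space \<Rightarrow> real. k \<in> tensor_smooth \<and> (\<forall>z. 0 \<le> k z) \<and> (\<forall>z. d \<le> norm z \<longrightarrow> k z = 0)
     \<and> integrable lborel k \<and> integral\<^sup>L lborel k = 1"
proof -
  \<comment> \<open>The norm is at most the sum of the coordinates, so a cube of this half-width lies in the ball.\<close>
  define e where "e = d / real DIM('b)"
  have e: "e > 0" using d by (simp add: e_def)
  define \<beta> where "\<beta> y = flat ((1 / e) * y + 1) * flat ((- 1 / e) * y + 1)" for y
  have b: "smooth1 \<beta>" unfolding \<beta>_def[abs_def] by (intro smooth1_mult smooth1_affine smooth1_flat)
  have b0: "0 \<le> \<beta> y" for y by (simp add: \<beta>_def flat_def)
  have bz: "\<beta> y = 0" if "e \<le> \<bar>y\<bar>" for y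
  proof -
    have "y \<le> - e \<or> e \<le> y" using that by auto
    then have "(1 / e) * y + 1 \<le> 0 \<or> (- 1 / e) * y + 1 \<le> 0" using e by (auto simp: field_simps)
    then show ?thesis by (auto simp: \<beta>_def flat_def)
  qed
  have bp: "0 < \<beta> 0" by (simp add: \<beta>_def flat_def)
  define K :: "'b \<Rightarrow> real" where "K z = prod_fn (\<lambda>_. \<beta>) z" for z
  have K1: "(\<lambda>z. a * K z) \<in> tensor_smooth" for a using b by (auto simp: tensor_smooth_def K_def)
  have Kc: "continuous_on UNIV K" using tensor_smooth_continuous[OF K1[of 1]] by simp
  have K0: "0 \<le> K z" for z by (simp add: K_def prod_fn_def b0 prod_nonneg)
  have Kz: "K z = 0" if "d \<le> norm z" for z
  proof (rule ccontr)
    assume "K z \<noteq> 0"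
    then have "\<bar>z \<bullet> i\<bar> < e" if "i \<in> Basis" for i
      using bz[of "z \<bullet> i"] that by (force simp: K_def prod_fn_def not_le[symmetric])
    then have "(\<Sum>i\<in>Basis. \<bar>z \<bullet> i\<bar>) < (\<Sum>i\<in>(Basis::'b set). e)" by (intro sum_strict_mono) auto
    then show False using norm_le_l1[of z] that by (simp add: e_def)
  qed
  have Ki: "integrable lborel K"
    by (rule integrable_continuous_compact_support[OF Kc compact_cball[of 0 d]]) (auto intro: Kz)
  have "integral\<^sup>L lborel K \<noteq> 0"
  proof
    assume "integral\<^sup>L lborel K = 0"
    then have ae: "AE z in lborel. K z = 0" using integral_nonneg_eq_0_iff_AE[OF Ki] K0 by auto
    have "open {z. K z \<noteq> 0}" using Kc open_Collect_neq[of K "\<lambda>_. 0"] by simp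
    moreover have "0 \<in> {z. K z \<noteq> 0}" using bp by (simp add: K_def prod_fn_def)
    ultimately obtain r where r: "r > 0" "ball 0 r \<subseteq> {z. K z \<noteq> 0}" using open_contains_ball by blast
    have "AE z in lborel. z \<notin> ball (0::'b) r"
    proof (rule AE_mp[OF ae AE_I2], rule impI)
      fix z assume "K z = 0"
      then show "z \<notin> ball (0::'b) r" using r(2) by auto
    qed
    then have "emeasure lborel (ball (0::'b) r) = 0" by (subst (asm) AE_iff_measurable[OF _ refl]) (auto simp: ball_def)
    then have "measure lborel (ball (0::'b) r) = 0" by (simp add: measure_def)
    then show False using content_ball_pos[OF r(1), of "0::'b"] by simp
  qed
  then show ?thesis
    using K1[of "1 / integral\<^sup>L lborel K"] K0 Kz Ki Bochner_Integration.integral_nonneg[of lborel K]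
    by (intro exI[of _ "\<lambda>z. 1 / integral\<^sup>L lborel K * K z"]) auto
qed

section \<open>Convolution\<close>

definition convolve :: "('b::euclidean_space \<Rightarrow> real) \<Rightarrow> ('b \<Rightarrow> real) \<Rightarrow> 'b \<Rightarrow> real" where
  "convolve f k z = (LINT y|lborel. f y * k (z - y))"

lemma integrable_times_bounded_continuous:
  fixes f k :: "'b::euclidean_space \<Rightarrow> real"
  assumes f: "integrable lborel f" and k: "continuous_on UNIV k" and B: "\<And>z. \<bar>k z\<bar> \<le> B"
  shows "integrable lborel (\<lambda>y. f y * k y)"
proof (rule Bochner_Integration.integrable_bound[of lborel "\<lambda>y. B * f y"])
  show "(\<lambda>y. f y * k y) \<in> borel_measurable lborel"
    using f borel_measurable_continuous_onI[OF k] by auto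
  have "\<bar>f y\<bar> * \<bar>k y\<bar> \<le> \<bar>f y\<bar> * B" for y using B[of y] by (intro mult_left_mono) auto
  moreover have "0 \<le> B" using B[of 0] by linarith
  ultimately show "AE y in lborel. norm (f y * k y) \<le> norm (B * f y)" by (auto simp: abs_mult mult.commute)
qed (use f in auto)

lemma convolve_integrable:
  fixes f k :: "'b::euclidean_space \<Rightarrow> real"
  assumes f: "integrable lborel f" and k: "continuous_on UNIV k" and B: "\<And>z. \<bar>k z\<bar> \<le> B"
  shows "integrable lborel (\<lambda>y. f y * k (z - y))"
  by (rule integrable_times_bounded_continuous[OF f _ B])
     (auto intro!: continuous_on_compose2[OF k] continuous_intros)

lemma convolve_continuous:
  fixes f k :: "'b::euclidean_space \<Rightarrow> real" and A :: "'b set"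
  assumes f: "integrable lborel f" and k: "continuous_on UNIV k" and B: "\<And>z. \<bar>k z\<bar> \<le> B"
  shows "continuous_on A (convolve f k)"
  unfolding continuous_on_sequentially
proof (intro allI ballI impI, elim conjE)
  fix X and z :: 'b assume X: "X \<longlonglongrightarrow> z"
  show "(convolve f k \<circ> X) \<longlonglongrightarrow> convolve f k z"
    unfolding convolve_def comp_def
  proof (rule integral_dominated_convergence[where w = "\<lambda>y. B * \<bar>f y\<bar>"])
    show "AE y in lborel. (\<lambda>n. f y * k (X n - y)) \<longlonglongrightarrow> f y * k (z - y)"
    proof (rule AE_I2)
      fix y
      have "isCont k (z - y)" using k by (simp add: continuous_on_eq_continuous_at)
      moreover have "(\<lambda>n. X n - y) \<longlonglongrightarrow> z - y" using X by (intro tendsto_intros)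
      ultimately show "(\<lambda>n. f y * k (X n - y)) \<longlonglongrightarrow> f y * k (z - y)"
        by (intro tendsto_mult_left isCont_tendsto_compose[of _ k])
    qed
    show "AE y in lborel. norm (f y * k (X n - y)) \<le> B * \<bar>f y\<bar>" for n
      using mult_right_mono[OF B abs_ge_zero] by (intro AE_I2) (simp add: abs_mult mult.commute)
  qed (use f convolve_integrable[OF f k B] in \<open>auto intro!: borel_measurable_integrable\<close>)
qed

lemma convolve_deriv:
  fixes f k k' :: "'b::euclidean_space \<Rightarrow> real"
  assumes f: "integrable lborel f" and k: "continuous_on UNIV k" and B: "\<And>z. \<bar>k z\<bar> \<le> B"
    and k': "continuous_on UNIV k'" and B': "\<And>z. \<bar>k' z\<bar> \<le> B'"
    and d: "\<And>z. ((\<lambda>h. k (z + h *\<^sub>R e)) has_field_derivative k' z) (at 0)"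
  shows "((\<lambda>h. convolve f k (z + h *\<^sub>R e)) has_field_derivative convolve f k' z) (at 0)"
  unfolding has_field_derivative_iff tendsto_at_iff_sequentially
proof (intro allI impI)
  fix X :: "nat \<Rightarrow> real" assume X0: "\<forall>i. X i \<in> UNIV - {0}" and X: "X \<longlonglongrightarrow> 0"
  have "(\<lambda>n. LINT y|lborel. f y * ((k ((z - y) + X n *\<^sub>R e) - k (z - y)) / X n)) \<longlonglongrightarrow> convolve f k' z"
    unfolding convolve_def
  proof (rule integral_dominated_convergence[where w = "\<lambda>y. B' * \<bar>f y\<bar>"])
    show "AE y in lborel. (\<lambda>n. f y * ((k ((z - y) + X n *\<^sub>R e) - k (z - y)) / X n)) \<longlonglongrightarrow> f y * k' (z - y)"
    proof (rule AE_I2)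
      fix y
      have "((\<lambda>h. (k ((z - y) + h *\<^sub>R e) - k ((z - y) + 0 *\<^sub>R e)) / (h - 0)) \<longlongrightarrow> k' (z - y)) (at 0)"
        using d[of "z - y"] by (simp add: has_field_derivative_iff)
      then have "((\<lambda>h. (k ((z - y) + h *\<^sub>R e) - k ((z - y) + 0 *\<^sub>R e)) / (h - 0)) \<circ> X) \<longlonglongrightarrow> k' (z - y)"
        unfolding tendsto_at_iff_sequentially using X0 X by blast
      then show "(\<lambda>n. f y * ((k ((z - y) + X n *\<^sub>R e) - k (z - y)) / X n)) \<longlonglongrightarrow> f y * k' (z - y)"
        by (intro tendsto_mult_left) (simp add: comp_def)
    qed
    show "AE y in lborel. norm (f y * ((k ((z - y) + X n *\<^sub>R e) - k (z - y)) / X n)) \<le> B' * \<bar>f y\<bar>" for n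
    proof (rule AE_I2)
      fix y
      define \<phi> where "\<phi> h = k ((z - y) + h *\<^sub>R e)" for h
      have \<phi>': "(\<phi> has_field_derivative k' ((z - y) + h *\<^sub>R e)) (at h)" for h
        unfolding \<phi>_def by (rule has_field_derivative_translate[OF d])
      have "\<bar>\<phi> (X n) - \<phi> 0\<bar> \<le> B' * \<bar>X n - 0\<bar>"
        using field_differentiable_bound[of UNIV \<phi> "\<lambda>h. k' ((z - y) + h *\<^sub>R e)" B' "X n" 0] \<phi>' B' by auto
      then have "\<bar>(k ((z - y) + X n *\<^sub>R e) - k (z - y)) / X n\<bar> \<le> B'"
        using X0 by (simp add: \<phi>_def abs_divide divide_le_eq)
      then have "\<bar>f y\<bar> * \<bar>(k ((z - y) + X n *\<^sub>R e) - k (z - y)) / X n\<bar> \<le> \<bar>f y\<bar> * B'" by (intro mult_left_mono) auto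
      then show "norm (f y * ((k ((z - y) + X n *\<^sub>R e) - k (z - y)) / X n)) \<le> B' * \<bar>f y\<bar>"
        by (simp add: abs_mult mult.commute)
    qed
    have km: "k \<in> borel_measurable borel" by (rule borel_measurable_continuous_onI[OF k])
    have fm: "f \<in> borel_measurable borel" using borel_measurable_integrable[OF f] by simp
    show "(\<lambda>y. f y * ((k ((z - y) + X n *\<^sub>R e) - k (z - y)) / X n)) \<in> borel_measurable lborel" for n
      using km fm by measurable
  qed (use f convolve_integrable[OF f k' B'] in \<open>auto intro!: borel_measurable_integrable\<close>)
  moreover have "(LINT y|lborel. f y * ((k ((z - y) + X n *\<^sub>R e) - k (z - y)) / X n)) =
      (convolve f k (z + X n *\<^sub>R e) - convolve f k z) / X n" for n
  proof -
    have "(convolve f k (z + X n *\<^sub>R e) - convolve f k z) / X n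
        = (LINT y|lborel. (f y * k ((z + X n *\<^sub>R e) - y) - f y * k (z - y)) / X n)"
      unfolding convolve_def by (simp add: convolve_integrable[OF f k B])
    also have "\<dots> = (LINT y|lborel. f y * ((k ((z - y) + X n *\<^sub>R e) - k (z - y)) / X n))"
      by (intro Bochner_Integration.integral_cong refl) (simp add: algebra_simps)
    finally show ?thesis ..
  qed
  ultimately have "(\<lambda>n. (convolve f k (z + X n *\<^sub>R e) - convolve f k z) / X n) \<longlonglongrightarrow> convolve f k' z"
    by (simp only:)
  then show "((\<lambda>y. (convolve f k (z + y *\<^sub>R e) - convolve f k (z + 0 *\<^sub>R e)) / (y - 0)) \<circ> X) \<longlonglongrightarrow> convolve f k' z"
    by (simp add: comp_def)
qed

lemma tensor_smooth_compact_deriv: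
  fixes k :: "'b::euclidean_space \<Rightarrow> real"
  assumes k: "k \<in> tensor_smooth" "\<And>z. d \<le> norm z \<Longrightarrow> k z = 0" and v: "v \<in> Basis"
  shows "d < norm z \<Longrightarrow> pderivative v k z = 0"
proof -
  assume z: "d < norm z"
  have "eventually (\<lambda>h. d < norm (z + h *\<^sub>R v)) (nhds (0::real))"
  proof -
    have "((\<lambda>h. norm (z + h *\<^sub>R v)) \<longlongrightarrow> norm (z + 0 *\<^sub>R v)) (nhds (0::real))"
      by (intro tendsto_intros filterlim_ident)
    from order_tendstoD(1)[OF this, of d] z show ?thesis by simp
  qed
  then have "eventually (\<lambda>h. k (z + h *\<^sub>R v) = 0) (nhds (0::real))"
    by eventually_elim (simp add: k(2))
  from DERIV_cong_ev[OF refl this refl, of "pderivative v k z"] show ?thesis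
    using tensor_smooth_deriv[OF k(1) v] by (metis DERIV_const DERIV_unique)
qed

lemma continuous_compact_support_bounded:
  fixes k :: "'b::euclidean_space \<Rightarrow> real"
  assumes "continuous_on UNIV k" "\<And>z. d < norm z \<Longrightarrow> k z = 0"
  shows "\<exists>B. \<forall>z. \<bar>k z\<bar> \<le> B"
proof -
  have "compact (k ` cball 0 d)"
    using assms(1) by (intro compact_continuous_image) (auto intro: continuous_on_subset)
  then obtain B where "\<forall>y\<in>k ` cball 0 d. norm y \<le> B"
    using compact_imp_bounded[of "k ` cball 0 d"] unfolding bounded_iff by blast
  then have B: "\<And>z. norm z \<le> d \<Longrightarrow> \<bar>k z\<bar> \<le> B" by simp
  have "\<bar>k z\<bar> \<le> max B 0" for z
    using B[of z] assms(2)[of z] by (cases "norm z \<le> d") (auto simp: max_def)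
  then show ?thesis by blast
qed

text \<open>
  Not normalised and not necessarily nonnegative, so that derivatives of kernels are kernels.
\<close>

definition kernels :: "real \<Rightarrow> ('b::euclidean_space \<Rightarrow> real) set" where
  "kernels d = {k \<in> tensor_smooth. \<forall>z. d < norm z \<longrightarrow> k z = 0}"

lemma kernels_continuous: "k \<in> kernels d \<Longrightarrow> continuous_on A k"
  by (simp add: kernels_def tensor_smooth_continuous)

lemma kernels_bounded: "k \<in> kernels d \<Longrightarrow> \<exists>B. \<forall>z. \<bar>k z\<bar> \<le> B"
  by (rule continuous_compact_support_bounded[OF kernels_continuous]) (auto simp: kernels_def)

lemma kernels_deriv:
  assumes "k \<in> kernels d" "v \<in> Basis"
  shows "pderivative v k \<in> kernels d" "((\<lambda>h. k (z + h *\<^sub>R v)) has_field_derivative pderivative v k z) (at 0)"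
proof -
  have k: "k \<in> tensor_smooth" "\<And>z. d < norm z \<Longrightarrow> k z = 0" using assms(1) by (auto simp: kernels_def)
  show "((\<lambda>h. k (z + h *\<^sub>R v)) has_field_derivative pderivative v k z) (at 0)"
    using tensor_smooth_deriv[OF k(1) assms(2)] by blast
  have "pderivative v k z = 0" if "d < norm z" for z
  proof -
    define d' where "d' = (d + norm z) / 2"
    show ?thesis
      by (rule tensor_smooth_compact_deriv[OF k(1) _ assms(2), of d']) (use that k(2) in \<open>auto simp: d'_def field_simps\<close>)
  qed
  then show "pderivative v k \<in> kernels d" using tensor_smooth_deriv[OF k(1) assms(2)] by (auto simp: kernels_def)
qed

lemma convolve_kernel_deriv:
  assumes f: "integrable lborel f" and k: "k \<in> kernels d" and v: "v \<in> Basis"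
  shows "((\<lambda>h. convolve f k (z + h *\<^sub>R v)) has_field_derivative convolve f (pderivative v k) z) (at 0)"
    and "pderivative v (convolve f k) = convolve f (pderivative v k)"
proof -
  obtain B where B: "\<And>z. \<bar>k z\<bar> \<le> B" using kernels_bounded[OF k] by blast
  obtain B' where B': "\<And>z. \<bar>pderivative v k z\<bar> \<le> B'" using kernels_bounded[OF kernels_deriv(1)[OF k v]] by blast
  have d: "((\<lambda>h. convolve f k (z + h *\<^sub>R v)) has_field_derivative convolve f (pderivative v k) z) (at 0)" for z
    by (rule convolve_deriv[OF f kernels_continuous[OF k] B kernels_continuous[OF kernels_deriv(1)[OF k v]] B' kernels_deriv(2)[OF k v]])
  then show "((\<lambda>h. convolve f k (z + h *\<^sub>R v)) has_field_derivative convolve f (pderivative v k) z) (at 0)" .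
  show "pderivative v (convolve f k) = convolve f (pderivative v k)"
    using d by (auto simp: pderivative_def fun_eq_iff intro!: DERIV_imp_deriv)
qed

lemma convolve_kernel_continuous:
  assumes f: "integrable lborel f" and k: "k \<in> kernels d"
  shows "continuous_on A (convolve f k)"
  using kernels_bounded[OF k] convolve_continuous[OF f kernels_continuous[OF k]] by blast

lemma convolve_kernel_integrable:
  assumes f: "integrable lborel f" and k: "k \<in> kernels d"
  shows "integrable lborel (\<lambda>y. f y * k (z - y))"
  using kernels_bounded[OF k] convolve_integrable[OF f kernels_continuous[OF k]] by blast

lemma convolve_C21_on:
  fixes f k :: "'a::euclidean_space \<times> real \<Rightarrow> real"
  assumes f: "integrable lborel f" and k: "k \<in> kernels d"
  shows "C21_on S (convolve f k)"
proof -
  have along: "C1_along v S (convolve f k)" if "k \<in> kernels d" "v \<in> Basis" for k v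
    unfolding C1_along_def convolve_kernel_deriv(2)[OF f that]
    using convolve_kernel_deriv(1)[OF f that] convolve_kernel_continuous[OF f kernels_deriv(1)[OF that]]
    by (auto simp: field_differentiable_def)
  have b: "(0, 1) \<in> (Basis :: ('a \<times> real) set)" "\<And>i. i \<in> Basis \<Longrightarrow> (i, 0) \<in> (Basis :: ('a \<times> real) set)"
    by (auto simp: Basis_prod_def)
  show ?thesis unfolding C21_on_def
    using along[OF k] along[OF kernels_deriv(1)[OF k]] b convolve_kernel_continuous[OF f k]
    by (auto simp: convolve_kernel_deriv(2)[OF f k])
qed

lemma reflected_kernel_deriv:
  assumes k: "k \<in> kernels d" and v: "v \<in> Basis"
  shows "((\<lambda>h. k (z - (y + h *\<^sub>R v))) has_field_derivative - pderivative v k (z - y)) (at 0)"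
proof -
  have "((\<lambda>h. k ((z - y) + h *\<^sub>R v)) has_field_derivative pderivative v k (z - y)) (at (- 0))"
    using kernels_deriv(2)[OF k v] by simp
  then have "((\<lambda>h. k ((z - y) + (- h) *\<^sub>R v)) has_field_derivative - pderivative v k (z - y)) (at 0)"
    by (subst (asm) DERIV_mirror) simp
  then show ?thesis by (simp add: algebra_simps)
qed

lemma pderivative_reflected_kernel:
  assumes k: "k \<in> kernels d" and v: "v \<in> Basis"
  shows "pderivative v (\<lambda>y. k (z - y)) = (\<lambda>y. - pderivative v k (z - y))"
    and "pderivative v (\<lambda>y. - k (z - y)) = (\<lambda>y. pderivative v k (z - y))"
  using reflected_kernel_deriv[OF k v] DERIV_minus[OF reflected_kernel_deriv[OF k v]]
  by (auto simp: pderivative_def fun_eq_iff intro!: DERIV_imp_deriv)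

lemma kernel_reflect_integral:
  fixes k :: "'b::euclidean_space \<Rightarrow> real"
  assumes k1: "integral\<^sup>L lborel k = 1"
  shows "integrable lborel (\<lambda>y. k (z - y))" "(LINT y|lborel. k (z - y)) = 1"
proof -
  have ki: "integrable lborel k" using k1 not_integrable_integral_eq by fastforce
  have e: "distr lborel borel (\<lambda>y. z - y) = (lborel :: 'b measure)"
    using lborel_affine[of "-1" z] by (simp add: density_1)
  have km: "k \<in> borel_measurable borel" using borel_measurable_integrable[OF ki] by simp
  show "integrable lborel (\<lambda>y. k (z - y))"
    using ki km by (subst (asm) e[symmetric], subst (asm) integrable_distr_eq) auto
  show "(LINT y|lborel. k (z - y)) = 1"
    using k1 km by (subst (asm) e[symmetric], subst (asm) integral_distr) auto
qed

section \<open>Mollified weak solutions\<close>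

text \<open>
  Fubini for null sets that need not be Borel.
\<close>

lemma lborel_AE_slice:
  assumes "AE z in (lborel :: ('a::euclidean_space \<times> real) measure). P z"
  shows "AE t in lborel. AE x in lborel. P (x, t)"
proof -
  obtain N where N: "N \<in> null_sets (lborel :: ('a \<times> real) measure)" "{z. \<not> P z} \<subseteq> N"
    using assms unfolding eventually_ae_filter by auto
  have "AE z in lborel \<Otimes>\<^sub>M lborel. z \<notin> N" by (subst lborel_prod) (rule AE_not_in[OF N(1)])
  then have "AE x in lborel. AE t in lborel. (x, t) \<notin> N" by (rule lborel_pair.AE_pair)
  moreover have "{z \<in> space (lborel \<Otimes>\<^sub>M lborel). (fst z, snd z) \<notin> N} \<in> sets (lborel \<Otimes>\<^sub>M lborel)"
  proof -
    have "{z \<in> space (lborel \<Otimes>\<^sub>M lborel). (fst z, snd z) \<notin> N} = - N" by (auto simp: space_pair_measure)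
    moreover have "N \<in> sets borel" using N(1) by auto
    moreover have "sets (lborel \<Otimes>\<^sub>M lborel) = sets (borel :: ('a \<times> real) measure)"
      by (subst lborel_prod) (rule sets_lborel)
    ultimately show ?thesis by (metis borel_comp)
  qed
  ultimately have "AE t in lborel. AE x in lborel. (x, t) \<notin> N"
    using lborel_pair.AE_commute[of "\<lambda>x t. (x, t) \<notin> N"] by simp
  then show ?thesis
  proof eventually_elim
    case (elim t)
    then show ?case by eventually_elim (use N(2) in blast)
  qed
qed

lemma lborel_Fubini:
  fixes f :: "'a::euclidean_space \<times> real \<Rightarrow> real"
  assumes "integrable lborel f"
  shows "integral\<^sup>L lborel f = (LINT t|lborel. LINT x|lborel. f (x, t))"
    and "AE t in lborel. integrable lborel (\<lambda>x. f (x, t))"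
    and "integrable lborel (\<lambda>t. LINT x|lborel. f (x, t))"
proof -
  have i: "integrable (lborel \<Otimes>\<^sub>M lborel) (case_prod (\<lambda>x t. f (x, t)))"
    using assms by (simp add: lborel_prod split_beta')
  show "integral\<^sup>L lborel f = (LINT t|lborel. LINT x|lborel. f (x, t))"
    using lborel_pair.integral_snd[OF i] by (simp add: lborel_prod split_beta')
  show "AE t in lborel. integrable lborel (\<lambda>x. f (x, t))" by (rule lborel_pair.AE_integrable_snd[OF i])
  show "integrable lborel (\<lambda>t. LINT x|lborel. f (x, t))" by (rule lborel_pair.integrable_snd[OF i])
qed

text \<open>
  Weak solutions are only Lebesgue measurable, while the product structure is that of the Borel measure.
\<close>

lemma lebesgue_on_borel_version:
  fixes f :: "'b::euclidean_space \<Rightarrow> real"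
  assumes f: "integrable (lebesgue_on K) f" and K: "K \<in> sets borel"
  shows "\<exists>f'. integrable lborel f' \<and> (AE z in lborel. f' z = indicator K z * f z)"
proof -
  have i: "integrable lebesgue (\<lambda>z. indicator K z * f z)"
    using f K by (subst (asm) integrable_restrict_space) auto
  obtain f' where f': "f' \<in> borel_measurable lborel" "AE z in lborel. indicator K z * f z = f' z"
    using completion_ex_borel_measurable_real[OF borel_measurable_integrable[OF i]] by blast
  have ae: "AE z in lebesgue. indicator K z * f z = f' z" by (rule AE_completion[OF f'(2)])
  have "integrable lebesgue f'"
    using i by (subst (asm) integrable_cong_AE[OF _ _ ae]) (use i f'(1) in \<open>auto intro: measurable_completion\<close>)
  then have "integrable lborel f'" using f'(1) by (simp add: integrable_completion)
  then show ?thesis using f'(2) by (intro exI[of _ f']) auto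
qed

lemma lebesgue_on_integral_eq_lborel:
  fixes F F' :: "'b::euclidean_space \<Rightarrow> real"
  assumes S: "S \<in> sets lebesgue" and F': "F' \<in> borel_measurable borel"
    and ae: "AE z in lborel. z \<in> S \<longrightarrow> F z = F' z" and off: "\<And>z. z \<notin> S \<Longrightarrow> F' z = 0"
  shows "integral\<^sup>L (lebesgue_on S) F = integral\<^sup>L lborel F'"
proof -
  have ae': "AE z in lebesgue. F' z = indicator S z * F z"
    by (rule AE_completion[OF AE_mp[OF ae AE_I2]]) (auto simp: indicator_def off)
  have m': "F' \<in> borel_measurable lebesgue" using F' by (intro measurable_completion) auto
  have m: "(\<lambda>z. indicator S z * F z) \<in> borel_measurable lebesgue" by (rule borel_measurable_AE[OF m' ae'])
  have "integral\<^sup>L (lebesgue_on S) F = (LINT z|lebesgue. indicator S z * F z)"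
    using S by (subst integral_restrict_space) auto
  also have "\<dots> = integral\<^sup>L lebesgue F'"
    by (rule integral_cong_AE[OF m m' AE_mp[OF ae' AE_I2]]) simp
  also have "\<dots> = integral\<^sup>L lborel F'" using F' by (simp add: integral_completion)
  finally show ?thesis .
qed

text \<open>
  The graph of \<open>|g|^q\<close> lies above its tangent plane at \<open>p\<close>. Integrated against a probability density
  with mean \<open>p\<close>, this is Jensen's inequality.
\<close>

lemma powr_norm_tangent:
  fixes p g :: "'a::real_inner"
  assumes q: "1 < q" and p: "p \<noteq> 0"
  shows "(1 - q) * norm p powr q + q * norm p powr (q - 2) * (p \<bullet> g) \<le> norm g powr q"
proof -
  define P a where "P = norm p" and "a = norm g"
  have P: "P > 0" and a: "a \<ge> 0" using p by (auto simp: P_def a_def)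
  have "a * P powr (q - 1) \<le> a powr q / q + (P powr (q - 1)) powr (q / (q - 1)) / (q / (q - 1))"
    using q a P by (intro Youngs_inequality) (auto simp: field_simps)
  also have "(P powr (q - 1)) powr (q / (q - 1)) = P powr q" using q by (simp add: powr_powr)
  finally have "q * (a * P powr (q - 1)) \<le> q * (a powr q / q + P powr q / (q / (q - 1)))"
    using q by (intro mult_left_mono) auto
  also have "\<dots> = a powr q + (q - 1) * P powr q" using q by (simp add: field_simps)
  finally have 1: "q * (a * P powr (q - 1)) \<le> a powr q + (q - 1) * P powr q" .
  have "p \<bullet> g \<le> P * a" unfolding P_def a_def by (rule norm_cauchy_schwarz)
  then have "q * P powr (q - 2) * (p \<bullet> g) \<le> q * P powr (q - 2) * (P * a)"
    using q by (intro mult_left_mono) auto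
  also have "\<dots> = q * (a * P powr (q - 1))"
  proof -
    have "P powr (q - 1) = P powr (q - 2) * P" using P powr_add[of P "q - 2" 1] by simp
    then show ?thesis by simp
  qed
  finally show ?thesis using 1 by (simp add: P_def a_def algebra_simps)
qed

text \<open>
  Inserting \<open>y \<mapsto> k (z - y)\<close> as a test function turns the weak equation into
  \<open>v_t - \<nu> \<Delta>v + |\<nabla>u|^q * k = 0\<close> for \<open>v = u * k\<close>. The weak gradient, used at almost every time, gives
  \<open>\<nabla>v = \<nabla>u * k\<close>, and \<open>|\<nabla>v|^q \<le> |\<nabla>u|^q * k\<close> by convexity. One Borel version \<open>U\<close>, cut off to a compact
  set, serves all kernels.
\<close>

lemma weak_solution_mollified:
  fixes u :: "'a::euclidean_space \<times> real \<Rightarrow> real"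
  assumes weak: "weak_solution \<nu> q \<Omega> T u" and \<Omega>: "open \<Omega>" and A: "compact A" "A \<subseteq> \<Omega>"
    and ab: "0 < a" "ereal b < T" and q: "1 < q"
  shows "\<exists>U. integrable lborel U \<and> (\<forall>z. 0 \<le> U z)
     \<and> (AE t in lborel. AE x in lborel. U (x, t) = indicator (A \<times> {a..b}) (x, t) * u (x, t))
     \<and> (\<forall>k d S J. k \<in> kernels d \<and> (\<forall>z. 0 \<le> k z) \<and> integral\<^sup>L lborel k = 1 \<and> (\<forall>z\<in>S \<times> J. cball z d \<subseteq> A \<times> {a..b})
        \<longrightarrow> classical_subsolution \<nu> q S J (convolve U k))"
proof -
  define K where "K = A \<times> {a..b}"
  let ?cyl = "cylinder \<Omega> T"
  have Kc: "compact K" unfolding K_def by (intro compact_Times A compact_Icc)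
  have Kb: "K \<in> sets borel" using Kc by (intro borel_closed compact_imp_closed)
  have tT: "t \<in> {a..b} \<Longrightarrow> 0 < t \<and> ereal t < T" for t
    using ab by (auto intro: le_less_trans[of _ "ereal b"])
  have Ksub: "K \<subseteq> ?cyl" unfolding K_def cylinder_def using A tT by auto
  have openT: "open {t. 0 < t \<and> ereal t < T}"
    by (cases T) (auto simp: open_Collect_conj open_Collect_less)
  have cylo: "open ?cyl" unfolding cylinder_def by (intro open_Times \<Omega> openT)
  obtain g where u0: "AE z in lebesgue_on ?cyl. 0 \<le> u z"
    and g: "L1_loc_W11_loc \<Omega> T u g" and gq: "loc_integrable ?cyl (\<lambda>z. norm (g z) powr q)"
    and weq: "\<And>\<phi>. \<phi> \<in> test_functions ?cyl \<Longrightarrow> (LINT z|lebesgue_on ?cyl.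
              - u z * pderivative (0, 1) \<phi> z - \<nu> * u z * laplacian_x \<phi> z + norm (g z) powr q * \<phi> z) = 0"
    using weak unfolding weak_solution_def by blast
  have ui: "integrable (lebesgue_on K) u" and gi: "integrable (lebesgue_on K) g"
    and hi: "integrable (lebesgue_on K) (\<lambda>z. norm (g z) powr q)"
    using g gq Kc Ksub unfolding L1_loc_W11_loc_def loc_integrable_def by blast+
  have wg: "AE t in lebesgue_on {t. 0 < t \<and> ereal t < T}. weak_gradient \<Omega> (\<lambda>x. u (x, t)) (\<lambda>x. g (x, t))"
    using g by (simp add: L1_loc_W11_loc_def)
  obtain U0 where U0: "integrable lborel U0" "AE z in lborel. U0 z = indicator K z * u z"
    using lebesgue_on_borel_version[OF ui Kb] by blast
  have "AE z in lebesgue. z \<in> ?cyl \<longrightarrow> 0 \<le> u z"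
    using u0 cylo by (subst (asm) AE_restrict_space_iff) (auto intro: sets_completionI_sets)
  then have upos: "AE z in lborel. z \<in> ?cyl \<longrightarrow> 0 \<le> u z" by (simp add: AE_completion_iff)
  \<comment> \<open>Nonnegative everywhere, so that the mollification is nonnegative without exceptional sets.\<close>
  define U where "U z = max 0 (U0 z)" for z
  have Ui: "integrable lborel U" unfolding U_def using U0(1) by auto
  have Upos: "0 \<le> U z" for z by (simp add: U_def)
  have Uae: "AE z in lborel. U z = indicator K z * u z"
    using U0(2) upos by eventually_elim (use Ksub in \<open>auto simp: U_def indicator_def\<close>)
  have "\<exists>G. \<forall>i\<in>Basis. integrable lborel (G i) \<and> (AE z in lborel. G i z = indicator K z * (g z \<bullet> i))"
    by (rule bchoice) (use lebesgue_on_borel_version[OF _ Kb] integrable_inner_left[OF gi] in blast)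
  then obtain G where G: "\<And>i. i \<in> Basis \<Longrightarrow> integrable lborel (G i)"
    "\<And>i. i \<in> Basis \<Longrightarrow> AE z in lborel. G i z = indicator K z * (g z \<bullet> i)" by blast
  obtain H where H: "integrable lborel H" "AE z in lborel. H z = indicator K z * norm (g z) powr q"
    using lebesgue_on_borel_version[OF hi Kb] by blast
  have Uae': "AE t in lborel. AE x in lborel. U (x, t) = indicator K (x, t) * u (x, t)"
    by (rule lborel_AE_slice[OF Uae])
  have "classical_subsolution \<nu> q S J (convolve U k)"
    if k: "k \<in> kernels d" and kpos: "\<And>z. 0 \<le> k z" and k1: "integral\<^sup>L lborel k = 1"
      and SJ: "\<And>z. z \<in> S \<times> J \<Longrightarrow> cball z d \<subseteq> K" for k d S J
    unfolding classical_subsolution_def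
  proof (intro conjI ballI convolve_C21_on[OF Ui k])
    fix z assume z: "z \<in> S \<times> J"
    have bt: "(0, 1) \<in> (Basis :: ('a \<times> real) set)" and bi: "\<And>i. i \<in> Basis \<Longrightarrow> (i, 0) \<in> (Basis :: ('a \<times> real) set)"
      by (auto simp: Basis_prod_def)
    show "0 \<le> convolve U k z"
      unfolding convolve_def by (intro Bochner_Integration.integral_nonneg mult_nonneg_nonneg Upos kpos)
    have off: "k' (z - y) = 0" if "k' \<in> kernels d" "y \<notin> K" for k' y
    proof -
      have "y \<notin> cball z d" using SJ[OF z] that(2) by blast
      then have "d < norm (z - y)" by (simp add: dist_norm)
      then show ?thesis using that(1) unfolding kernels_def by blast
    qed
    define kt where "kt = pderivative (0, 1) k"
    define ki where "ki i = pderivative (i, 0) k" for i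
    define kii where "kii i = pderivative (i, 0) (ki i)" for i
    have kt: "kt \<in> kernels d" and ki: "\<And>i. i \<in> Basis \<Longrightarrow> ki i \<in> kernels d" and kii: "\<And>i. i \<in> Basis \<Longrightarrow> kii i \<in> kernels d"
      unfolding kt_def ki_def kii_def using kernels_deriv(1)[OF k] kernels_deriv(1)[OF kernels_deriv(1)[OF k]] bt bi by auto
    define \<phi> where "\<phi> y = k (z - y)" for y
    have \<phi>test: "\<phi> \<in> test_functions ?cyl"
    proof -
      have "k \<in> tensor_smooth" using k by (simp add: kernels_def)
      then have "smooth \<phi>" unfolding \<phi>_def by (intro tensor_smooth_smooth tensor_smooth_reflect)
      moreover have "supported_in ?cyl \<phi>" unfolding supported_in_def
        using Kc Ksub off[OF k] by (intro exI[of _ K]) (auto simp: \<phi>_def)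
      ultimately show ?thesis by (simp add: test_functions_def)
    qed
    have d1: "pderivative (0, 1) \<phi> y = - kt (z - y)" for y
      unfolding \<phi>_def kt_def pderivative_reflected_kernel(1)[OF k bt] ..
    have d2: "laplacian_x \<phi> y = (\<Sum>i\<in>Basis. kii i (z - y))" for y
      unfolding laplacian_x_def
    proof (rule sum.cong[OF refl])
      fix i :: 'a assume i: "i \<in> Basis"
      have "pderivative (i, 0) \<phi> = (\<lambda>y. - ki i (z - y))"
        unfolding \<phi>_def ki_def by (rule pderivative_reflected_kernel(1)[OF k bi[OF i]])
      then show "pderivative (i, 0) (pderivative (i, 0) \<phi>) y = kii i (z - y)"
        using pderivative_reflected_kernel(2)[OF ki[OF i] bi[OF i], of z] by (simp add: kii_def)
    qed
    note ci = convolve_kernel_integrable[OF _ _ , of _ _ d z]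
    have cint: "integrable lborel (\<lambda>y. U y * kt (z - y))" "\<And>i. i \<in> Basis \<Longrightarrow> integrable lborel (\<lambda>y. U y * kii i (z - y))"
      "integrable lborel (\<lambda>y. H y * k (z - y))" "\<And>i. i \<in> Basis \<Longrightarrow> integrable lborel (\<lambda>y. U y * ki i (z - y))"
      "\<And>i. i \<in> Basis \<Longrightarrow> integrable lborel (\<lambda>y. G i y * k (z - y))"
      using Ui H(1) G(1) k kt ki kii by (auto intro: ci)
    define F' where "F' y = U y * kt (z - y) - \<nu> * (\<Sum>i\<in>Basis. U y * kii i (z - y)) + H y * k (z - y)" for y
    have F'int: "integrable lborel F'"
      unfolding F'_def using cint by (intro Bochner_Integration.integrable_add Bochner_Integration.integrable_diff
          integrable_mult_right Bochner_Integration.integrable_sum) auto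
    have F'm: "F' \<in> borel_measurable borel" using borel_measurable_integrable[OF F'int] by simp
    have F'off: "F' y = 0" if "y \<notin> K" for y
      using off[OF kt that] off[OF kii that] off[OF k that] by (simp add: F'_def)
    have "integral\<^sup>L lborel F' = 0"
    proof -
      have "(LINT y|lebesgue_on ?cyl. - u y * pderivative (0, 1) \<phi> y - \<nu> * u y * laplacian_x \<phi> y + norm (g y) powr q * \<phi> y)
          = integral\<^sup>L lborel F'"
      proof (rule lebesgue_on_integral_eq_lborel[OF _ F'm])
        show "?cyl \<in> sets lebesgue" using cylo by (auto intro: sets_completionI_sets)
        show "AE y in lborel. y \<in> ?cyl \<longrightarrow> - u y * pderivative (0, 1) \<phi> y - \<nu> * u y * laplacian_x \<phi> y + norm (g y) powr q * \<phi> y = F' y"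
          using Uae H(2)
        proof eventually_elim
          fix y assume e: "U y = indicator K y * u y" "H y = indicator K y * norm (g y) powr q"
          show "y \<in> ?cyl \<longrightarrow> - u y * pderivative (0, 1) \<phi> y - \<nu> * u y * laplacian_x \<phi> y + norm (g y) powr q * \<phi> y = F' y"
          proof (cases "y \<in> K")
            case True
            then show ?thesis using e by (simp add: F'_def d1 d2 \<phi>_def sum_distrib_left mult.assoc)
          next
            case False
            then show ?thesis using F'off[OF False] off[OF kt False] off[OF kii False] off[OF k False] by (simp add: d1 d2 \<phi>_def)
          qed
        qed
        show "F' y = 0" if "y \<notin> ?cyl" for y using that Ksub F'off by blast
      qed
      then show ?thesis using weq[OF \<phi>test] by simp
    qed
    also have "integral\<^sup>L lborel F' = convolve U kt z - \<nu> * (\<Sum>i\<in>Basis. convolve U (kii i) z) + convolve H k z"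
      unfolding F'_def convolve_def using cint by (simp add: Bochner_Integration.integral_sum Bochner_Integration.integrable_sum)
    finally have eq: "convolve U kt z - \<nu> * (\<Sum>i\<in>Basis. convolve U (kii i) z) + convolve H k z = 0" by simp
    have vt: "pderivative (0, 1) (convolve U k) z = convolve U kt z"
      unfolding kt_def convolve_kernel_deriv(2)[OF Ui k bt] ..
    have vi: "pderivative (i, 0) (convolve U k) = convolve U (ki i)" if "i \<in> Basis" for i
      unfolding ki_def by (rule convolve_kernel_deriv(2)[OF Ui k bi[OF that]])
    have vlap: "laplacian_x (convolve U k) z = (\<Sum>i\<in>Basis. convolve U (kii i) z)"
      unfolding laplacian_x_def
      by (intro sum.cong refl) (simp add: vi convolve_kernel_deriv(2)[OF Ui ki bi] kii_def)
    have grad: "convolve U (ki i) z = convolve (G i) k z" if i: "i \<in> Basis" for i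
    proof -
      have wg': "AE t in lborel. 0 < t \<and> ereal t < T \<longrightarrow> weak_gradient \<Omega> (\<lambda>x. u (x, t)) (\<lambda>x. g (x, t))"
      proof -
        have "AE t in lebesgue. t \<in> {t. 0 < t \<and> ereal t < T} \<longrightarrow> weak_gradient \<Omega> (\<lambda>x. u (x, t)) (\<lambda>x. g (x, t))"
          using wg openT by (subst (asm) AE_restrict_space_iff) (auto intro: sets_completionI_sets)
        then show ?thesis by (simp add: AE_completion_iff)
      qed
      have Um: "U \<in> borel_measurable borel" and Gm: "G i \<in> borel_measurable borel"
        using borel_measurable_integrable[OF Ui] borel_measurable_integrable[OF G(1)[OF i]] by auto
      have km: "k \<in> borel_measurable borel" "ki i \<in> borel_measurable borel"
        using kernels_continuous[OF k] kernels_continuous[OF ki[OF i]] by (auto intro: borel_measurable_continuous_onI)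
      have pm: "(\<lambda>x. f (x, t)) \<in> borel_measurable borel" if "f \<in> borel_measurable borel" for f :: "'a \<times> real \<Rightarrow> real" and t
        using measurable_compose[OF _ that, of "\<lambda>x. (x, t)" borel] by (simp add: borel_measurable_continuous_onI continuous_on_Pair)
      have pm': "(\<lambda>x. f (z - (x, t))) \<in> borel_measurable borel" if "f \<in> borel_measurable borel" for f :: "'a \<times> real \<Rightarrow> real" and t
        using measurable_compose[OF _ that, of "\<lambda>x. z - (x, t)" borel]
        by (simp add: borel_measurable_continuous_onI continuous_intros)
      have slice: "AE t in lborel. (LINT x|lborel. U (x, t) * ki i (z - (x, t))) = (LINT x|lborel. G i (x, t) * k (z - (x, t)))"
        using wg' Uae' lborel_AE_slice[OF G(2)[OF i]]
      proof eventually_elim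
        fix t assume w: "0 < t \<and> ereal t < T \<longrightarrow> weak_gradient \<Omega> (\<lambda>x. u (x, t)) (\<lambda>x. g (x, t))"
          and ut: "AE x in lborel. U (x, t) = indicator K (x, t) * u (x, t)"
          and gt: "AE x in lborel. G i (x, t) = indicator K (x, t) * (g (x, t) \<bullet> i)"
        show "(LINT x|lborel. U (x, t) * ki i (z - (x, t))) = (LINT x|lborel. G i (x, t) * k (z - (x, t)))"
        proof (cases "t \<in> {a..b}")
          case False
          then have "(x, t) \<notin> K" for x by (auto simp: K_def)
          then show ?thesis using off[OF k] off[OF ki[OF i]] by simp
        next
          case True
          have w': "weak_gradient \<Omega> (\<lambda>x. u (x, t)) (\<lambda>x. g (x, t))" using w tT[OF True] by blast
          define \<psi> where "\<psi> x = \<phi> (x, t)" for x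
          have "\<psi> \<in> test_functions \<Omega>"
          proof -
            have "k \<in> tensor_smooth" using k by (simp add: kernels_def)
            then have "smooth \<psi>" unfolding \<psi>_def \<phi>_def
              by (intro tensor_smooth_smooth tensor_smooth_slice[of "\<lambda>y. k (z - y)"] tensor_smooth_reflect)
            moreover have "supported_in \<Omega> \<psi>" unfolding supported_in_def
              using A off[OF k] by (intro exI[of _ A]) (auto simp: \<psi>_def \<phi>_def K_def)
            ultimately show ?thesis by (simp add: test_functions_def)
          qed
          then have ibp: "(LINT x|lebesgue_on \<Omega>. u (x, t) * pderivative i \<psi> x) = - (LINT x|lebesgue_on \<Omega>. (g (x, t) \<bullet> i) * \<psi> x)"
            using w' i by (auto simp: weak_gradient_def)
          have dpsi: "pderivative i \<psi> x = - ki i (z - (x, t))" for x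
          proof -
            have "pderivative i \<psi> x = pderivative (i, 0) \<phi> (x, t)" by (simp add: pderivative_def \<psi>_def)
            then show ?thesis unfolding \<phi>_def ki_def pderivative_reflected_kernel(1)[OF k bi[OF i]] .
          qed
          have \<Omega>s: "\<Omega> \<in> sets lebesgue" using \<Omega> by (auto intro: sets_completionI_sets)
          have xK: "(x, t) \<in> K \<Longrightarrow> x \<in> \<Omega>" for x using A by (auto simp: K_def)
          have "(LINT x|lebesgue_on \<Omega>. u (x, t) * pderivative i \<psi> x) = (LINT x|lborel. - (U (x, t) * ki i (z - (x, t))))"
          proof (rule lebesgue_on_integral_eq_lborel[OF \<Omega>s])
            show "(\<lambda>x. - (U (x, t) * ki i (z - (x, t)))) \<in> borel_measurable borel"
              using pm[OF Um] pm'[OF km(2)] by measurable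
            show "AE x in lborel. x \<in> \<Omega> \<longrightarrow> u (x, t) * pderivative i \<psi> x = - (U (x, t) * ki i (z - (x, t)))"
              using ut by eventually_elim (use off[OF ki[OF i]] in \<open>auto simp: dpsi indicator_def\<close>)
            show "- (U (x, t) * ki i (z - (x, t))) = 0" if "x \<notin> \<Omega>" for x
              using off[OF ki[OF i], of "(x, t)"] xK[of x] that by auto
          qed
          moreover have "(LINT x|lebesgue_on \<Omega>. (g (x, t) \<bullet> i) * \<psi> x) = (LINT x|lborel. G i (x, t) * k (z - (x, t)))"
          proof (rule lebesgue_on_integral_eq_lborel[OF \<Omega>s])
            show "(\<lambda>x. G i (x, t) * k (z - (x, t))) \<in> borel_measurable borel"
              using pm[OF Gm] pm'[OF km(1)] by measurable
            show "AE x in lborel. x \<in> \<Omega> \<longrightarrow> (g (x, t) \<bullet> i) * \<psi> x = G i (x, t) * k (z - (x, t))"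
              using gt by eventually_elim (use off[OF k] in \<open>auto simp: \<psi>_def \<phi>_def indicator_def\<close>)
            show "G i (x, t) * k (z - (x, t)) = 0" if "x \<notin> \<Omega>" for x
              using off[OF k, of "(x, t)"] xK[of x] that by auto
          qed
          ultimately show ?thesis using ibp by simp
        qed
      qed
      have "convolve U (ki i) z = (LINT t|lborel. LINT x|lborel. U (x, t) * ki i (z - (x, t)))"
        unfolding convolve_def by (rule lborel_Fubini(1)[OF cint(4)[OF i]])
      also have "\<dots> = (LINT t|lborel. LINT x|lborel. G i (x, t) * k (z - (x, t)))"
        using lborel_Fubini(3)[OF cint(4)[OF i]] lborel_Fubini(3)[OF cint(5)[OF i]] slice
        by (intro integral_cong_AE) auto
      also have "\<dots> = convolve (G i) k z"
        unfolding convolve_def by (rule lborel_Fubini(1)[OF cint(5)[OF i], symmetric])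
      finally show ?thesis .
    qed
    define p where "p = grad_x (convolve U k) z"
    have pi: "p \<bullet> i = convolve (G i) k z" if "i \<in> Basis" for i
      using that by (simp add: p_def grad_x_inner vi grad)
    note kz = kernel_reflect_integral[OF k1, of z]
    have "norm p powr q \<le> convolve H k z"
    proof (cases "p = 0")
      case True
      have "0 \<le> convolve H k z" unfolding convolve_def
      proof (rule integral_nonneg_AE)
        show "AE y in lborel. 0 \<le> H y * k (z - y)"
          using H(2) by eventually_elim (simp add: kpos)
      qed
      then show ?thesis using True by simp
    next
      case False
      define c where "c = q * norm p powr (q - 2)"
      have Gall: "AE y in lborel. \<forall>i\<in>Basis. G i y = indicator K y * (g y \<bullet> i)"
        using G(2) by (intro AE_finite_allI) auto
      have le: "(LINT y|lborel. ((1 - q) * norm p powr q) * k (z - y) + c * (\<Sum>i\<in>Basis. (p \<bullet> i) * (G i y * k (z - y)))) \<le> convolve H k z"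
        unfolding convolve_def
      proof (rule integral_mono_AE)
        show "AE y in lborel. (1 - q) * norm p powr q * k (z - y) + c * (\<Sum>i\<in>Basis. (p \<bullet> i) * (G i y * k (z - y))) \<le> H y * k (z - y)"
          using Gall H(2)
        proof eventually_elim
          fix y assume e: "\<forall>i\<in>Basis. G i y = indicator K y * (g y \<bullet> i)" "H y = indicator K y * norm (g y) powr q"
          show "(1 - q) * norm p powr q * k (z - y) + c * (\<Sum>i\<in>Basis. (p \<bullet> i) * (G i y * k (z - y))) \<le> H y * k (z - y)"
          proof (cases "y \<in> K")
            case True
            have "(\<Sum>i\<in>Basis. (p \<bullet> i) * (G i y * k (z - y))) = (\<Sum>i\<in>Basis. (p \<bullet> i) * (g y \<bullet> i)) * k (z - y)"
              unfolding sum_distrib_right using e True by (intro sum.cong) auto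
            also have "(\<Sum>i\<in>Basis. (p \<bullet> i) * (g y \<bullet> i)) = p \<bullet> g y" by (rule euclidean_inner[symmetric])
            finally have "(1 - q) * norm p powr q * k (z - y) + c * (\<Sum>i\<in>Basis. (p \<bullet> i) * (G i y * k (z - y)))
                = ((1 - q) * norm p powr q + c * (p \<bullet> g y)) * k (z - y)" by (simp add: algebra_simps)
            also have "\<dots> \<le> norm (g y) powr q * k (z - y)"
              unfolding c_def by (intro mult_right_mono powr_norm_tangent q False kpos)
            finally show ?thesis using e True by simp
          next
            case False
            then show ?thesis using off[OF k False] by simp
          qed
        qed
      qed (use cint(5) kz(1) cint(3) in \<open>auto intro!: Bochner_Integration.integrable_add integrable_mult_right Bochner_Integration.integrable_sum\<close>)
      have "(LINT y|lborel. ((1 - q) * norm p powr q) * k (z - y) + c * (\<Sum>i\<in>Basis. (p \<bullet> i) * (G i y * k (z - y))))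
          = (1 - q) * norm p powr q + c * (\<Sum>i\<in>Basis. (p \<bullet> i) * convolve (G i) k z)"
        unfolding convolve_def using cint(5) kz
        by (simp add: Bochner_Integration.integral_sum Bochner_Integration.integrable_sum)
      also have "(\<Sum>i\<in>Basis. (p \<bullet> i) * convolve (G i) k z) = (norm p)\<^sup>2"
        unfolding power2_norm_eq_inner by (subst euclidean_inner) (simp add: pi)
      also have "c * (norm p)\<^sup>2 = q * norm p powr q"
      proof -
        have "norm p powr q = norm p powr (q - 2) * (norm p)\<^sup>2"
          using False powr_add[of "norm p" "q - 2" 2] by (simp add: powr_numeral)
        then show ?thesis by (simp add: c_def)
      qed
      finally show ?thesis using le by (simp add: algebra_simps)
    qed
    then show "pderivative (0, 1) (convolve U k) z - \<nu> * laplacian_x (convolve U k) z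
        + norm (grad_x (convolve U k) z) powr q \<le> 0"
      using eq unfolding vt vlap p_def by linarith
  qed
  then show ?thesis using Ui Upos Uae' unfolding K_def by (intro exI[of _ U]) blast
qed

section \<open>Passage to the limit in the mollification\<close>

lemma powr_tangent:
  fixes v u R :: real
  assumes R: "1 \<le> R" and v: "0 < v" and u: "0 \<le> u"
  shows "(1 - R) * v powr R + R * v powr (R - 1) * u \<le> u powr R"
proof (cases "R = 1")
  case False
  then have "(1 - R) * norm v powr R + R * norm v powr (R - 2) * (v \<bullet> u) \<le> norm u powr R"
    using R v by (intro powr_norm_tangent) auto
  moreover have "v powr (R - 1) = v powr (R - 2) * v" using v powr_add[of v "R - 2" 1] by simp
  ultimately show ?thesis using v u by (simp add: mult.assoc)
qed (use v u in simp)

text \<open>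
  With \<open>a\<close> and \<open>b\<close> of norms \<open>\<alpha>\<close> and \<open>\<beta>\<close> in \<open>L^R\<close>, integration of this inequality gives Minkowski's
  inequality.
\<close>

lemma powr_add_weighted:
  fixes a b \<alpha> \<beta> R :: real
  assumes R: "1 \<le> R" and a: "0 \<le> a" and b: "0 \<le> b" and pos: "0 < \<alpha>" "0 < \<beta>"
  shows "(a + b) powr R \<le> (\<alpha> + \<beta>) powr (R - 1) * (\<alpha> powr (1 - R) * a powr R + \<beta> powr (1 - R) * b powr R)"
proof (cases "a + b = 0")
  case True
  then show ?thesis using a b R by simp
next
  case False
  define v where "v = (a + b) / (\<alpha> + \<beta>)"
  have v: "v > 0" using False a b pos by (simp add: v_def)
  have ab: "a / \<alpha> * \<alpha> + b / \<beta> * \<beta> = (\<alpha> + \<beta>) * v" using pos by (simp add: v_def)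
  have 1: "\<alpha> * ((1 - R) * v powr R + R * v powr (R - 1) * (a / \<alpha>)) \<le> \<alpha> * (a / \<alpha>) powr R"
    using powr_tangent[OF R v, of "a / \<alpha>"] a pos by (intro mult_left_mono) auto
  have 2: "\<beta> * ((1 - R) * v powr R + R * v powr (R - 1) * (b / \<beta>)) \<le> \<beta> * (b / \<beta>) powr R"
    using powr_tangent[OF R v, of "b / \<beta>"] b pos by (intro mult_left_mono) auto
  have vR: "v powr (R - 1) * v = v powr R" using v powr_add[of v "R - 1" 1] by simp
  have "(\<alpha> + \<beta>) * v powr R = (\<alpha> + \<beta>) * ((1 - R) * v powr R) + R * v powr (R - 1) * ((\<alpha> + \<beta>) * v)"
    unfolding vR[symmetric] by (simp add: algebra_simps)
  also have "\<dots> = \<alpha> * ((1 - R) * v powr R + R * v powr (R - 1) * (a / \<alpha>)) + \<beta> * ((1 - R) * v powr R + R * v powr (R - 1) * (b / \<beta>))"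
    unfolding ab[symmetric] by (simp add: algebra_simps)
  also have "\<dots> \<le> \<alpha> * (a / \<alpha>) powr R + \<beta> * (b / \<beta>) powr R" using 1 2 by linarith
  also have "\<dots> = \<alpha> powr (1 - R) * a powr R + \<beta> powr (1 - R) * b powr R"
    using pos by (simp add: powr_divide powr_diff)
  finally have le: "(\<alpha> + \<beta>) * v powr R \<le> \<alpha> powr (1 - R) * a powr R + \<beta> powr (1 - R) * b powr R" .
  have "(a + b) powr R = ((\<alpha> + \<beta>) * v) powr R" using pos by (simp add: v_def)
  also have "\<dots> = (\<alpha> + \<beta>) powr (R - 1) * ((\<alpha> + \<beta>) * v powr R)"
    using pos powr_add[of "\<alpha> + \<beta>" "R - 1" 1] by (simp add: powr_mult)
  also have "\<dots> \<le> (\<alpha> + \<beta>) powr (R - 1) * (\<alpha> powr (1 - R) * a powr R + \<beta> powr (1 - R) * b powr R)"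
    using le by (intro mult_left_mono) auto
  finally show ?thesis .
qed

lemma nn_integral_lborel_iterated:
  fixes f :: "'a::euclidean_space \<times> real \<Rightarrow> ennreal"
  assumes "f \<in> borel_measurable borel"
  shows "integral\<^sup>N lborel f = (\<integral>\<^sup>+t. \<integral>\<^sup>+y. f (y, t) \<partial>lborel \<partial>lborel)"
proof -
  have "f \<in> borel_measurable (lborel \<Otimes>\<^sub>M lborel)" using assms by (subst lborel_prod) simp
  from lborel_pair.nn_integral_snd[OF this] show ?thesis by (simp add: lborel_prod)
qed

text \<open>
  Integration of a mollification in space alone: the mollifying average moves to the weight, and the
  remaining average over times is what the bounds for almost every time can be inserted into.
\<close>

lemma mollify_Tonelli:
  fixes f :: "'a::euclidean_space \<times> real \<Rightarrow> ennreal" and \<theta> :: "'a \<Rightarrow> ennreal" and k :: "'a \<times> real \<Rightarrow> real"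
  assumes f: "f \<in> borel_measurable borel" and \<theta>[measurable]: "\<theta> \<in> borel_measurable borel" and k: "k \<in> borel_measurable borel"
  shows "(\<integral>\<^sup>+x. \<theta> x * (\<integral>\<^sup>+z. f z * ennreal (k ((x, s) - z)) \<partial>lborel) \<partial>lborel) =
    (\<integral>\<^sup>+t. \<integral>\<^sup>+y. f (y, t) * (\<integral>\<^sup>+x. \<theta> x * ennreal (k (x - y, s - t)) \<partial>lborel) \<partial>lborel \<partial>lborel)"
proof -
  have f'[measurable]: "f \<in> borel_measurable (borel \<Otimes>\<^sub>M borel)" and k'[measurable]: "k \<in> borel_measurable (borel \<Otimes>\<^sub>M borel)"
    using f k by (simp_all add: borel_prod)
  have kc: "(\<lambda>z. k ((x, s) - z)) \<in> borel_measurable borel" for x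
    using measurable_compose[OF _ k, of "\<lambda>z. (x, s) - z" borel] by (simp add: borel_measurable_continuous_onI continuous_intros)
  have "(\<integral>\<^sup>+x. \<theta> x * (\<integral>\<^sup>+z. f z * ennreal (k ((x, s) - z)) \<partial>lborel) \<partial>lborel) =
      (\<integral>\<^sup>+x. \<theta> x * (\<integral>\<^sup>+t. \<integral>\<^sup>+y. f (y, t) * ennreal (k (x - y, s - t)) \<partial>lborel \<partial>lborel) \<partial>lborel)"
    using f kc by (subst nn_integral_lborel_iterated) auto
  also have "\<dots> = (\<integral>\<^sup>+x. \<integral>\<^sup>+t. \<integral>\<^sup>+y. \<theta> x * (f (y, t) * ennreal (k (x - y, s - t))) \<partial>lborel \<partial>lborel \<partial>lborel)"
    by (simp add: nn_integral_cmult)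
  also have "\<dots> = (\<integral>\<^sup>+t. \<integral>\<^sup>+x. \<integral>\<^sup>+y. \<theta> x * (f (y, t) * ennreal (k (x - y, s - t))) \<partial>lborel \<partial>lborel \<partial>lborel)"
    by (rule lborel_pair.Fubini') measurable
  also have "\<dots> = (\<integral>\<^sup>+t. \<integral>\<^sup>+y. \<integral>\<^sup>+x. \<theta> x * (f (y, t) * ennreal (k (x - y, s - t))) \<partial>lborel \<partial>lborel \<partial>lborel)"
    by (intro nn_integral_cong lborel_pair.Fubini') measurable
  also have "\<dots> = (\<integral>\<^sup>+t. \<integral>\<^sup>+y. f (y, t) * (\<integral>\<^sup>+x. \<theta> x * ennreal (k (x - y, s - t)) \<partial>lborel) \<partial>lborel \<partial>lborel)"
    by (simp add: nn_integral_cmult[symmetric] mult_ac)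
  finally show ?thesis .
qed

text \<open>
  The marginal of a space-time kernel: the weight with which the times enter a mollification.
\<close>

definition time_kernel :: "('a::euclidean_space \<times> real \<Rightarrow> real) \<Rightarrow> real \<Rightarrow> ennreal" where
  "time_kernel k \<tau> = (\<integral>\<^sup>+x. ennreal (k (x, \<tau>)) \<partial>lborel)"

lemma nn_integral_lborel_translate:
  fixes g :: "'a::euclidean_space \<Rightarrow> ennreal"
  assumes g: "g \<in> borel_measurable borel"
  shows "(\<integral>\<^sup>+x. g (x - y) \<partial>lborel) = integral\<^sup>N lborel g"
proof -
  have "(\<lambda>x. x - y) = (+) (- y)" by auto
  then have e: "distr lborel borel (\<lambda>x. x - y) = lborel" using lborel_distr_plus[of "- y"] by simp
  have "integral\<^sup>N (distr lborel borel (\<lambda>x. x - y)) g = (\<integral>\<^sup>+x. g (x - y) \<partial>lborel)"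
    using g by (intro nn_integral_distr) auto
  then show ?thesis by (simp add: e)
qed

lemma time_kernel_integral:
  fixes k :: "'a::euclidean_space \<times> real \<Rightarrow> real"
  assumes k: "k \<in> borel_measurable borel" and nn: "\<And>z. 0 \<le> k z" and k1: "integral\<^sup>L lborel k = 1"
  shows "(\<integral>\<^sup>+t. time_kernel k (s - t) \<partial>lborel) = 1"
    and "time_kernel k \<in> borel_measurable borel"
    and "(\<integral>\<^sup>+x. ennreal (k (x - y, \<tau>)) \<partial>lborel) = time_kernel k \<tau>"
proof -
  have k'[measurable]: "k \<in> borel_measurable (borel \<Otimes>\<^sub>M borel)" using k by (simp add: borel_prod)
  have ki: "integrable lborel k" using k1 not_integrable_integral_eq by fastforce
  show m: "time_kernel k \<in> borel_measurable borel" unfolding time_kernel_def[abs_def] by measurable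
  have e: "distr lborel borel (\<lambda>t. s - t) = (lborel :: real measure)"
    using lborel_affine[of "-1" s] by (simp add: density_1)
  have "(\<integral>\<^sup>+t. time_kernel k (s - t) \<partial>lborel) = integral\<^sup>N (distr lborel borel (\<lambda>t. s - t)) (time_kernel k)"
    using m by (intro nn_integral_distr[symmetric]) auto
  also have "\<dots> = integral\<^sup>N lborel (\<lambda>z. ennreal (k z))"
    unfolding e time_kernel_def using k by (subst nn_integral_lborel_iterated) auto
  also have "\<dots> = 1" using ki k1 nn by (subst nn_integral_eq_integral) auto
  finally show "(\<integral>\<^sup>+t. time_kernel k (s - t) \<partial>lborel) = 1" .
  have "(\<lambda>x. ennreal (k (x, \<tau>))) \<in> borel_measurable borel" by measurable
  from nn_integral_lborel_translate[OF this, of y]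
  show "(\<integral>\<^sup>+x. ennreal (k (x - y, \<tau>)) \<partial>lborel) = time_kernel k \<tau>" by (simp add: time_kernel_def)
qed

lemma time_kernel_off:
  assumes "k \<in> kernels d" "d < \<bar>\<tau>\<bar>"
  shows "time_kernel k \<tau> = 0"
proof -
  have "k (x, \<tau>) = 0" for x
  proof -
    have "d < norm (x, \<tau>)" using assms(2) norm_snd_le[of \<tau> x] by simp
    then show ?thesis using assms(1) unfolding kernels_def by blast
  qed
  then show ?thesis by (simp add: time_kernel_def)
qed

lemma kernels_measurable: "k \<in> kernels d \<Longrightarrow> k \<in> borel_measurable borel"
  using kernels_continuous by (rule borel_measurable_continuous_onI)

text \<open>
  Jensen's inequality, from the tangent at the value of the mollification. The right-hand side may be
  infinite.
\<close>

lemma convolve_powr_le: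
  fixes U k :: "'b::euclidean_space \<Rightarrow> real"
  assumes U: "integrable lborel U" "\<And>z. 0 \<le> U z" and k: "k \<in> kernels d" "\<And>z. 0 \<le> k z" "integral\<^sup>L lborel k = 1" and R: "1 \<le> R"
  shows "ennreal (convolve U k z powr R) \<le> (\<integral>\<^sup>+y. ennreal (U y powr R) * ennreal (k (z - y)) \<partial>lborel)"
proof -
  define v where "v = convolve U k z"
  have v0: "0 \<le> v" unfolding v_def convolve_def by (intro Bochner_Integration.integral_nonneg mult_nonneg_nonneg U k)
  have eq: "(\<integral>\<^sup>+y. ennreal (U y powr R) * ennreal (k (z - y)) \<partial>lborel) = (\<integral>\<^sup>+y. ennreal (U y powr R * k (z - y)) \<partial>lborel)"
    by (simp add: ennreal_mult k)
  have m: "(\<lambda>y. U y powr R * k (z - y)) \<in> borel_measurable lborel"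
  proof -
    have "(\<lambda>y. k (z - y)) \<in> borel_measurable lborel" using kernel_reflect_integral(1)[OF k(3)] by auto
    then show ?thesis using borel_measurable_integrable[OF U(1)] by measurable
  qed
  show ?thesis
  proof (cases "v = 0 \<or> (\<integral>\<^sup>+y. ennreal (U y powr R * k (z - y)) \<partial>lborel) = \<infinity>")
    case True
    then show ?thesis using R eq by (auto simp: v_def[symmetric])
  next
    case False
    then have v: "v > 0" using v0 by simp
    have i: "integrable lborel (\<lambda>y. U y powr R * k (z - y))"
      using m False by (intro integrableI_nonneg) (auto simp: k top.not_eq_extremum)
    have ci: "integrable lborel (\<lambda>y. U y * k (z - y))" by (rule convolve_kernel_integrable[OF U(1) k(1)])
    have "(LINT y|lborel. ((1 - R) * v powr R) * k (z - y) + (R * v powr (R - 1)) * (U y * k (z - y))) \<le> (LINT y|lborel. U y powr R * k (z - y))"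
    proof (rule integral_mono)
      show "((1 - R) * v powr R) * k (z - y) + (R * v powr (R - 1)) * (U y * k (z - y)) \<le> U y powr R * k (z - y)" for y
        using mult_right_mono[OF powr_tangent[OF R v U(2)[of y]] k(2)[of "z - y"]] by (simp add: algebra_simps)
    qed (use i ci kernel_reflect_integral(1)[OF k(3)] in auto)
    also have "(LINT y|lborel. ((1 - R) * v powr R) * k (z - y) + (R * v powr (R - 1)) * (U y * k (z - y)))
        = (1 - R) * v powr R + R * v powr (R - 1) * v"
      using ci kernel_reflect_integral[OF k(3)] by (simp add: v_def convolve_def)
    also have "\<dots> = v powr R" using v powr_add[of v "R - 1" 1] by (simp add: algebra_simps)
    finally have "ennreal (v powr R) \<le> ennreal (LINT y|lborel. U y powr R * k (z - y))" by (rule ennreal_leI)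
    also have "\<dots> = (\<integral>\<^sup>+y. ennreal (U y powr R * k (z - y)) \<partial>lborel)"
      using i by (intro nn_integral_eq_integral[symmetric]) (auto simp: k)
    finally show ?thesis unfolding eq v_def .
  qed
qed

text \<open>
  By Jensen, the local \<open>L^R\<close> norm of the mollification at time \<open>s\<close> is an average of those of \<open>U\<close> at
  nearby times, on a slightly larger ball.
\<close>

lemma mollified_mass_bound:
  fixes U :: "'a::euclidean_space \<times> real \<Rightarrow> real"
  assumes U: "integrable lborel U" "\<And>z. 0 \<le> U z" and k: "k \<in> kernels d" "\<And>z. 0 \<le> k z" "integral\<^sup>L lborel k = 1" and R: "1 \<le> R"
    and rho: "\<rho> + d \<le> \<rho>'" and c: "0 \<le> c"
    and mass: "AE t in lborel. \<bar>s - t\<bar> \<le> d \<longrightarrow> (\<integral>\<^sup>+y. ennreal (indicator (cball x0 \<rho>') y * U (y, t) powr R) \<partial>lborel) \<le> ennreal c"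
  shows "(LINT x:cball x0 \<rho>|lborel. convolve U k (x, s) powr R) \<le> c"
proof -
  have Um: "U \<in> borel_measurable borel" using borel_measurable_integrable[OF U(1)] by simp
  have km: "k \<in> borel_measurable borel" by (rule kernels_measurable[OF k(1)])
  have v0: "0 \<le> convolve U k z" for z unfolding convolve_def by (intro Bochner_Integration.integral_nonneg mult_nonneg_nonneg U k)
  have cc: "continuous_on UNIV (\<lambda>x. convolve U k (x, s) powr R)"
    using continuous_on_compose2[OF convolve_kernel_continuous[OF U(1) k(1), of UNIV], of UNIV "\<lambda>x. (x, s)"] v0 R
    by (intro continuous_on_powr') (auto simp: continuous_on_Pair)
  have vi: "integrable lborel (\<lambda>x. indicator (cball x0 \<rho>) x *\<^sub>R (convolve U k (x, s) powr R))"
    by (intro borel_integrable_compact compact_cball continuous_on_subset[OF cc]) auto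
  have "ennreal (LINT x:cball x0 \<rho>|lborel. convolve U k (x, s) powr R) =
      (\<integral>\<^sup>+x. ennreal (indicator (cball x0 \<rho>) x *\<^sub>R (convolve U k (x, s) powr R)) \<partial>lborel)"
    unfolding set_lebesgue_integral_def using vi by (intro nn_integral_eq_integral[symmetric]) auto
  also have "\<dots> \<le> (\<integral>\<^sup>+x. indicator (cball x0 \<rho>) x * (\<integral>\<^sup>+z. ennreal (U z powr R) * ennreal (k ((x, s) - z)) \<partial>lborel) \<partial>lborel)"
    using convolve_powr_le[OF U k R] by (intro nn_integral_mono) (auto simp: indicator_def)
  also have "\<dots> = (\<integral>\<^sup>+t. \<integral>\<^sup>+y. ennreal (U (y, t) powr R) * (\<integral>\<^sup>+x. indicator (cball x0 \<rho>) x * ennreal (k (x - y, s - t)) \<partial>lborel) \<partial>lborel \<partial>lborel)"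
    using Um km by (intro mollify_Tonelli borel_measurable_indicator) auto
  also have "\<dots> \<le> (\<integral>\<^sup>+t. time_kernel k (s - t) * ennreal c \<partial>lborel)"
  proof (rule nn_integral_mono_AE)
    show "AE t in lborel. (\<integral>\<^sup>+y. ennreal (U (y, t) powr R) * (\<integral>\<^sup>+x. indicator (cball x0 \<rho>) x * ennreal (k (x - y, s - t)) \<partial>lborel) \<partial>lborel)
        \<le> time_kernel k (s - t) * ennreal c"
      using mass
    proof eventually_elim
      fix t assume mt: "\<bar>s - t\<bar> \<le> d \<longrightarrow> (\<integral>\<^sup>+y. ennreal (indicator (cball x0 \<rho>') y * U (y, t) powr R) \<partial>lborel) \<le> ennreal c"
      have inner: "(\<integral>\<^sup>+x. indicator (cball x0 \<rho>) x * ennreal (k (x - y, s - t)) \<partial>lborel) \<le> indicator (cball x0 \<rho>') y * time_kernel k (s - t)" for y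
      proof (cases "y \<in> cball x0 \<rho>'")
        case True
        have "(\<integral>\<^sup>+x. indicator (cball x0 \<rho>) x * ennreal (k (x - y, s - t)) \<partial>lborel) \<le> (\<integral>\<^sup>+x. ennreal (k (x - y, s - t)) \<partial>lborel)"
          by (intro nn_integral_mono) (auto simp: indicator_def)
        also have "\<dots> = time_kernel k (s - t)" by (rule time_kernel_integral(3)[OF km k(2,3)])
        finally show ?thesis using True by simp
      next
        case False
        have "indicator (cball x0 \<rho>) x * ennreal (k (x - y, s - t)) = 0" for x
        proof (cases "x \<in> cball x0 \<rho>")
          case True
          then have "d < norm (x - y)" using False rho dist_triangle[of x0 y x] by (simp add: dist_norm)
          then have "d < norm (x - y, s - t)" using norm_fst_le[of "x - y" "s - t"] by linarith
          then show ?thesis using k(1) unfolding kernels_def by fastforce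
        qed simp
        then have "(\<integral>\<^sup>+x. indicator (cball x0 \<rho>) x * ennreal (k (x - y, s - t)) \<partial>lborel) = (\<integral>\<^sup>+(x::'a). 0 \<partial>lborel)"
          by (rule nn_integral_cong)
        then show ?thesis by simp
      qed
      have "(\<integral>\<^sup>+y. ennreal (U (y, t) powr R) * (\<integral>\<^sup>+x. indicator (cball x0 \<rho>) x * ennreal (k (x - y, s - t)) \<partial>lborel) \<partial>lborel)
          \<le> (\<integral>\<^sup>+y. time_kernel k (s - t) * ennreal (indicator (cball x0 \<rho>') y * U (y, t) powr R) \<partial>lborel)"
      proof (rule nn_integral_mono)
        fix y
        have "ennreal (U (y, t) powr R) * (\<integral>\<^sup>+x. indicator (cball x0 \<rho>) x * ennreal (k (x - y, s - t)) \<partial>lborel)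
           \<le> ennreal (U (y, t) powr R) * (indicator (cball x0 \<rho>') y * time_kernel k (s - t))"
          by (intro mult_left_mono inner) auto
        also have "\<dots> = time_kernel k (s - t) * ennreal (indicator (cball x0 \<rho>') y * U (y, t) powr R)"
          by (auto simp: indicator_def mult.commute)
        finally show "ennreal (U (y, t) powr R) * (\<integral>\<^sup>+x. indicator (cball x0 \<rho>) x * ennreal (k (x - y, s - t)) \<partial>lborel)
           \<le> time_kernel k (s - t) * ennreal (indicator (cball x0 \<rho>') y * U (y, t) powr R)" .
      qed
      also have "\<dots> = time_kernel k (s - t) * (\<integral>\<^sup>+y. ennreal (indicator (cball x0 \<rho>') y * U (y, t) powr R) \<partial>lborel)"
      proof (rule nn_integral_cmult)
        have "(\<lambda>y. U (y, t)) \<in> borel_measurable borel"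
          using measurable_compose[OF _ Um, of "\<lambda>y. (y, t)" borel] by (simp add: borel_measurable_continuous_onI continuous_on_Pair)
        then have "(\<lambda>y. U (y, t) powr R) \<in> borel_measurable lborel" by measurable
        then show "(\<lambda>y. ennreal (indicator (cball x0 \<rho>') y * U (y, t) powr R)) \<in> borel_measurable lborel"
          by (intro measurable_compose[OF _ measurable_ennreal] borel_measurable_times borel_measurable_indicator) auto
      qed
      also have "\<dots> \<le> time_kernel k (s - t) * ennreal c"
      proof (cases "\<bar>s - t\<bar> \<le> d")
        case True
        then show ?thesis using mt by (intro mult_left_mono) auto
      next
        case False
        then show ?thesis using time_kernel_off[OF k(1)] by simp
      qed
      finally show "(\<integral>\<^sup>+y. ennreal (U (y, t) powr R) * (\<integral>\<^sup>+x. indicator (cball x0 \<rho>) x * ennreal (k (x - y, s - t)) \<partial>lborel) \<partial>lborel)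
          \<le> time_kernel k (s - t) * ennreal c" .
    qed
  qed
  also have "\<dots> = ennreal c"
    using time_kernel_integral[OF km k(2,3)] by (subst nn_integral_multc) (auto intro!: measurable_compose[OF _ time_kernel_integral(2)[OF km k(2,3)]])
  finally show ?thesis using c by simp
qed

text \<open>
  An upper bound for the mollification yields one for \<open>U\<close>, tested against \<open>\<theta>\<close>, up to the oscillation
  \<open>\<omega>\<close> of \<open>\<theta>\<close> on the scale of the kernel. Only one inequality is needed, so everything stays in the
  nonnegative integrals and no convergence of mollifications is invoked.
\<close>

lemma mollified_test_lower:
  fixes U :: "'a::euclidean_space \<times> real \<Rightarrow> real" and \<theta> :: "'a \<Rightarrow> real"
  assumes U: "integrable lborel U" "\<And>z. 0 \<le> U z" and k: "k \<in> kernels d" "\<And>z. 0 \<le> k z" "integral\<^sup>L lborel k = 1"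
    and \<theta>: "continuous_on UNIV \<theta>" "\<And>x. 0 \<le> \<theta> x" and \<omega>: "0 \<le> \<omega>" "\<And>x y. norm (x - y) \<le> d \<Longrightarrow> \<theta> y \<le> \<theta> x + \<omega>"
    and mass: "AE t in lborel. \<bar>s - t\<bar> \<le> d \<longrightarrow> ennreal I \<le> (\<integral>\<^sup>+y. ennreal (U (y, t) * \<theta> y) \<partial>lborel)
         \<and> (\<integral>\<^sup>+y. ennreal (U (y, t)) \<partial>lborel) \<le> ennreal c"
    and B: "\<And>x. \<theta> x \<noteq> 0 \<Longrightarrow> convolve U k (x, s) \<le> B" "0 \<le> B"
  shows "ennreal I \<le> ennreal B * (\<integral>\<^sup>+x. ennreal (\<theta> x) \<partial>lborel) + ennreal (\<omega> * c)"
proof -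
  have Um: "U \<in> borel_measurable borel" using borel_measurable_integrable[OF U(1)] by simp
  have km: "k \<in> borel_measurable borel" by (rule kernels_measurable[OF k(1)])
  have km'[measurable]: "k \<in> borel_measurable (borel \<Otimes>\<^sub>M borel)" using km by (simp add: borel_prod)
  have \<theta>m[measurable]: "\<theta> \<in> borel_measurable borel" by (rule borel_measurable_continuous_onI[OF \<theta>(1)])
  have Us[measurable]: "(\<lambda>y. U (y, t)) \<in> borel_measurable borel" for t
    using measurable_compose[OF _ Um, of "\<lambda>y. (y, t)" borel] by (simp add: borel_measurable_continuous_onI continuous_on_Pair)
  have tk: "(\<lambda>t. time_kernel k (s - t)) \<in> borel_measurable borel"
    by (rule measurable_compose[OF _ time_kernel_integral(2)[OF km k(2,3)]]) auto
  have v0: "0 \<le> convolve U k z" for z unfolding convolve_def by (intro Bochner_Integration.integral_nonneg mult_nonneg_nonneg U k)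
  define X where "X t = (\<integral>\<^sup>+y. ennreal (U (y, t)) * (\<integral>\<^sup>+x. ennreal (\<theta> x) * ennreal (k (x - y, s - t)) \<partial>lborel) \<partial>lborel)" for t
  have Xm: "X \<in> borel_measurable borel"
  proof -
    have [measurable]: "U \<in> borel_measurable (borel \<Otimes>\<^sub>M borel)" using Um by (simp add: borel_prod)
    show ?thesis unfolding X_def by measurable
  qed
  have X: "integral\<^sup>N lborel X \<le> ennreal B * (\<integral>\<^sup>+x. ennreal (\<theta> x) \<partial>lborel)"
  proof -
    have "integral\<^sup>N lborel X = (\<integral>\<^sup>+x. ennreal (\<theta> x) * (\<integral>\<^sup>+z. ennreal (U z) * ennreal (k ((x, s) - z)) \<partial>lborel) \<partial>lborel)"
      unfolding X_def using Um km by (intro mollify_Tonelli[symmetric]) auto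
    also have "\<dots> \<le> (\<integral>\<^sup>+x. ennreal B * ennreal (\<theta> x) \<partial>lborel)"
    proof (rule nn_integral_mono)
      fix x
      have "(\<integral>\<^sup>+z. ennreal (U z) * ennreal (k ((x, s) - z)) \<partial>lborel) = ennreal (convolve U k (x, s))"
        unfolding convolve_def using convolve_kernel_integrable[OF U(1) k(1)] U k
        by (subst nn_integral_eq_integral[symmetric]) (auto simp: ennreal_mult)
      then show "ennreal (\<theta> x) * (\<integral>\<^sup>+z. ennreal (U z) * ennreal (k ((x, s) - z)) \<partial>lborel) \<le> ennreal B * ennreal (\<theta> x)"
        using mult_left_mono[OF ennreal_leI[OF B(1)[of x]], of "ennreal (\<theta> x)"]
        by (cases "\<theta> x = 0") (auto simp: mult.commute)
    qed
    also have "\<dots> = ennreal B * (\<integral>\<^sup>+x. ennreal (\<theta> x) \<partial>lborel)" by (intro nn_integral_cmult) measurable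
    finally show ?thesis .
  qed
  have "ennreal I = (\<integral>\<^sup>+t. time_kernel k (s - t) * ennreal I \<partial>lborel)"
    using time_kernel_integral(1)[OF km k(2,3)] tk by (subst nn_integral_multc) auto
  also have "\<dots> \<le> (\<integral>\<^sup>+t. X t + time_kernel k (s - t) * ennreal (\<omega> * c) \<partial>lborel)"
  proof (rule nn_integral_mono_AE)
    show "AE t in lborel. time_kernel k (s - t) * ennreal I \<le> X t + time_kernel k (s - t) * ennreal (\<omega> * c)"
      using mass
    proof eventually_elim
      fix t assume mt: "\<bar>s - t\<bar> \<le> d \<longrightarrow> ennreal I \<le> (\<integral>\<^sup>+y. ennreal (U (y, t) * \<theta> y) \<partial>lborel) \<and> (\<integral>\<^sup>+y. ennreal (U (y, t)) \<partial>lborel) \<le> ennreal c"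
      show "time_kernel k (s - t) * ennreal I \<le> X t + time_kernel k (s - t) * ennreal (\<omega> * c)"
      proof (cases "\<bar>s - t\<bar> \<le> d")
        case False
        then show ?thesis using time_kernel_off[OF k(1)] by simp
      next
        case True
        have inner: "ennreal (\<theta> y) * time_kernel k (s - t) \<le> (\<integral>\<^sup>+x. ennreal (\<theta> x) * ennreal (k (x - y, s - t)) \<partial>lborel) + ennreal \<omega> * time_kernel k (s - t)" for y
        proof -
          have "ennreal (\<theta> y) * time_kernel k (s - t) = (\<integral>\<^sup>+x. ennreal (\<theta> y) * ennreal (k (x - y, s - t)) \<partial>lborel)"
            unfolding time_kernel_integral(3)[OF km k(2,3), of y, symmetric] by (intro nn_integral_cmult[symmetric]) measurable
          also have "\<dots> \<le> (\<integral>\<^sup>+x. ennreal (\<theta> x) * ennreal (k (x - y, s - t)) + ennreal \<omega> * ennreal (k (x - y, s - t)) \<partial>lborel)"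
          proof (rule nn_integral_mono)
            fix x
            show "ennreal (\<theta> y) * ennreal (k (x - y, s - t)) \<le> ennreal (\<theta> x) * ennreal (k (x - y, s - t)) + ennreal \<omega> * ennreal (k (x - y, s - t))"
            proof (cases "norm (x - y) \<le> d")
              case True
              have "ennreal (\<theta> y) \<le> ennreal (\<theta> x) + ennreal \<omega>"
                using \<omega>(2)[OF True] \<theta>(2) \<omega>(1) by (simp add: ennreal_plus[symmetric] del: ennreal_plus)
              then have "ennreal (\<theta> y) * ennreal (k (x - y, s - t)) \<le> (ennreal (\<theta> x) + ennreal \<omega>) * ennreal (k (x - y, s - t))"
                by (intro mult_right_mono) auto
              then show ?thesis by (simp add: distrib_right)
            next
              case False
              then have "d < norm (x - y, s - t)" using norm_fst_le[of "x - y" "s - t"] by linarith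
              then have "k (x - y, s - t) = 0" using k(1) unfolding kernels_def by blast
              then show ?thesis by simp
            qed
          qed
          also have "\<dots> = (\<integral>\<^sup>+x. ennreal (\<theta> x) * ennreal (k (x - y, s - t)) \<partial>lborel) + (\<integral>\<^sup>+x. ennreal \<omega> * ennreal (k (x - y, s - t)) \<partial>lborel)"
            by (intro nn_integral_add) measurable
          also have "(\<integral>\<^sup>+x. ennreal \<omega> * ennreal (k (x - y, s - t)) \<partial>lborel) = ennreal \<omega> * time_kernel k (s - t)"
            unfolding time_kernel_integral(3)[OF km k(2,3), of y, symmetric] by (intro nn_integral_cmult) measurable
          finally show ?thesis .
        qed
        have "time_kernel k (s - t) * ennreal I \<le> time_kernel k (s - t) * (\<integral>\<^sup>+y. ennreal (U (y, t) * \<theta> y) \<partial>lborel)"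
          using mt True by (intro mult_left_mono) auto
        also have "\<dots> = (\<integral>\<^sup>+y. ennreal (U (y, t)) * (ennreal (\<theta> y) * time_kernel k (s - t)) \<partial>lborel)"
          by (subst nn_integral_cmult[symmetric]) (auto simp: ennreal_mult U \<theta> mult_ac)
        also have "\<dots> \<le> (\<integral>\<^sup>+y. ennreal (U (y, t)) * (\<integral>\<^sup>+x. ennreal (\<theta> x) * ennreal (k (x - y, s - t)) \<partial>lborel)
            + ennreal \<omega> * time_kernel k (s - t) * ennreal (U (y, t)) \<partial>lborel)"
        proof (rule nn_integral_mono)
          fix y
          show "ennreal (U (y, t)) * (ennreal (\<theta> y) * time_kernel k (s - t)) \<le>
              ennreal (U (y, t)) * (\<integral>\<^sup>+x. ennreal (\<theta> x) * ennreal (k (x - y, s - t)) \<partial>lborel)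
              + ennreal \<omega> * time_kernel k (s - t) * ennreal (U (y, t))"
            using mult_left_mono[OF inner[of y], of "ennreal (U (y, t))"] by (simp add: distrib_left mult_ac)
        qed
        also have "\<dots> = X t + ennreal \<omega> * time_kernel k (s - t) * (\<integral>\<^sup>+y. ennreal (U (y, t)) \<partial>lborel)"
          unfolding X_def by (subst nn_integral_add) (auto simp: nn_integral_cmult)
        also have "\<dots> \<le> X t + ennreal \<omega> * time_kernel k (s - t) * ennreal c"
          using mt True by (intro add_left_mono mult_left_mono) auto
        also have "\<dots> = X t + time_kernel k (s - t) * ennreal (\<omega> * c)"
          using \<omega> by (cases "0 \<le> c") (auto simp: ennreal_mult mult_ac ennreal_neg mult_nonneg_nonpos)
        finally show ?thesis .
      qed
    qed
  qed
  also have "\<dots> = integral\<^sup>N lborel X + ennreal (\<omega> * c)"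
    using time_kernel_integral(1)[OF km k(2,3)] tk Xm by (simp add: nn_integral_add nn_integral_multc)
  also have "\<dots> \<le> ennreal B * (\<integral>\<^sup>+x. ennreal (\<theta> x) \<partial>lborel) + ennreal (\<omega> * c)"
    by (intro add_right_mono X)
  finally show ?thesis .
qed

text \<open>
  If \<open>f > D\<close> held on a set of positive measure, it would hold on a compact subset of positive measure,
  whose indicator is a decreasing limit of admissible test functions.
\<close>

lemma AE_le_from_test_functions:
  fixes f :: "'a::euclidean_space \<Rightarrow> real"
  assumes f: "integrable (lebesgue_on A) f" and A: "A \<in> sets lebesgue" and B: "ball x0 \<rho> \<subseteq> A"
    and test: "\<And>\<theta> C. continuous_on UNIV \<theta> \<Longrightarrow> (\<And>x. 0 \<le> \<theta> x) \<Longrightarrow> compact C \<Longrightarrow> C \<subseteq> ball x0 \<rho> \<Longrightarrow> (\<And>x. x \<notin> C \<Longrightarrow> \<theta> x = 0)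
        \<Longrightarrow> (LINT x|lebesgue_on A. f x * \<theta> x) \<le> D * (LINT x|lborel. \<theta> x)"
  shows "AE x in lebesgue_on (ball x0 \<rho>). f x \<le> D"
proof -
  define F where "F x = indicator A x * f x" for x
  have F: "integrable lebesgue F" using f A by (subst (asm) integrable_restrict_space) (auto simp: F_def[abs_def])
  have Fm: "F \<in> borel_measurable lebesgue" using F by auto
  define S where "S = {x \<in> ball x0 \<rho>. D < F x}"
  have Bs: "ball x0 \<rho> \<in> sets lebesgue" by (auto intro: sets_completionI_sets)
  have Ss: "S \<in> sets lebesgue"
  proof -
    have "{x \<in> space lebesgue. D < F x} \<in> sets lebesgue" using Fm by measurable
    then have "ball x0 \<rho> \<inter> {x \<in> space lebesgue. D < F x} \<in> sets lebesgue" using Bs by blast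
    also have "ball x0 \<rho> \<inter> {x \<in> space lebesgue. D < F x} = S" by (auto simp: S_def)
    finally show ?thesis .
  qed
  have "emeasure lebesgue S = 0"
  proof (rule ccontr)
    assume nz: "emeasure lebesgue S \<noteq> 0"
    have fin: "emeasure lebesgue S < \<infinity>"
    proof -
      have "emeasure lebesgue S \<le> emeasure lebesgue (ball x0 \<rho>)" using Bs by (intro emeasure_mono) (auto simp: S_def)
      also have "\<dots> < \<infinity>" using emeasure_bounded_finite[OF bounded_ball, of x0 \<rho>] by simp
      finally show ?thesis .
    qed
    define e where "e = measure lebesgue S"
    have Se: "emeasure lebesgue S = ennreal e" using fin by (simp add: e_def emeasure_eq_ennreal_measure top.not_eq_extremum)
    have e: "e > 0" using nz Se by (metis e_def ennreal_0 less_eq_real_def measure_nonneg)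
    obtain T where T: "closed T" "T \<subseteq> S" "S - T \<in> lmeasurable" "emeasure lebesgue (S - T) < ennreal e"
      using sets_lebesgue_inner_closed[OF Ss e] by blast
    have Ts: "T \<in> sets lebesgue" using T(1) by (auto intro: sets_completionI_sets)
    have Tnz: "emeasure lebesgue T \<noteq> 0"
    proof
      assume "emeasure lebesgue T = 0"
      then have "emeasure lebesgue (S - T) = emeasure lebesgue S"
        using Ss Ts by (intro emeasure_Diff_null_set) auto
      then show False using T(4) Se by simp
    qed
    have TB: "T \<subseteq> ball x0 \<rho>" using T(2) by (auto simp: S_def)
    have Tc: "compact T" using T(1) TB bounded_subset[OF bounded_ball TB] by (simp add: compact_eq_bounded_closed)
    have Tne: "T \<noteq> {}" using Tnz by auto
    obtain r where r: "r > 0" "(\<Union>x\<in>T. cball x r) \<subseteq> ball x0 \<rho>"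
      using compact_subset_open_imp_cball_epsilon_subset[OF Tc open_ball TB] by blast
    define C where "C = {x. infdist x T \<le> r}"
    have Cc: "compact C" unfolding C_def by (rule compact_infdist_le[OF Tne Tc r(1)])
    have CB: "C \<subseteq> ball x0 \<rho>"
    proof
      fix x assume "x \<in> C"
      moreover obtain y where "y \<in> T" "infdist x T = dist x y" using infdist_attains_inf[OF T(1) Tne, of x] by blast
      ultimately have "x \<in> cball y r" "y \<in> T" by (auto simp: C_def dist_commute)
      then show "x \<in> ball x0 \<rho>" using r(2) by blast
    qed
    \<comment> \<open>The summand \<open>1 / r\<close> keeps all supports in \<open>C\<close>.\<close>
    define \<theta> where "\<theta> n x = max 0 (1 - (1 / r + real n) * infdist x T)" for n x
    have \<theta>c: "continuous_on UNIV (\<theta> n)" for n unfolding \<theta>_def by (intro continuous_intros)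
    have \<theta>0: "0 \<le> \<theta> n x" "\<theta> n x \<le> 1" for n x using r(1) by (auto simp: \<theta>_def infdist_nonneg)
    have \<theta>z: "\<theta> n x = 0" if "x \<notin> C" for n x
    proof -
      have i: "infdist x T > r" using that by (simp add: C_def)
      have "1 = (1 / r) * r" using r by simp
      also have "\<dots> \<le> (1 / r + real n) * infdist x T" using i r by (intro mult_mono) auto
      finally show ?thesis by (simp add: \<theta>_def)
    qed
    have \<theta>lim: "(\<lambda>n. \<theta> n x) \<longlonglongrightarrow> indicator T x" for x
    proof (cases "x \<in> T")
      case True
      then show ?thesis by (simp add: \<theta>_def)
    next
      case False
      then have i: "infdist x T > 0" using T(1) Tne by (metis in_closed_iff_infdist_zero infdist_nonneg less_eq_real_def)
      obtain N :: nat where N: "1 / infdist x T < real N" using reals_Archimedean2 by blast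
      have "eventually (\<lambda>n. \<theta> n x = 0) sequentially"
      proof (rule eventually_sequentiallyI[of N])
        fix n assume "n \<ge> N"
        then have "1 / infdist x T \<le> real n" using N by simp
        then have "1 \<le> real n * infdist x T" using i by (simp add: divide_le_eq)
        also have "\<dots> \<le> (1 / r + real n) * infdist x T" using r i by (intro mult_right_mono) auto
        finally show "\<theta> n x = 0" by (simp add: \<theta>_def)
      qed
      then show ?thesis using False by (simp add: tendsto_eventually)
    qed
    have \<theta>m: "\<theta> n \<in> borel_measurable lebesgue" for n
      using borel_measurable_continuous_onI[OF \<theta>c[of n]] by (intro measurable_completion) simp
    have le: "(LINT x|lebesgue. F x * \<theta> n x) \<le> D * (LINT x|lebesgue. \<theta> n x)" for n
    proof -
      have "(LINT x|lebesgue. F x * \<theta> n x) = (LINT x|lebesgue_on A. f x * \<theta> n x)"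
        using A by (subst integral_restrict_space) (auto simp: F_def mult.assoc)
      also have "\<dots> \<le> D * (LINT x|lborel. \<theta> n x)" by (rule test[OF \<theta>c \<theta>0(1) Cc CB \<theta>z])
      also have "(LINT x|lborel. \<theta> n x) = (LINT x|lebesgue. \<theta> n x)"
        using borel_measurable_continuous_onI[OF \<theta>c[of n]] by (intro integral_completion[symmetric]) simp
      finally show ?thesis .
    qed
    have Cl: "C \<in> sets lebesgue" using Cc by (auto intro!: sets_completionI_sets borel_closed compact_imp_closed)
    have Cf: "emeasure lebesgue C < \<infinity>" using emeasure_bounded_finite[OF compact_imp_bounded[OF Cc]] Cc
      by (simp add: borel_closed compact_imp_closed)
    have l1: "(\<lambda>n. LINT x|lebesgue. F x * \<theta> n x) \<longlonglongrightarrow> (LINT x|lebesgue. F x * indicator T x)"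
    proof (rule integral_dominated_convergence[where w = "\<lambda>x. \<bar>F x\<bar>"])
      show "AE x in lebesgue. (\<lambda>n. F x * \<theta> n x) \<longlonglongrightarrow> F x * indicator T x"
        using \<theta>lim by (intro AE_I2 tendsto_mult_left)
      show "AE x in lebesgue. norm (F x * \<theta> n x) \<le> \<bar>F x\<bar>" for n
        using \<theta>0 by (intro AE_I2) (auto simp: abs_mult mult_left_le)
    qed (use F Fm \<theta>m Ts in auto)
    have l2: "(\<lambda>n. LINT x|lebesgue. \<theta> n x) \<longlonglongrightarrow> (LINT x|lebesgue. indicator T x)"
    proof (rule integral_dominated_convergence[where w = "indicator C"])
      show "AE x in lebesgue. (\<lambda>n. \<theta> n x) \<longlonglongrightarrow> indicator T x" using \<theta>lim by (intro AE_I2)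
      show "AE x in lebesgue. norm (\<theta> n x) \<le> indicator C x" for n
        using \<theta>0 \<theta>z by (intro AE_I2) (auto simp: indicator_def)
      show "integrable lebesgue (indicator C :: 'a \<Rightarrow> real)" using Cl Cf by (intro integrable_real_indicator) auto
    qed (use \<theta>m Ts in auto)
    have "(LINT x|lebesgue. F x * indicator T x) \<le> D * (LINT x|lebesgue. indicator T x)"
      by (rule LIMSEQ_le[OF l1 tendsto_mult_left[OF l2]]) (use le in auto)
    moreover have Ti: "integrable lebesgue (indicator T :: 'a \<Rightarrow> real)"
      using fin emeasure_mono[OF T(2) Ss] Ts by (intro integrable_real_indicator) (auto intro: le_less_trans)
    moreover have FTi: "integrable lebesgue (\<lambda>x. F x * indicator T x)"
      using integrable_mult_indicator[OF Ts F] by (simp add: mult.commute)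
    ultimately have "(LINT x|lebesgue. F x * indicator T x - D * indicator T x) \<le> 0" by simp
    moreover have pos: "0 \<le> F x * indicator T x - D * indicator T x" for x
      using T(2) by (auto simp: S_def indicator_def)
    ultimately have "(LINT x|lebesgue. F x * indicator T x - D * indicator T x) = 0"
      by (intro antisym Bochner_Integration.integral_nonneg) auto
    then have "AE x in lebesgue. F x * indicator T x - D * indicator T x = 0"
      using FTi Ti pos by (subst (asm) integral_nonneg_eq_0_iff_AE) auto
    then have "AE x in lebesgue. x \<notin> T"
      by (rule AE_mp) (use T(2) in \<open>auto simp: S_def indicator_def intro!: AE_I2\<close>)
    then have "emeasure lebesgue T = 0" using Ts by (subst (asm) AE_iff_measurable[OF _ refl]) auto
    then show False using Tnz by simp
  qed
  then have "S \<in> null_sets lebesgue" using Ss by auto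
  then have "AE x in lebesgue. x \<notin> S" by (rule AE_not_in)
  then have "AE x in lebesgue. x \<in> ball x0 \<rho> \<longrightarrow> f x \<le> D"
  proof eventually_elim
    fix x assume x: "x \<notin> S"
    show "x \<in> ball x0 \<rho> \<longrightarrow> f x \<le> D"
    proof
      assume "x \<in> ball x0 \<rho>"
      moreover from this have "x \<in> A" using B by blast
      ultimately show "f x \<le> D" using x by (simp add: S_def F_def not_less)
    qed
  qed
  then show ?thesis using Bs by (subst AE_restrict_space_iff) auto
qed

section \<open>Initial traces\<close>

text \<open>
  All information on the initial data passes through this property. A lower integral with respect to the Borel measure
  serves for functions that are only Lebesgue measurable. Nonnegativity and integrability are
  conditions on the time \<open>t\<close>, because they may be known for almost every time only.
\<close>

definition initial_bound ::
    "real \<Rightarrow> 'a::euclidean_space set \<Rightarrow> ereal \<Rightarrow> 'a \<Rightarrow> real \<Rightarrow> ('a \<times> real \<Rightarrow> real) \<Rightarrow> real \<Rightarrow> bool" where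
  "initial_bound R \<Omega> T x0 \<rho> u m \<longleftrightarrow> (\<forall>\<delta>>0. \<exists>\<sigma>0>0. \<forall>t. 0 < t \<and> t < \<sigma>0 \<and> ereal t < T \<and>
      (AE x in lebesgue_on \<Omega>. 0 \<le> u (x, t)) \<and> (\<lambda>x. u (x, t)) \<in> Lp_loc R \<Omega> \<longrightarrow>
      (\<integral>\<^sup>+y. ennreal (indicator (cball x0 \<rho>) y * \<bar>u (y, t)\<bar> powr R) \<partial>lborel) \<le> ennreal ((m + \<delta>) powr R))"

lemma nn_integral_lborel_lebesgue_on:
  fixes h :: "'a::euclidean_space \<Rightarrow> real"
  assumes "integrable (lebesgue_on K) h" "\<And>x. 0 \<le> h x" and K: "K \<in> sets lebesgue"
  shows "(\<integral>\<^sup>+y. ennreal (indicator K y * h y) \<partial>lborel) = ennreal (integral\<^sup>L (lebesgue_on K) h)"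
proof -
  have "(\<integral>\<^sup>+y. ennreal (indicator K y * h y) \<partial>lborel) = (\<integral>\<^sup>+y. ennreal (indicator K y * h y) \<partial>lebesgue)"
    by (simp add: nn_integral_completion)
  also have "\<dots> = ennreal (LINT y|lebesgue. indicator K y * h y)"
    using assms by (intro nn_integral_eq_integral) (auto simp: integrable_restrict_space)
  also have "(LINT y|lebesgue. indicator K y * h y) = integral\<^sup>L (lebesgue_on K) h"
    using K by (subst integral_restrict_space) auto
  finally show ?thesis .
qed

text \<open>
  Minkowski's inequality, in the form of \<open>powr_add_weighted\<close> with weights \<open>m + \<delta> / 2\<close> and \<open>\<delta> / 2\<close>.
\<close>

lemma initial_bound_continuous:
  fixes u :: "'a::euclidean_space \<times> real \<Rightarrow> real"
  assumes R: "1 \<le> R" and u0: "u0 \<in> Lp_loc R \<Omega>" and T: "0 < T" and \<Omega>: "open \<Omega>"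
    and cont: "continuous_into_Lp_loc {t. 0 \<le> t \<and> ereal t < T} R \<Omega> u"
    and eq: "AE x in lebesgue_on \<Omega>. u (x, 0) = u0 x" and rho: "\<rho> < \<eta>" "cball x0 \<eta> \<subseteq> \<Omega>"
  shows "initial_bound R \<Omega> T x0 \<rho> u (Lp_norm R (ball x0 \<eta>) u0)"
  unfolding initial_bound_def
proof (intro allI impI)
  fix \<delta> :: real assume \<delta>: "\<delta> > 0"
  define m where "m = Lp_norm R (ball x0 \<eta>) u0"
  define K where "K = cball x0 \<rho>"
  have K: "compact K" "K \<subseteq> \<Omega>" "K \<subseteq> ball x0 \<eta>" using rho by (auto simp: K_def)
  have Ks: "K \<in> sets lebesgue" using K by (auto intro!: sets_completionI_sets borel_closed compact_imp_closed)
  have m0: "0 \<le> m" by (simp add: m_def Lp_norm_def)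
  have I0: "(0::real) \<in> {t. 0 \<le> t \<and> ereal t < T}" using T by (simp add: zero_ereal_def)
  have lim: "((\<lambda>t. Lp_norm R K (\<lambda>x. u (x, t) - u (x, 0))) \<longlongrightarrow> 0) (at 0 within {t. 0 \<le> t \<and> ereal t < T})"
    using cont K(1,2) I0 unfolding continuous_into_Lp_loc_def by blast
  have "eventually (\<lambda>t. Lp_norm R K (\<lambda>x. u (x, t) - u (x, 0)) < \<delta> / 2) (at 0 within {t. 0 \<le> t \<and> ereal t < T})"
    using order_tendstoD(2)[OF lim, of "\<delta> / 2"] \<delta> by simp
  then obtain s0 where s0: "s0 > 0" "\<And>t. 0 \<le> t \<Longrightarrow> ereal t < T \<Longrightarrow> t \<noteq> 0 \<Longrightarrow> \<bar>t\<bar> < s0 \<Longrightarrow>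
      Lp_norm R K (\<lambda>x. u (x, t) - u (x, 0)) < \<delta> / 2"
    unfolding eventually_at by (auto simp: dist_real_def)
  have Lp: "(\<lambda>x. u (x, t)) \<in> borel_measurable (lebesgue_on K)" "integrable (lebesgue_on K) (\<lambda>x. \<bar>u (x, t)\<bar> powr R)"
    if "0 \<le> t" "ereal t < T" for t
    using cont K(1,2) that unfolding continuous_into_Lp_loc_def Lp_loc_def by auto
  have i0: "(LINT x|lebesgue_on K. \<bar>u (x, 0)\<bar> powr R) \<le> m powr R"
  proof -
    have cb: "integrable (lebesgue_on (cball x0 \<eta>)) (\<lambda>x. \<bar>u0 x\<bar> powr R)"
      using u0 rho(2) by (auto simp: Lp_loc_def)
    have bs: "ball x0 \<eta> \<in> sets lebesgue" "cball x0 \<eta> \<in> sets lebesgue" by (auto intro: sets_completionI_sets)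
    have bi: "integrable lebesgue (\<lambda>x. indicator (cball x0 \<eta>) x *\<^sub>R \<bar>u0 x\<bar> powr R)"
      using cb bs by (subst (asm) integrable_restrict_space) auto
    have sub: "integrable (lebesgue_on S) (\<lambda>x. \<bar>u0 x\<bar> powr R)" if "S \<in> sets lebesgue" "S \<subseteq> cball x0 \<eta>" for S
    proof -
      have "integrable lebesgue (\<lambda>x. indicator S x *\<^sub>R (indicator (cball x0 \<eta>) x *\<^sub>R \<bar>u0 x\<bar> powr R))"
        by (rule integrable_mult_indicator[OF that(1) bi])
      also have "(\<lambda>x. indicator S x *\<^sub>R (indicator (cball x0 \<eta>) x *\<^sub>R \<bar>u0 x\<bar> powr R)) = (\<lambda>x. indicator S x *\<^sub>R \<bar>u0 x\<bar> powr R)"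
        using that(2) by (auto simp: fun_eq_iff indicator_def)
      finally show ?thesis using that(1) by (subst integrable_restrict_space) auto
    qed
    have "AE x in lebesgue. x \<in> \<Omega> \<longrightarrow> u (x, 0) = u0 x"
      using eq \<Omega> by (subst (asm) AE_restrict_space_iff) (auto intro: sets_completionI_sets)
    then have ae: "AE x in lebesgue. indicator K x * \<bar>u (x, 0)\<bar> powr R = indicator K x * \<bar>u0 x\<bar> powr R"
      by (rule AE_mp) (use K(2) in \<open>auto simp: indicator_def intro!: AE_I2\<close>)
    have iK: "integrable lebesgue (\<lambda>x. indicator K x * \<bar>u0 x\<bar> powr R)"
    proof -
      have "K \<subseteq> cball x0 \<eta>" using K(3) ball_subset_cball by blast
      from sub[OF Ks this] show ?thesis using Ks by (subst (asm) integrable_restrict_space) auto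
    qed
    have iK': "integrable lebesgue (\<lambda>x. indicator K x * \<bar>u (x, 0)\<bar> powr R)"
    proof -
      have "integrable (lebesgue_on K) (\<lambda>x. \<bar>u (x, 0)\<bar> powr R)" using Lp(2)[of 0] I0 by simp
      then show ?thesis using Ks by (subst (asm) integrable_restrict_space) auto
    qed
    have ib: "integrable lebesgue (\<lambda>x. indicator (ball x0 \<eta>) x * \<bar>u0 x\<bar> powr R)"
      using sub[OF bs(1) ball_subset_cball] bs(1) by (subst (asm) integrable_restrict_space) auto
    have "(LINT x|lebesgue_on K. \<bar>u (x, 0)\<bar> powr R) = (LINT x|lebesgue. indicator K x * \<bar>u (x, 0)\<bar> powr R)"
      using Ks by (subst integral_restrict_space) auto
    also have "\<dots> = (LINT x|lebesgue. indicator K x * \<bar>u0 x\<bar> powr R)"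
      using iK iK' ae by (intro integral_cong_AE) auto
    also have "\<dots> \<le> (LINT x|lebesgue. indicator (ball x0 \<eta>) x * \<bar>u0 x\<bar> powr R)"
      using K(3) by (intro integral_mono iK ib) (auto simp: indicator_def)
    also have "\<dots> = (LINT x|lebesgue_on (ball x0 \<eta>). \<bar>u0 x\<bar> powr R)"
      using bs(1) by (subst integral_restrict_space) auto
    also have "\<dots> = m powr R"
    proof -
      have "0 \<le> (LINT x|lebesgue_on (ball x0 \<eta>). \<bar>u0 x\<bar> powr R)" by (intro Bochner_Integration.integral_nonneg) auto
      then show ?thesis using R by (simp add: m_def Lp_norm_def powr_powr)
    qed
    finally show ?thesis .
  qed
  show "\<exists>\<sigma>0>0. \<forall>t. 0 < t \<and> t < \<sigma>0 \<and> ereal t < T \<and>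
      (AE x in lebesgue_on \<Omega>. 0 \<le> u (x, t)) \<and> (\<lambda>x. u (x, t)) \<in> Lp_loc R \<Omega> \<longrightarrow>
      (\<integral>\<^sup>+y. ennreal (indicator (cball x0 \<rho>) y * \<bar>u (y, t)\<bar> powr R) \<partial>lborel) \<le> ennreal ((Lp_norm R (ball x0 \<eta>) u0 + \<delta>) powr R)"
  proof (intro exI[of _ s0] conjI s0(1) allI impI, elim conjE)
    fix t assume t: "0 < t" "t < s0" "ereal t < T"
    \<comment> \<open>The increment \<open>\<delta> / 2\<close> keeps \<open>\<alpha>\<close> positive also when \<open>m = 0\<close>.\<close>
    define \<alpha> \<beta> where "\<alpha> = m + \<delta> / 2" and "\<beta> = \<delta> / 2"
    have ab: "\<alpha> > 0" "\<beta> > 0" "\<alpha> + \<beta> = m + \<delta>" "m \<le> \<alpha>" using m0 \<delta> by (auto simp: \<alpha>_def \<beta>_def)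
    define b where "b x = \<bar>u (x, t) - u (x, 0)\<bar>" for x
    have bm: "b \<in> borel_measurable (lebesgue_on K)" using Lp(1)[of t] Lp(1)[of 0] t I0 unfolding b_def by auto
    have bi: "integrable (lebesgue_on K) (\<lambda>x. b x powr R)"
    proof (rule Bochner_Integration.integrable_bound[of _ "\<lambda>x. 2 powr R * (\<bar>u (x, t)\<bar> powr R + \<bar>u (x, 0)\<bar> powr R)"])
      show "integrable (lebesgue_on K) (\<lambda>x. 2 powr R * (\<bar>u (x, t)\<bar> powr R + \<bar>u (x, 0)\<bar> powr R))"
        using Lp(2)[of t] Lp(2)[of 0] t I0 by auto
      have "b x powr R \<le> 2 powr R * (\<bar>u (x, t)\<bar> powr R + \<bar>u (x, 0)\<bar> powr R)" for x
      proof -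
        have "b x powr R \<le> (\<bar>u (x, t)\<bar> + \<bar>u (x, 0)\<bar>) powr R" using R by (intro powr_mono2) (auto simp: b_def)
        also have "\<dots> \<le> 2 powr R * (\<bar>u (x, t)\<bar> powr R + \<bar>u (x, 0)\<bar> powr R)" using R by (intro powr_add_le) auto
        finally show ?thesis .
      qed
      then show "AE x in lebesgue_on K. norm (b x powr R) \<le> norm (2 powr R * (\<bar>u (x, t)\<bar> powr R + \<bar>u (x, 0)\<bar> powr R))"
        by (intro AE_I2) simp
    qed (use bm in measurable)
    have bI: "(LINT x|lebesgue_on K. b x powr R) \<le> \<beta> powr R"
    proof -
      have p: "0 \<le> (LINT x|lebesgue_on K. b x powr R)" by (intro Bochner_Integration.integral_nonneg) auto
      have "(LINT x|lebesgue_on K. b x powr R) powr (1 / R) < \<beta>"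
        using s0(2)[of t] t by (simp add: Lp_norm_def b_def \<beta>_def)
      then have "((LINT x|lebesgue_on K. b x powr R) powr (1 / R)) powr R \<le> \<beta> powr R"
        using R by (intro powr_mono2) auto
      then show ?thesis using p R by (simp add: powr_powr)
    qed
    define h where "h x = (\<alpha> + \<beta>) powr (R - 1) * (\<alpha> powr (1 - R) * \<bar>u (x, 0)\<bar> powr R + \<beta> powr (1 - R) * b x powr R)" for x
    have hi: "integrable (lebesgue_on K) h" unfolding h_def using Lp(2)[of 0] I0 bi by auto
    have "(\<integral>\<^sup>+y. ennreal (indicator K y * \<bar>u (y, t)\<bar> powr R) \<partial>lborel) \<le> (\<integral>\<^sup>+y. ennreal (indicator K y * h y) \<partial>lborel)"
    proof (intro nn_integral_mono ennreal_leI mult_left_mono)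
      fix y
      have "\<bar>u (y, t)\<bar> powr R \<le> (\<bar>u (y, 0)\<bar> + b y) powr R" using R by (intro powr_mono2) (auto simp: b_def)
      also have "\<dots> \<le> h y" unfolding h_def using R ab by (intro powr_add_weighted) (auto simp: b_def)
      finally show "\<bar>u (y, t)\<bar> powr R \<le> h y" .
    qed auto
    also have "\<dots> = ennreal (integral\<^sup>L (lebesgue_on K) h)"
      by (rule nn_integral_lborel_lebesgue_on[OF hi _ Ks]) (auto simp: h_def)
    also have "integral\<^sup>L (lebesgue_on K) h = (\<alpha> + \<beta>) powr (R - 1) *
        (\<alpha> powr (1 - R) * (LINT x|lebesgue_on K. \<bar>u (x, 0)\<bar> powr R) + \<beta> powr (1 - R) * (LINT x|lebesgue_on K. b x powr R))"
      unfolding h_def using Lp(2)[of 0] I0 bi by simp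
    also have "\<dots> \<le> (\<alpha> + \<beta>) powr (R - 1) * (\<alpha> powr (1 - R) * \<alpha> powr R + \<beta> powr (1 - R) * \<beta> powr R)"
    proof (intro mult_left_mono add_mono)
      have "m powr R \<le> \<alpha> powr R" using m0 ab R by (intro powr_mono2) auto
      then show "(LINT x|lebesgue_on K. \<bar>u (x, 0)\<bar> powr R) \<le> \<alpha> powr R" using i0 by linarith
    qed (use bI in auto)
    also have "\<dots> = (m + \<delta>) powr R"
      using ab powr_add[of "\<alpha> + \<beta>" "R - 1" 1] by (simp add: powr_add[symmetric])
    finally show "(\<integral>\<^sup>+y. ennreal (indicator (cball x0 \<rho>) y * \<bar>u (y, t)\<bar> powr R) \<partial>lborel) \<le> ennreal ((Lp_norm R (ball x0 \<eta>) u0 + \<delta>) powr R)"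
      by (simp add: K_def m_def ennreal_leI)
  qed
qed

text \<open>
  The trace is tested against a continuous function that equals \<open>1\<close> on the smaller ball and vanishes
  outside the larger one.
\<close>

lemma initial_bound_measure:
  fixes u :: "'a::euclidean_space \<times> real \<Rightarrow> real"
  assumes \<mu>: "radon_measure_on \<Omega> \<mu>" and tr: "has_initial_trace \<Omega> u \<mu>" and \<Omega>: "open \<Omega>"
    and rho: "0 < \<rho>" "\<rho> < \<eta>" "cball x0 \<eta> \<subseteq> \<Omega>"
  shows "initial_bound 1 \<Omega> T x0 \<rho> u (measure \<mu> (ball x0 \<eta>))"
  unfolding initial_bound_def
proof (intro allI impI)
  fix \<delta> :: real assume \<delta>: "\<delta> > 0"
  define m where "m = measure \<mu> (ball x0 \<eta>)"
  define K where "K = cball x0 \<rho>"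
  define \<psi> where "\<psi> y = max 0 (min 1 ((\<eta> - norm (y - x0)) / (\<eta> - \<rho>)))" for y
  have \<psi>c: "continuous_on UNIV \<psi>" unfolding \<psi>_def using rho by (intro continuous_intros) auto
  have \<psi>01: "0 \<le> \<psi> y" "\<psi> y \<le> 1" for y by (auto simp: \<psi>_def)
  have \<psi>K: "\<psi> y = 1" if "y \<in> K" for y
    using that rho by (simp add: \<psi>_def K_def dist_norm norm_minus_commute)
  have \<psi>0: "\<psi> y = 0" if "y \<notin> ball x0 \<eta>" for y
  proof -
    have "\<eta> - norm (y - x0) \<le> 0" using that by (simp add: dist_norm norm_minus_commute)
    then have "(\<eta> - norm (y - x0)) / (\<eta> - \<rho>) \<le> 0" using rho by (simp add: divide_le_0_iff)
    then show ?thesis by (simp add: \<psi>_def)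
  qed
  have \<psi>Cc: "\<psi> \<in> Cc \<Omega>"
    unfolding Cc_def supported_in_def using \<psi>c rho \<psi>0 by (auto intro!: exI[of _ "cball x0 \<eta>"])
  have lim: "((\<lambda>t. LINT x|lebesgue_on \<Omega>. u (x, t) * \<psi> x) \<longlongrightarrow> (LINT x|\<mu>. \<psi> x)) (at_right 0)"
    using tr \<psi>Cc unfolding has_initial_trace_def by blast
  have \<mu>s: "sets \<mu> = sets (restrict_space borel \<Omega>)" using \<mu> by (simp add: radon_measure_on_def)
  have sets: "S \<in> sets \<mu>" if "S \<in> sets borel" "S \<subseteq> \<Omega>" for S
    unfolding \<mu>s using that \<Omega> by (subst sets_restrict_space_iff) auto
  have fin: "emeasure \<mu> (ball x0 \<eta>) < \<infinity>"
  proof -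
    have "emeasure \<mu> (ball x0 \<eta>) \<le> emeasure \<mu> (cball x0 \<eta>)"
      using rho(3) by (intro emeasure_mono sets) auto
    also have "\<dots> < \<infinity>" using \<mu> rho(3) by (auto simp: radon_measure_on_def)
    finally show ?thesis .
  qed
  have bs: "ball x0 \<eta> \<in> sets \<mu>" using rho(3) by (intro sets) auto
  have \<psi>m: "\<psi> \<in> borel_measurable \<mu>"
  proof -
    have "\<psi> \<in> borel_measurable (restrict_space borel \<Omega>)"
      using borel_measurable_continuous_onI[OF \<psi>c] by (rule measurable_restrict_space1)
    then show ?thesis by (subst measurable_cong_sets[OF \<mu>s refl])
  qed
  have le: "(LINT x|\<mu>. \<psi> x) \<le> m"
  proof -
    have ii: "integrable \<mu> (indicator (ball x0 \<eta>) :: 'a \<Rightarrow> real)" using bs fin by (intro integrable_real_indicator) auto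
    have pt: "\<psi> x \<le> indicator (ball x0 \<eta>) x" for x using \<psi>01 \<psi>0 by (auto simp: indicator_def)
    have "integrable \<mu> \<psi>"
      by (rule Bochner_Integration.integrable_bound[OF ii \<psi>m]) (use pt \<psi>01 in auto)
    then have "(LINT x|\<mu>. \<psi> x) \<le> (LINT x|\<mu>. indicator (ball x0 \<eta>) x)" using ii pt by (intro integral_mono) auto
    also have "\<dots> = m" using bs by (simp add: m_def sets.sets_into_space Int_absorb2)
    finally show ?thesis .
  qed
  have "eventually (\<lambda>t. (LINT x|lebesgue_on \<Omega>. u (x, t) * \<psi> x) < m + \<delta>) (at_right 0)"
    using order_tendstoD(2)[OF lim, of "m + \<delta>"] le \<delta> by simp
  then obtain s0 where s0: "s0 > 0" "\<And>t. 0 < t \<Longrightarrow> t < s0 \<Longrightarrow> (LINT x|lebesgue_on \<Omega>. u (x, t) * \<psi> x) < m + \<delta>"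
    unfolding eventually_at_right_field by auto
  show "\<exists>\<sigma>0>0. \<forall>t. 0 < t \<and> t < \<sigma>0 \<and> ereal t < T \<and>
      (AE x in lebesgue_on \<Omega>. 0 \<le> u (x, t)) \<and> (\<lambda>x. u (x, t)) \<in> Lp_loc 1 \<Omega> \<longrightarrow>
      (\<integral>\<^sup>+y. ennreal (indicator (cball x0 \<rho>) y * \<bar>u (y, t)\<bar> powr 1) \<partial>lborel) \<le> ennreal ((measure \<mu> (ball x0 \<eta>) + \<delta>) powr 1)"
  proof (intro exI[of _ s0] conjI s0(1) allI impI, elim conjE)
    fix t assume t: "0 < t" "t < s0" and nn: "AE x in lebesgue_on \<Omega>. 0 \<le> u (x, t)" and L: "(\<lambda>x. u (x, t)) \<in> Lp_loc 1 \<Omega>"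
    have \<Omega>s: "\<Omega> \<in> sets lebesgue" using \<Omega> by (auto intro: sets_completionI_sets)
    have cs: "cball x0 \<eta> \<in> sets lebesgue" by (auto intro: sets_completionI_sets)
    have "integrable (lebesgue_on (cball x0 \<eta>)) (\<lambda>x. u (x, t))"
    proof -
      have "(\<lambda>x. u (x, t)) \<in> borel_measurable (lebesgue_on (cball x0 \<eta>))" "integrable (lebesgue_on (cball x0 \<eta>)) (\<lambda>x. \<bar>u (x, t)\<bar> powr 1)"
        using L rho(3) unfolding Lp_loc_def by auto
      then show ?thesis by (simp add: integrable_abs_iff)
    qed
    then have ui: "integrable lebesgue (\<lambda>x. indicator (cball x0 \<eta>) x *\<^sub>R u (x, t))"
      using cs by (subst (asm) integrable_restrict_space) auto
    have \<psi>ml: "\<psi> \<in> borel_measurable lebesgue"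
      using borel_measurable_continuous_onI[OF \<psi>c] by (intro measurable_completion) simp
    have "integrable lebesgue (\<lambda>x. indicator (cball x0 \<eta>) x *\<^sub>R u (x, t) * \<psi> x)"
    proof (rule Bochner_Integration.integrable_bound[OF ui])
      show "(\<lambda>x. indicator (cball x0 \<eta>) x *\<^sub>R u (x, t) * \<psi> x) \<in> borel_measurable lebesgue"
        using borel_measurable_times[OF borel_measurable_integrable[OF ui] \<psi>ml] by simp
      show "AE x in lebesgue. norm (indicator (cball x0 \<eta>) x *\<^sub>R u (x, t) * \<psi> x) \<le> norm (indicator (cball x0 \<eta>) x *\<^sub>R u (x, t))"
        using \<psi>01 by (intro AE_I2) (auto simp: abs_mult mult_left_le)
    qed
    also have "(\<lambda>x. indicator (cball x0 \<eta>) x *\<^sub>R u (x, t) * \<psi> x) = (\<lambda>x. indicator \<Omega> x * (u (x, t) * \<psi> x))"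
    proof
      fix x
      show "indicator (cball x0 \<eta>) x *\<^sub>R u (x, t) * \<psi> x = indicator \<Omega> x * (u (x, t) * \<psi> x)"
      proof (cases "x \<in> ball x0 \<eta>")
        case True
        then have "x \<in> \<Omega>" "x \<in> cball x0 \<eta>" using rho(3) ball_subset_cball by blast+
        then show ?thesis by simp
      qed (simp add: \<psi>0)
    qed
    finally have gi: "integrable lebesgue (\<lambda>x. indicator \<Omega> x * (u (x, t) * \<psi> x))" .
    have nn': "AE x in lebesgue. x \<in> \<Omega> \<longrightarrow> 0 \<le> u (x, t)" using nn \<Omega>s by (subst (asm) AE_restrict_space_iff) auto
    have Kin: "K \<subseteq> \<Omega>" "K \<subseteq> ball x0 \<eta>" using rho by (auto simp: K_def)
    have "(\<integral>\<^sup>+y. ennreal (indicator K y * \<bar>u (y, t)\<bar> powr 1) \<partial>lborel) = (\<integral>\<^sup>+y. ennreal (indicator K y * \<bar>u (y, t)\<bar> powr 1) \<partial>lebesgue)"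
      by (simp only: nn_integral_completion)
    also have "\<dots> \<le> (\<integral>\<^sup>+y. ennreal (indicator \<Omega> y * (u (y, t) * \<psi> y)) \<partial>lebesgue)"
    proof (rule nn_integral_mono_AE)
      show "AE y in lebesgue. ennreal (indicator K y * \<bar>u (y, t)\<bar> powr 1) \<le> ennreal (indicator \<Omega> y * (u (y, t) * \<psi> y))"
        using nn'
      proof eventually_elim
        fix y assume "y \<in> \<Omega> \<longrightarrow> 0 \<le> u (y, t)"
        then show "ennreal (indicator K y * \<bar>u (y, t)\<bar> powr 1) \<le> ennreal (indicator \<Omega> y * (u (y, t) * \<psi> y))"
          using Kin \<psi>K[of y] by (cases "y \<in> K") (auto simp: indicator_def)
      qed
    qed
    also have "\<dots> = ennreal (LINT y|lebesgue. indicator \<Omega> y * (u (y, t) * \<psi> y))"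
      by (rule nn_integral_eq_integral[OF gi AE_mp[OF nn' AE_I2]]) (auto simp: indicator_def \<psi>01)
    also have "(LINT y|lebesgue. indicator \<Omega> y * (u (y, t) * \<psi> y)) = (LINT x|lebesgue_on \<Omega>. u (x, t) * \<psi> x)"
      using \<Omega>s by (subst integral_restrict_space) auto
    also have "ennreal \<dots> \<le> ennreal (m + \<delta>)" using s0(2)[OF t] by (intro ennreal_leI) simp
    finally show "(\<integral>\<^sup>+y. ennreal (indicator (cball x0 \<rho>) y * \<bar>u (y, t)\<bar> powr 1) \<partial>lborel) \<le> ennreal ((measure \<mu> (ball x0 \<eta>) + \<delta>) powr 1)"
      using \<delta> by (simp add: K_def m_def add_nonneg_nonneg)
  qed
qed

section \<open>The decay estimate\<close>

lemma classical_solution_subsolution: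
  assumes "classical_solution \<nu> q \<Omega> T u"
  shows "classical_subsolution \<nu> q \<Omega> {t. 0 < t \<and> ereal t < T} u"
  using assms unfolding classical_solution_def classical_subsolution_def cylinder_def by force

lemma continuous_integrable_lebesgue_on:
  fixes f :: "'a::euclidean_space \<Rightarrow> real"
  assumes "compact K" "continuous_on K f"
  shows "integrable (lebesgue_on K) f"
proof -
  have K: "K \<in> sets borel" using assms(1) by (intro borel_closed compact_imp_closed)
  have i: "integrable lborel (\<lambda>x. indicator K x *\<^sub>R f x)" by (rule borel_integrable_compact[OF assms])
  then have "integrable lebesgue (\<lambda>x. indicator K x *\<^sub>R f x)"
    using integrable_completion[of "\<lambda>x. indicator K x *\<^sub>R f x" lborel] by auto
  then show ?thesis using K by (subst integrable_restrict_space) (auto intro: sets_completionI_sets)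
qed

lemma initial_boundE:
  fixes u :: "'a::euclidean_space \<times> real \<Rightarrow> real"
  assumes "initial_bound R \<Omega> T x0 \<rho> u m" "0 < \<delta>"
  obtains s0 where "0 < s0" "\<And>s. 0 < s \<Longrightarrow> s < s0 \<Longrightarrow> ereal s < T \<Longrightarrow> (AE x in lebesgue_on \<Omega>. 0 \<le> u (x, s)) \<Longrightarrow>
      (\<lambda>x. u (x, s)) \<in> Lp_loc R \<Omega> \<Longrightarrow>
      (\<integral>\<^sup>+y. ennreal (indicator (cball x0 \<rho>) y * \<bar>u (y, s)\<bar> powr R) \<partial>lborel) \<le> ennreal ((m + \<delta>) powr R)"
proof -
  from assms(1)[unfolded initial_bound_def, rule_format, OF assms(2)]
  obtain s0 where s0: "0 < s0" "\<forall>s. 0 < s \<and> s < s0 \<and> ereal s < T \<and> (AE x in lebesgue_on \<Omega>. 0 \<le> u (x, s)) \<and>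
      (\<lambda>x. u (x, s)) \<in> Lp_loc R \<Omega> \<longrightarrow>
      (\<integral>\<^sup>+y. ennreal (indicator (cball x0 \<rho>) y * \<bar>u (y, s)\<bar> powr R) \<partial>lborel) \<le> ennreal ((m + \<delta>) powr R)" by (elim exE conjE)
  show thesis by (rule that[OF s0(1) s0(2)[rule_format]]) (intro conjI)
qed

text \<open>
  A classical solution need not be regular down to the initial time, so \<open>subsolution_bound\<close> is applied
  from a time \<open>s > 0\<close>, which then tends to \<open>0\<close>.
\<close>

lemma classical_solution_decay:
  fixes u :: "'a::euclidean_space \<times> real \<Rightarrow> real"
  assumes q: "1 < q" and eta: "0 < \<eta>" and R: "1 \<le> R" and m: "0 \<le> m"
    and C0: "subsolution_constant TYPE('a) q \<eta> \<tau> R C0"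
    and nu: "0 < \<nu>" "\<nu> \<le> 1" and T: "ereal \<tau> < T" and \<Omega>: "open \<Omega>" "ball x0 (2 * \<eta>) \<subseteq> \<Omega>"
    and init: "initial_bound R \<Omega> T x0 (15 * \<eta> / 16) u m" and u: "classical_solution \<nu> q \<Omega> T u"
    and t: "0 < t" "t \<le> \<tau>" and x: "x \<in> ball x0 (\<eta> / 2)" and r: "0 < r" "r \<le> \<eta>"
  shows "u (x, t) \<le> C0 * (r powr (- (real DIM('a) / R)) * (m + t) + r powr (q / (q - 1)) * t powr (1 - q / (q - 1)))"
proof (rule bound_limit_initial_time[OF t(1)])
  fix \<delta> :: real assume \<delta>: "0 < \<delta>"
  let ?J = "{t. 0 < t \<and> ereal t < T}"
  have sub: "classical_subsolution \<nu> q \<Omega> ?J u" by (rule classical_solution_subsolution[OF u])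
  have cb: "cball x0 (15 * \<eta> / 16) \<subseteq> \<Omega>" "cball x0 (7 * \<eta> / 8) \<subseteq> \<Omega>" using \<Omega>(2) eta by (auto simp: subset_iff)
  obtain s0 where s0: "s0 > 0" "\<And>s. 0 < s \<Longrightarrow> s < s0 \<Longrightarrow> ereal s < T \<Longrightarrow> (AE x in lebesgue_on \<Omega>. 0 \<le> u (x, s)) \<Longrightarrow>
      (\<lambda>x. u (x, s)) \<in> Lp_loc R \<Omega> \<Longrightarrow>
      (\<integral>\<^sup>+y. ennreal (indicator (cball x0 (15 * \<eta> / 16)) y * \<bar>u (y, s)\<bar> powr R) \<partial>lborel) \<le> ennreal ((m + \<delta>) powr R)"
    by (rule initial_boundE[OF init \<delta>], rule that, assumption)
  have "u (x, t) \<le> C0 * (r powr (- (real DIM('a) / R)) * (m + \<delta> + (t - s)) + r powr (q / (q - 1)) * (t - s) powr (1 - q / (q - 1)))"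
    if s: "0 < s" "s < s0" "s < t" for s
  proof -
    have tT: "ereal t < T" using t T by (metis ereal_less_eq(3) le_less_trans)
    have sT: "ereal s < T" using s tT by (metis ereal_less_eq(3) le_less_trans less_imp_le)
    have sJ: "s \<in> ?J" using s sT by simp
    have J: "{s..t} \<subseteq> ?J" using s tT by (auto intro: le_less_trans[of _ "ereal t"])
    have pos: "0 \<le> u (y, s)" if "y \<in> \<Omega>" for y using sub that sJ by (auto simp: classical_subsolution_def)
    have uc: "continuous_on A (\<lambda>y. u (y, s))" if "A \<subseteq> \<Omega>" for A
      by (rule subsolution_slice_continuous[OF sub sJ that])
    have Rc: "continuous_on A (\<lambda>y. \<bar>u (y, s)\<bar> powr R)" if "A \<subseteq> \<Omega>" for A
      using R by (intro continuous_on_powr' continuous_intros uc that) auto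
    have Lp: "(\<lambda>x. u (x, s)) \<in> Lp_loc R \<Omega>"
      unfolding Lp_loc_def
      using borel_measurable_integrable[OF continuous_integrable_lebesgue_on[OF _ uc]] continuous_integrable_lebesgue_on[OF _ Rc] by auto
    have ae: "AE x in lebesgue_on \<Omega>. 0 \<le> u (x, s)" using pos by (intro AE_I2) (auto simp: space_restrict_space)
    have "ennreal (LINT y:cball x0 (7 * \<eta> / 8)|lborel. u (y, s) powr R) = ennreal (LINT y:cball x0 (7 * \<eta> / 8)|lborel. \<bar>u (y, s)\<bar> powr R)"
    proof -
      have "(LINT y:cball x0 (7 * \<eta> / 8)|lborel. u (y, s) powr R) = (LINT y:cball x0 (7 * \<eta> / 8)|lborel. \<bar>u (y, s)\<bar> powr R)"
        using pos cb(2) by (intro set_lebesgue_integral_cong) (auto simp: subset_iff)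
      then show ?thesis by simp
    qed
    also have "\<dots> = (\<integral>\<^sup>+y. ennreal (indicator (cball x0 (7 * \<eta> / 8)) y *\<^sub>R \<bar>u (y, s)\<bar> powr R) \<partial>lborel)"
      unfolding set_lebesgue_integral_def
      by (intro nn_integral_eq_integral[symmetric] borel_integrable_compact compact_cball Rc cb(2)) auto
    also have "\<dots> \<le> (\<integral>\<^sup>+y. ennreal (indicator (cball x0 (15 * \<eta> / 16)) y * \<bar>u (y, s)\<bar> powr R) \<partial>lborel)"
      using eta by (intro nn_integral_mono ennreal_leI) (auto simp: indicator_def)
    also have "\<dots> \<le> ennreal ((m + \<delta>) powr R)" by (rule s0(2)[OF s(1,2) sT ae Lp])
    finally have i: "(LINT y:cball x0 (7 * \<eta> / 8)|lborel. u (y, s) powr R) \<le> (m + \<delta>) powr R" by simp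
    show ?thesis
      using subsolution_constantD[OF C0 nu \<Omega>(1) cb(2) J s(3) _ sub r _ i x] s t m \<delta> by simp
  qed
  then show "\<exists>\<sigma>0>0. \<forall>s. 0 < s \<and> s < \<sigma>0 \<and> s < t \<longrightarrow>
      u (x, t) \<le> C0 * (r powr (- (real DIM('a) / R)) * (m + \<delta> + (t - s)) + r powr (q / (q - 1)) * (t - s) powr (1 - q / (q - 1)))"
    using s0(1) by blast
qed

text \<open>
  The bound of \<open>subsolution_bound\<close> for mollifications passes to \<open>u\<close> after integration against a test
  function \<open>\<theta>\<close>. This reaches every time \<open>t\<close>, through the continuity of \<open>u\<close> in \<open>L^1\<close>, although the
  mollification sees \<open>u\<close> at almost every time only.
\<close>

lemma weak_solution_tested_bound:
  fixes u :: "'a::euclidean_space \<times> real \<Rightarrow> real"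
  assumes q: "1 < q" and eta: "0 < \<eta>" and R: "1 \<le> R" and m: "0 \<le> m" and C0pos: "0 < C0"
    and C0: "subsolution_constant TYPE('a) q \<eta> \<tau> R C0"
    and nu: "0 < \<nu>" "\<nu> \<le> 1" and T: "ereal \<tau> < T" and \<Omega>: "open \<Omega>" "ball x0 (2 * \<eta>) \<subseteq> \<Omega>"
    and Lp: "\<And>t. 0 < t \<Longrightarrow> ereal t < T \<Longrightarrow> (\<lambda>x. u (x, t)) \<in> Lp_loc R \<Omega>"
    and \<delta>: "0 < \<delta>" and s0: "\<And>s. 0 < s \<Longrightarrow> s < s0 \<Longrightarrow> ereal s < T \<Longrightarrow> (AE x in lebesgue_on \<Omega>. 0 \<le> u (x, s)) \<Longrightarrow>
      (\<lambda>x. u (x, s)) \<in> Lp_loc R \<Omega> \<Longrightarrow>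
      (\<integral>\<^sup>+y. ennreal (indicator (cball x0 (15 * \<eta> / 16)) y * \<bar>u (y, s)\<bar> powr R) \<partial>lborel) \<le> ennreal ((m + \<delta>) powr R)"
    and u: "weak_solution \<nu> q \<Omega> T u"
    and t: "t \<le> \<tau>" and s: "0 < s" "s < s0" "s < t" and r: "0 < r" "r \<le> \<eta>"
    and \<theta>: "continuous_on UNIV \<theta>" "\<And>x. 0 \<le> \<theta> x" "compact C" "C \<subseteq> ball x0 (\<eta> / 2)" "\<And>x. x \<notin> C \<Longrightarrow> \<theta> x = 0"
  shows "(LINT x|lebesgue_on (cball x0 (15 * \<eta> / 16)). u (x, t) * \<theta> x) \<le>
    C0 * (r powr (- (real DIM('a) / R)) * (m + \<delta> + (t - s)) + r powr (q / (q - 1)) * (t - s) powr (1 - q / (q - 1)))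
      * (LINT x|lborel. \<theta> x)"
proof -
  define A where "A = cball x0 (15 * \<eta> / 16)"
  define B where "B = C0 * (r powr (- (real DIM('a) / R)) * (m + \<delta> + (t - s)) + r powr (q / (q - 1)) * (t - s) powr (1 - q / (q - 1)))"
  define I where "I = (LINT x|lebesgue_on A. u (x, t) * \<theta> x)"
  define \<Theta> where "\<Theta> = (LINT x|lborel. \<theta> x)"
  have B0: "0 \<le> B" unfolding B_def using C0pos m \<delta> s by simp
  have A: "compact A" "A \<subseteq> \<Omega>" using \<Omega>(2) eta by (auto simp: A_def subset_iff)
  have As: "A \<in> sets lebesgue" using A by (auto intro!: sets_completionI_sets borel_closed compact_imp_closed)
  have tT: "ereal t < T" using t T by (metis ereal_less_eq(3) le_less_trans)
  have t0: "0 < t" using s by simp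
  obtain t2 where t2: "t < t2" "ereal t2 < T" using ereal_dense2[OF tT] by auto
  have cont: "continuous_into_Lp_loc {t. 0 < t \<and> ereal t < T} 1 \<Omega> u" using u by (simp add: weak_solution_def)
  have L1: "integrable (lebesgue_on A) (\<lambda>x. u (x, t'))" if "0 < t'" "ereal t' < T" for t'
  proof -
    have "(\<lambda>x. u (x, t')) \<in> borel_measurable (lebesgue_on A)" "integrable (lebesgue_on A) (\<lambda>x. \<bar>u (x, t')\<bar> powr 1)"
      using cont that A unfolding continuous_into_Lp_loc_def Lp_loc_def by auto
    then show ?thesis by (simp add: integrable_abs_iff)
  qed
  have \<theta>i: "integrable lborel \<theta>" by (rule integrable_continuous_compact_support[OF \<theta>(1,3,5)])
  obtain M where M: "\<And>x. \<theta> x \<le> M" "0 \<le> M"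
  proof -
    have "compact (\<theta> ` C)" using \<theta>(1,3) by (intro compact_continuous_image) (auto intro: continuous_on_subset)
    then obtain M where "\<forall>y\<in>\<theta> ` C. norm y \<le> M" using compact_imp_bounded[of "\<theta> ` C"] unfolding bounded_iff by blast
    then have "\<theta> x \<le> max M 0" for x using \<theta>(5)[of x] by (cases "x \<in> C") auto
    then show ?thesis using that[of "max M 0"] by auto
  qed
  have \<theta>L: "integrable (lebesgue_on A) (\<lambda>x. f x * \<theta> x)" if f: "integrable (lebesgue_on A) f" for f
  proof (rule Bochner_Integration.integrable_bound[OF integrable_mult_right[OF f, of M]])
    have "\<theta> \<in> borel_measurable (lebesgue_on A)"
      using borel_measurable_continuous_onI[OF \<theta>(1)] by (intro measurable_restrict_space1 measurable_completion) simp
    then show "(\<lambda>x. f x * \<theta> x) \<in> borel_measurable (lebesgue_on A)" using borel_measurable_integrable[OF f] by measurable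
    show "AE x in lebesgue_on A. norm (f x * \<theta> x) \<le> norm (M * f x)"
    proof (rule AE_I2)
      fix x
      have "\<bar>f x\<bar> * \<theta> x \<le> \<bar>f x\<bar> * M" by (intro mult_left_mono M) auto
      then show "norm (f x * \<theta> x) \<le> norm (M * f x)" using \<theta>(2)[of x] M(2) by (simp add: abs_mult mult.commute)
    qed
  qed
  have upos: "AE t' in lborel. 0 < t' \<and> ereal t' < T \<longrightarrow> (AE x in lebesgue_on \<Omega>. 0 \<le> u (x, t'))"
  proof -
    have cyl: "open (cylinder \<Omega> T)"
    proof -
      have "open {t. 0 < t \<and> ereal t < T}" by (cases T) (auto simp: open_Collect_conj open_Collect_less)
      then show ?thesis unfolding cylinder_def by (intro open_Times \<Omega>(1))
    qed
    have "AE z in lebesgue. z \<in> cylinder \<Omega> T \<longrightarrow> 0 \<le> u z"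
      using u cyl unfolding weak_solution_def by (subst (asm) AE_restrict_space_iff) (auto intro: sets_completionI_sets)
    then have "AE z in lborel. z \<in> cylinder \<Omega> T \<longrightarrow> 0 \<le> u z" by (simp add: AE_completion_iff)
    from lborel_AE_slice[OF this] show ?thesis
    proof eventually_elim
      fix t' assume e: "AE x in lborel. (x, t') \<in> cylinder \<Omega> T \<longrightarrow> 0 \<le> u (x, t')"
      have "AE x in lebesgue_on \<Omega>. 0 \<le> u (x, t')" if "0 < t' \<and> ereal t' < T"
      proof -
        have "AE x in lebesgue. x \<in> \<Omega> \<longrightarrow> 0 \<le> u (x, t')"
          using AE_completion[OF e] by (rule AE_mp) (use that in \<open>auto simp: cylinder_def intro!: AE_I2\<close>)
        then show ?thesis using \<Omega>(1) by (subst AE_restrict_space_iff) (auto intro: sets_completionI_sets)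
      qed
      then show "0 < t' \<and> ereal t' < T \<longrightarrow> (AE x in lebesgue_on \<Omega>. 0 \<le> u (x, t'))" by blast
    qed
  qed
  have s2: "0 < s / 2" using s by simp
  from weak_solution_mollified[OF u \<Omega>(1) A s2 t2(2) q]
  obtain U where U': "integrable lborel U" "\<forall>z. 0 \<le> U z"
    and Uu: "AE t' in lborel. AE x in lborel. U (x, t') = indicator (A \<times> {s / 2..t2}) (x, t') * u (x, t')"
    and moll': "\<forall>k d S J. k \<in> kernels d \<and> (\<forall>z. 0 \<le> k z) \<and> integral\<^sup>L lborel k = 1 \<and> (\<forall>z\<in>S \<times> J. cball z d \<subseteq> A \<times> {s / 2..t2})
        \<longrightarrow> classical_subsolution \<nu> q S J (convolve U k)"
    by (elim exE conjE)
  note U = U'(1) U'(2)[rule_format]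
  have moll: "classical_subsolution \<nu> q S J (convolve U k)"
    if "k \<in> kernels d" "\<And>z. 0 \<le> k z" "integral\<^sup>L lborel k = 1" "\<And>z. z \<in> S \<times> J \<Longrightarrow> cball z d \<subseteq> A \<times> {s / 2..t2}" for k d S J
    by (rule moll'[rule_format, of k d S J]) (intro conjI allI ballI that)
  \<comment> \<open>Between the radius \<open>7 \<eta> / 8\<close> needed by the local bound and the radius \<open>15 \<eta> / 16\<close> where \<open>u\<close> is controlled.\<close>
  define S where "S = ball x0 (29 * \<eta> / 32)"
  define J where "J = {3 * s / 4<..<(t + t2) / 2}"
  have UA: "AE t' in lborel. t' \<in> {s / 2..t2} \<longrightarrow> (AE x in lborel. U (x, t') = indicator A x * \<bar>u (x, t')\<bar>)"
    using Uu
  proof eventually_elim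
    fix t' assume e: "AE x in lborel. U (x, t') = indicator (A \<times> {s / 2..t2}) (x, t') * u (x, t')"
    have "AE x in lborel. U (x, t') = indicator A x * \<bar>u (x, t')\<bar>" if "t' \<in> {s / 2..t2}"
      using e
    proof eventually_elim
      fix x assume "U (x, t') = indicator (A \<times> {s / 2..t2}) (x, t') * u (x, t')"
      then show "U (x, t') = indicator A x * \<bar>u (x, t')\<bar>"
        using U(2)[of "(x, t')"] that by (auto simp: indicator_def split: if_splits)
    qed
    then show "t' \<in> {s / 2..t2} \<longrightarrow> (AE x in lborel. U (x, t') = indicator A x * \<bar>u (x, t')\<bar>)" by blast
  qed
  have "I \<le> B * \<Theta> + \<epsilon>" if \<epsilon>: "0 < \<epsilon>" for \<epsilon>
  proof -
    define c where "c = (LINT x|lebesgue_on A. \<bar>u (x, t)\<bar>) + 1"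
    have c: "c > 0" unfolding c_def by (intro add_nonneg_pos Bochner_Integration.integral_nonneg) auto
    define \<omega> where "\<omega> = \<epsilon> / (2 * c)"
    have \<omega>: "\<omega> > 0" using \<epsilon> c by (simp add: \<omega>_def)
    \<comment> \<open>The error \<open>\<epsilon>\<close> is split evenly between the variation of \<open>u\<close> in time and the oscillation \<open>\<omega>\<close> of \<open>\<theta>\<close>.\<close>
    define e1 where "e1 = min 1 (\<epsilon> / (2 * (M + 1)))"
    have e1: "e1 > 0" "e1 \<le> 1" "M * e1 \<le> \<epsilon> / 2"
    proof -
      show "e1 > 0" "e1 \<le> 1" using \<epsilon> M(2) by (auto simp: e1_def)
      have "M * e1 \<le> (M + 1) * (\<epsilon> / (2 * (M + 1)))" using M(2) \<epsilon> by (intro mult_mono) (auto simp: e1_def)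
      also have "\<dots> = \<epsilon> / 2" using M(2) by (auto simp: divide_simps algebra_simps)
      finally show "M * e1 \<le> \<epsilon> / 2" .
    qed
    have "((\<lambda>t'. Lp_norm 1 A (\<lambda>x. u (x, t') - u (x, t))) \<longlongrightarrow> 0) (at t within {t. 0 < t \<and> ereal t < T})"
      using cont A t0 tT unfolding continuous_into_Lp_loc_def by blast
    from order_tendstoD(2)[OF this e1(1)]
    obtain e2 where e2: "e2 > 0" "\<And>t'. 0 < t' \<Longrightarrow> ereal t' < T \<Longrightarrow> t' \<noteq> t \<Longrightarrow> \<bar>t' - t\<bar> < e2 \<Longrightarrow>
        Lp_norm 1 A (\<lambda>x. u (x, t') - u (x, t)) < e1"
      unfolding eventually_at by (auto simp: dist_real_def)
    have "uniformly_continuous_on (cball x0 \<eta>) \<theta>"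
      using \<theta>(1) by (intro compact_uniformly_continuous) (auto intro: continuous_on_subset)
    from this[unfolded uniformly_continuous_on_def, rule_format, OF \<omega>]
    obtain e3 where e3: "e3 > 0" "\<And>x y. x \<in> cball x0 \<eta> \<Longrightarrow> y \<in> cball x0 \<eta> \<Longrightarrow> dist x y < e3 \<Longrightarrow> dist (\<theta> x) (\<theta> y) < \<omega>"
      by blast
    \<comment> \<open>The first three entries keep the averages inside the cylinder, the fourth keeps times near \<open>s\<close> below \<open>s0\<close>, and the last two make \<open>u\<close> vary little in time and \<open>\<theta>\<close> in space.\<close>
    define d where "d = Min {s / 4, (t2 - t) / 4, \<eta> / 32, (s0 - s) / 2, e2 / 2, e3 / 2}"
    have d: "0 < d" "d \<le> s / 4" "d \<le> (t2 - t) / 4" "d \<le> \<eta> / 32" "d \<le> (s0 - s) / 2" "d \<le> e2 / 2" "d \<le> e3 / 2"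
    proof -
      show "0 < d" unfolding d_def using s t2 eta e2 e3 by simp
    qed (unfold d_def, (rule Min_le, simp, simp)+)
    obtain k :: "'a \<times> real \<Rightarrow> real" where k0: "k \<in> tensor_smooth" "\<And>z. 0 \<le> k z" "\<And>z. d \<le> norm z \<Longrightarrow> k z = 0" "integral\<^sup>L lborel k = 1"
      using mollifier_exists[OF d(1), where 'b = "'a \<times> real"] by blast
    have k: "k \<in> kernels d" using k0 by (auto simp: kernels_def)
    have inK: "cball z d \<subseteq> A \<times> {s / 2..t2}" if "z \<in> S \<times> J" for z
    proof
      fix y assume "y \<in> cball z d"
      then have "dist (fst z) (fst y) \<le> d" "dist (snd z) (snd y) \<le> d"
        using dist_fst_le[of z y] dist_snd_le[of z y] by auto
      moreover have "dist x0 (fst z) < 29 * \<eta> / 32" "3 * s / 4 < snd z" "snd z < (t + t2) / 2"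
        using that by (auto simp: S_def J_def)
      ultimately have "dist x0 (fst y) \<le> 15 * \<eta> / 16" "s / 2 \<le> snd y" "snd y \<le> t2"
        using d dist_triangle[of x0 "fst y" "fst z"] by (auto simp: dist_real_def)
      then show "y \<in> A \<times> {s / 2..t2}" by (cases y) (auto simp: A_def)
    qed
    have sub: "classical_subsolution \<nu> q S J (convolve U k)" by (rule moll[OF k k0(2,4) inK])
    have mass: "(LINT y:cball x0 (7 * \<eta> / 8)|lborel. convolve U k (y, s) powr R) \<le> (m + \<delta>) powr R"
    proof (rule mollified_mass_bound[OF U k k0(2,4) R, where \<rho>' = "15 * \<eta> / 16"])
      show "7 * \<eta> / 8 + d \<le> 15 * \<eta> / 16" using d by simp
      show "AE t' in lborel. \<bar>s - t'\<bar> \<le> d \<longrightarrow> (\<integral>\<^sup>+y. ennreal (indicator (cball x0 (15 * \<eta> / 16)) y * U (y, t') powr R) \<partial>lborel) \<le> ennreal ((m + \<delta>) powr R)"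
        using upos UA
      proof eventually_elim
        fix t' assume p: "0 < t' \<and> ereal t' < T \<longrightarrow> (AE x in lebesgue_on \<Omega>. 0 \<le> u (x, t'))"
          and a: "t' \<in> {s / 2..t2} \<longrightarrow> (AE x in lborel. U (x, t') = indicator A x * \<bar>u (x, t')\<bar>)"
        have "(\<integral>\<^sup>+y. ennreal (indicator (cball x0 (15 * \<eta> / 16)) y * U (y, t') powr R) \<partial>lborel) \<le> ennreal ((m + \<delta>) powr R)" if "\<bar>s - t'\<bar> \<le> d"
        proof -
          have t': "0 < t'" "t' < s0" "t' \<in> {s / 2..t2}" "t' \<le> t2" using that d s t2 by (auto simp: abs_le_iff)
          then have tT': "ereal t' < T" using t2(2) by (metis ereal_less_eq(3) le_less_trans)
          have ae: "AE y in lborel. U (y, t') = indicator A y * \<bar>u (y, t')\<bar>" using a t'(3) by blast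
          have "(\<integral>\<^sup>+y. ennreal (indicator (cball x0 (15 * \<eta> / 16)) y * U (y, t') powr R) \<partial>lborel)
              = (\<integral>\<^sup>+y. ennreal (indicator (cball x0 (15 * \<eta> / 16)) y * \<bar>u (y, t')\<bar> powr R) \<partial>lborel)"
            using ae by (intro nn_integral_cong_AE, elim AE_mp) (auto simp: A_def indicator_def intro!: AE_I2)
          also have "\<dots> \<le> ennreal ((m + \<delta>) powr R)" using p t'(1) tT' by (intro s0 t' tT' Lp) auto
          finally show ?thesis .
        qed
        then show "\<bar>s - t'\<bar> \<le> d \<longrightarrow> (\<integral>\<^sup>+y. ennreal (indicator (cball x0 (15 * \<eta> / 16)) y * U (y, t') powr R) \<partial>lborel) \<le> ennreal ((m + \<delta>) powr R)" by blast
      qed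
    qed auto
    have vB: "convolve U k (x, t) \<le> B" if "\<theta> x \<noteq> 0" for x
    proof -
      have "x \<in> ball x0 (\<eta> / 2)" using \<theta>(4,5) that by blast
      moreover have "open S" "cball x0 (7 * \<eta> / 8) \<subseteq> S" "{s..t} \<subseteq> J" using eta s t2 by (auto simp: S_def J_def)
      moreover have "t - s \<le> \<tau>" using t s by simp
      ultimately show ?thesis unfolding B_def using subsolution_constantD[OF C0 nu _ _ _ s(3) _ sub r _ mass] m \<delta> by simp
    qed
    have "ennreal (I - \<epsilon> / 2) \<le> ennreal B * (\<integral>\<^sup>+x. ennreal (\<theta> x) \<partial>lborel) + ennreal (\<omega> * c)"
    proof (rule mollified_test_lower[OF U k k0(2,4) \<theta>(1,2) less_imp_le[OF \<omega>] _ _ vB B0])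
      fix x y :: 'a assume xy: "norm (x - y) \<le> d"
      show "\<theta> y \<le> \<theta> x + \<omega>"
      proof (cases "x \<in> cball x0 \<eta> \<and> y \<in> cball x0 \<eta>")
        case True
        have "dist x y < e3" using xy d e3 by (simp add: dist_norm)
        then show ?thesis using e3(2) True by (fastforce simp: dist_real_def)
      next
        case False
        have "y \<notin> ball x0 (\<eta> / 2)"
          using False xy d eta dist_triangle[of x0 x y] by (auto simp: dist_norm norm_minus_commute)
        then have "\<theta> y = 0" using \<theta>(4,5) by blast
        then show ?thesis using \<theta>(2)[of x] \<omega> by simp
      qed
    next
      have "AE t' in lborel. t' \<noteq> t" by (rule AE_lborel_singleton)
      then show "AE t' in lborel. \<bar>t - t'\<bar> \<le> d \<longrightarrow> ennreal (I - \<epsilon> / 2) \<le> (\<integral>\<^sup>+y. ennreal (U (y, t') * \<theta> y) \<partial>lborel)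
         \<and> (\<integral>\<^sup>+y. ennreal (U (y, t')) \<partial>lborel) \<le> ennreal c"
        using UA
      proof eventually_elim
        fix t' assume ne: "t' \<noteq> t" and a: "t' \<in> {s / 2..t2} \<longrightarrow> (AE x in lborel. U (x, t') = indicator A x * \<bar>u (x, t')\<bar>)"
        have "ennreal (I - \<epsilon> / 2) \<le> (\<integral>\<^sup>+y. ennreal (U (y, t') * \<theta> y) \<partial>lborel) \<and> (\<integral>\<^sup>+y. ennreal (U (y, t')) \<partial>lborel) \<le> ennreal c"
          if "\<bar>t - t'\<bar> \<le> d"
        proof
          have t': "0 < t'" "t' \<in> {s / 2..t2}" "t' \<le> t2" "\<bar>t' - t\<bar> < e2" using that d s t2 e2 by (auto simp: abs_le_iff abs_less_iff)
          then have tT': "ereal t' < T" using t2(2) by (metis ereal_less_eq(3) le_less_trans)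
          have ae: "AE y in lborel. U (y, t') = indicator A y * \<bar>u (y, t')\<bar>" using a t'(2) by blast
          note i' = L1[OF t'(1) tT'] and i = L1[OF t0 tT]
          have diff: "(LINT x|lebesgue_on A. \<bar>u (x, t') - u (x, t)\<bar>) \<le> e1"
          proof -
            have "0 \<le> (LINT x|lebesgue_on A. \<bar>u (x, t') - u (x, t)\<bar>)" by (intro Bochner_Integration.integral_nonneg) auto
            then show ?thesis using e2(2)[OF t'(1) tT' ne t'(4)] by (simp add: Lp_norm_def)
          qed
          have "(\<integral>\<^sup>+y. ennreal (U (y, t')) \<partial>lborel) = (\<integral>\<^sup>+y. ennreal (indicator A y * \<bar>u (y, t')\<bar>) \<partial>lborel)"
            using ae by (intro nn_integral_cong_AE, elim AE_mp) (auto intro!: AE_I2)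
          also have "\<dots> = ennreal (LINT x|lebesgue_on A. \<bar>u (x, t')\<bar>)"
            using i' by (intro nn_integral_lborel_lebesgue_on As) auto
          also have "\<dots> \<le> ennreal c"
          proof (rule ennreal_leI)
            have "(LINT x|lebesgue_on A. \<bar>u (x, t')\<bar>) \<le> (LINT x|lebesgue_on A. \<bar>u (x, t)\<bar> + \<bar>u (x, t') - u (x, t)\<bar>)"
              using i i' by (intro integral_mono) auto
            also have "\<dots> = (LINT x|lebesgue_on A. \<bar>u (x, t)\<bar>) + (LINT x|lebesgue_on A. \<bar>u (x, t') - u (x, t)\<bar>)"
              using i i' by simp
            also have "\<dots> \<le> c" using diff e1 by (simp add: c_def)
            finally show "(LINT x|lebesgue_on A. \<bar>u (x, t')\<bar>) \<le> c" .
          qed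
          finally show "(\<integral>\<^sup>+y. ennreal (U (y, t')) \<partial>lborel) \<le> ennreal c" .
          have "I - (LINT x|lebesgue_on A. \<bar>u (x, t')\<bar> * \<theta> x) \<le> (LINT x|lebesgue_on A. M * \<bar>u (x, t') - u (x, t)\<bar>)"
          proof -
            have "I - (LINT x|lebesgue_on A. \<bar>u (x, t')\<bar> * \<theta> x) = (LINT x|lebesgue_on A. u (x, t) * \<theta> x - \<bar>u (x, t')\<bar> * \<theta> x)"
              unfolding I_def using \<theta>L[OF i] \<theta>L[OF integrable_abs[OF i']] by simp
            also have "\<dots> \<le> (LINT x|lebesgue_on A. M * \<bar>u (x, t') - u (x, t)\<bar>)"
            proof (rule integral_mono)
              fix x
              have "u (x, t) * \<theta> x - \<bar>u (x, t')\<bar> * \<theta> x = (u (x, t) - \<bar>u (x, t')\<bar>) * \<theta> x" by (simp add: algebra_simps)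
              also have "\<dots> \<le> \<bar>u (x, t') - u (x, t)\<bar> * \<theta> x" by (intro mult_right_mono \<theta>(2)) auto
              also have "\<dots> \<le> \<bar>u (x, t') - u (x, t)\<bar> * M" by (intro mult_left_mono M) auto
              finally show "u (x, t) * \<theta> x - \<bar>u (x, t')\<bar> * \<theta> x \<le> M * \<bar>u (x, t') - u (x, t)\<bar>" by (simp add: mult.commute)
            qed (use i i' \<theta>L[OF i] \<theta>L[OF integrable_abs[OF i']] in auto)
            finally show ?thesis .
          qed
          also have "\<dots> = M * (LINT x|lebesgue_on A. \<bar>u (x, t') - u (x, t)\<bar>)" by simp
          also have "\<dots> \<le> M * e1" by (intro mult_left_mono diff M)
          finally have le: "I - \<epsilon> / 2 \<le> (LINT x|lebesgue_on A. \<bar>u (x, t')\<bar> * \<theta> x)" using e1 by simp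
          then have "ennreal (I - \<epsilon> / 2) \<le> ennreal (LINT x|lebesgue_on A. \<bar>u (x, t')\<bar> * \<theta> x)" by (rule ennreal_leI)
          also have "\<dots> = (\<integral>\<^sup>+y. ennreal (indicator A y * (\<bar>u (y, t')\<bar> * \<theta> y)) \<partial>lborel)"
            using \<theta>L[OF integrable_abs[OF i']] \<theta>(2) by (intro nn_integral_lborel_lebesgue_on[symmetric] As) auto
          also have "\<dots> = (\<integral>\<^sup>+y. ennreal (U (y, t') * \<theta> y) \<partial>lborel)"
            using ae by (intro nn_integral_cong_AE, elim AE_mp) (auto simp: mult.assoc intro!: AE_I2)
          finally show "ennreal (I - \<epsilon> / 2) \<le> (\<integral>\<^sup>+y. ennreal (U (y, t') * \<theta> y) \<partial>lborel)" .
        qed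
        then show "\<bar>t - t'\<bar> \<le> d \<longrightarrow> ennreal (I - \<epsilon> / 2) \<le> (\<integral>\<^sup>+y. ennreal (U (y, t') * \<theta> y) \<partial>lborel)
         \<and> (\<integral>\<^sup>+y. ennreal (U (y, t')) \<partial>lborel) \<le> ennreal c" by blast
      qed
    qed
    also have "(\<integral>\<^sup>+x. ennreal (\<theta> x) \<partial>lborel) = ennreal \<Theta>"
      unfolding \<Theta>_def using \<theta>i \<theta>(2) by (intro nn_integral_eq_integral) auto
    also have "ennreal B * ennreal \<Theta> + ennreal (\<omega> * c) = ennreal (B * \<Theta> + \<omega> * c)"
    proof -
      have "0 \<le> \<Theta>" unfolding \<Theta>_def by (intro Bochner_Integration.integral_nonneg \<theta>(2))
      then show ?thesis using B0 \<omega> c by (simp add: ennreal_mult ennreal_plus)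
    qed
    finally have "I - \<epsilon> / 2 \<le> B * \<Theta> + \<omega> * c"
    proof (subst (asm) ennreal_le_iff)
      have "0 \<le> \<Theta>" unfolding \<Theta>_def by (intro Bochner_Integration.integral_nonneg \<theta>(2))
      then show "0 \<le> B * \<Theta> + \<omega> * c" using B0 \<omega> c by simp
    qed
    moreover have "\<omega> * c = \<epsilon> / 2" using c by (simp add: \<omega>_def)
    ultimately show ?thesis by simp
  qed
  then have "I \<le> B * \<Theta>" by (rule field_le_epsilon)
  then show ?thesis by (simp add: I_def B_def \<Theta>_def A_def)
qed

text \<open>
  For a weak solution the optimisation over \<open>r\<close> and the limit of initial times are carried out for the
  number \<open>(\<integral> u \<theta>) / (\<integral> \<theta>)\<close>, which avoids exceptional null sets depending on \<open>r\<close> and \<open>s\<close>.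
\<close>

lemma decay_estimate:
  fixes q \<eta> \<epsilon> \<tau> R :: real
  assumes q: "1 < q" and eta: "0 < \<eta>" and eps: "0 < \<epsilon>" and tau: "0 < \<tau>" and R: "1 \<le> R" "q - 1 < R"
  shows "\<exists>C>0. \<forall>\<nu> T (\<Omega> :: 'a::euclidean_space set) x0 u m.
     0 < \<nu> \<and> \<nu> \<le> 1 \<and> ereal \<tau> < T \<and> open \<Omega> \<and> ball x0 (2 * \<eta>) \<subseteq> \<Omega> \<and> 0 \<le> m \<and>
     initial_bound R \<Omega> T x0 (15 * \<eta> / 16) u m \<longrightarrow>
     (classical_solution \<nu> q \<Omega> T u \<longrightarrow>
        (\<forall>t\<in>{0<..\<tau>}. (SUP x\<in>ball x0 (\<eta> / 2). ereal (u (x, t))) \<le> ereal (decay_bound DIM('a) q R \<epsilon> C t m))) \<and>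
     (weak_solution \<nu> q \<Omega> T u \<and> (\<forall>t. 0 < t \<and> ereal t < T \<longrightarrow> (\<lambda>x. u (x, t)) \<in> Lp_loc R \<Omega>) \<longrightarrow>
        (\<forall>t\<in>{0<..\<tau>}. esssup (lebesgue_on (ball x0 (\<eta> / 2))) (\<lambda>x. ereal (u (x, t)))
           \<le> ereal (decay_bound DIM('a) q R \<epsilon> C t m)))"
proof -
  obtain C0 where C0pos: "C0 > 0" and C0: "subsolution_constant TYPE('a) q \<eta> \<tau> R C0"
    using subsolution_bound[OF q eta tau R(1)] by blast
  have N: "0 < real DIM('a)" by simp
  from decay_bound_optimize[OF q R eta eps tau C0pos N]
  obtain C where C: "C > 0" and opt': "\<forall>t m v. 0 < t \<and> t \<le> \<tau> \<and> 0 \<le> m \<and>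
     (\<forall>r. 0 < r \<and> r \<le> \<eta> \<longrightarrow> v \<le> C0 * (r powr (- (real DIM('a) / R)) * (m + t) + r powr (q / (q - 1)) * t powr (1 - q / (q - 1))))
     \<longrightarrow> v \<le> decay_bound DIM('a) q R \<epsilon> C t m"
    by (elim exE conjE)
  have opt: "v \<le> decay_bound DIM('a) q R \<epsilon> C t m"
    if "0 < t" "t \<le> \<tau>" "0 \<le> m"
      "\<And>r. 0 < r \<Longrightarrow> r \<le> \<eta> \<Longrightarrow> v \<le> C0 * (r powr (- (real DIM('a) / R)) * (m + t) + r powr (q / (q - 1)) * t powr (1 - q / (q - 1)))"
    for t m v
    using opt' that by simp
  show ?thesis
  proof (intro exI[of _ C] conjI C allI impI ballI; elim conjE)
    fix \<nu> m t :: real and T :: ereal and x0 :: 'a and \<Omega> :: "'a set" and u :: "'a \<times> real \<Rightarrow> real"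
    assume nu: "0 < \<nu>" "\<nu> \<le> 1" and T: "ereal \<tau> < T" and \<Omega>: "open \<Omega>" "ball x0 (2 * \<eta>) \<subseteq> \<Omega>" and m: "0 \<le> m"
      and init: "initial_bound R \<Omega> T x0 (15 * \<eta> / 16) u m" and "t \<in> {0<..\<tau>}"
    then have t: "0 < t" "t \<le> \<tau>" by auto
    let ?D = "decay_bound DIM('a) q R \<epsilon> C t m"
    {
      assume u: "classical_solution \<nu> q \<Omega> T u"
      show "(SUP x\<in>ball x0 (\<eta> / 2). ereal (u (x, t))) \<le> ereal ?D"
      proof (rule SUP_least)
        fix x assume x: "x \<in> ball x0 (\<eta> / 2)"
        have "u (x, t) \<le> ?D"
          by (rule opt[OF t m classical_solution_decay[OF q eta R(1) m C0 nu T \<Omega> init u t x]])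
        then show "ereal (u (x, t)) \<le> ereal ?D" by simp
      qed
    }
    {
      assume u: "weak_solution \<nu> q \<Omega> T u" and Lp: "\<forall>t. 0 < t \<and> ereal t < T \<longrightarrow> (\<lambda>x. u (x, t)) \<in> Lp_loc R \<Omega>"
      define A where "A = cball x0 (15 * \<eta> / 16)"
      have A: "compact A" "A \<subseteq> \<Omega>" using \<Omega>(2) eta by (auto simp: A_def subset_iff)
      have As: "A \<in> sets lebesgue" using A by (auto intro!: sets_completionI_sets borel_closed compact_imp_closed)
      have bA: "ball x0 (\<eta> / 2) \<subseteq> A" using eta by (auto simp: A_def)
      have tT: "ereal t < T" using t T by (metis ereal_less_eq(3) le_less_trans)
      have f: "integrable (lebesgue_on A) (\<lambda>x. u (x, t))"
      proof -
        have "continuous_into_Lp_loc {t. 0 < t \<and> ereal t < T} 1 \<Omega> u" using u by (simp add: weak_solution_def)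
        then have "(\<lambda>x. u (x, t)) \<in> borel_measurable (lebesgue_on A)" "integrable (lebesgue_on A) (\<lambda>x. \<bar>u (x, t)\<bar> powr 1)"
          using t tT A unfolding continuous_into_Lp_loc_def Lp_loc_def by auto
        then show ?thesis by (simp add: integrable_abs_iff)
      qed
      have "AE x in lebesgue_on (ball x0 (\<eta> / 2)). u (x, t) \<le> ?D"
      proof (rule AE_le_from_test_functions[OF f As bA])
        fix \<theta> :: "'a \<Rightarrow> real" and K
        assume \<theta>: "continuous_on UNIV \<theta>" "\<And>x. 0 \<le> \<theta> x" "compact K" "K \<subseteq> ball x0 (\<eta> / 2)" "\<And>x. x \<notin> K \<Longrightarrow> \<theta> x = 0"
        define I where "I = (LINT x|lebesgue_on A. u (x, t) * \<theta> x)"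
        define \<Theta> where "\<Theta> = (LINT x|lborel. \<theta> x)"
        have \<Theta>0: "0 \<le> \<Theta>" unfolding \<Theta>_def by (intro Bochner_Integration.integral_nonneg \<theta>(2))
        have key: "\<exists>\<sigma>0>0. \<forall>s. 0 < s \<and> s < \<sigma>0 \<and> s < t \<longrightarrow> I \<le> C0 * (r powr (- (real DIM('a) / R)) * (m + \<delta> + (t - s)) + r powr (q / (q - 1)) * (t - s) powr (1 - q / (q - 1))) * \<Theta>"
          if \<delta>: "0 < \<delta>" and r: "0 < r" "r \<le> \<eta>" for \<delta> r
        proof -
          obtain s0 where s0: "s0 > 0" "\<And>s. 0 < s \<Longrightarrow> s < s0 \<Longrightarrow> ereal s < T \<Longrightarrow> (AE x in lebesgue_on \<Omega>. 0 \<le> u (x, s)) \<Longrightarrow>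
              (\<lambda>x. u (x, s)) \<in> Lp_loc R \<Omega> \<Longrightarrow>
              (\<integral>\<^sup>+y. ennreal (indicator (cball x0 (15 * \<eta> / 16)) y * \<bar>u (y, s)\<bar> powr R) \<partial>lborel) \<le> ennreal ((m + \<delta>) powr R)"
            by (rule initial_boundE[OF init \<delta>], rule that, assumption)
          have "I \<le> C0 * (r powr (- (real DIM('a) / R)) * (m + \<delta> + (t - s)) + r powr (q / (q - 1)) * (t - s) powr (1 - q / (q - 1))) * \<Theta>"
            if "0 < s" "s < s0" "s < t" for s
            unfolding I_def \<Theta>_def A_def using Lp
            by (intro weak_solution_tested_bound[OF q eta R(1) m C0pos C0 nu T \<Omega> _ \<delta> s0(2) u t(2) that r \<theta>]) auto
          then show ?thesis using s0(1) by blast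
        qed
        have "I \<le> ?D * \<Theta>"
        proof (cases "\<Theta> = 0")
          case True
          obtain s0 where "s0 > 0" "\<And>s. 0 < s \<Longrightarrow> s < s0 \<Longrightarrow> s < t \<Longrightarrow> I \<le> 0" using key[of 1 \<eta>] eta True by auto
          from this(2)[of "min s0 t / 2"] this(1) show ?thesis using t True by auto
        next
          case False
          then have \<Theta>: "\<Theta> > 0" using \<Theta>0 by simp
          have "I / \<Theta> \<le> ?D"
          proof (rule opt[OF t m], rule bound_limit_initial_time[OF t(1)])
            fix r \<delta> :: real assume "0 < r" "r \<le> \<eta>" "0 < \<delta>"
            from key[OF this(3,1,2)] \<Theta>
            show "\<exists>\<sigma>0>0. \<forall>s. 0 < s \<and> s < \<sigma>0 \<and> s < t \<longrightarrow> I / \<Theta> \<le> C0 * (r powr (- (real DIM('a) / R)) * (m + \<delta> + (t - s)) + r powr (q / (q - 1)) * (t - s) powr (1 - q / (q - 1)))"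
              by (simp add: pos_divide_le_eq)
          qed
          then show ?thesis using \<Theta> by (simp add: pos_divide_le_eq)
        qed
        then show "(LINT x|lebesgue_on A. u (x, t) * \<theta> x) \<le> ?D * (LINT x|lborel. \<theta> x)" by (simp add: I_def \<Theta>_def)
      qed
      then have ae: "AE x in lebesgue_on (ball x0 (\<eta> / 2)). ereal (u (x, t)) \<le> ereal ?D" by simp
      have meas: "(\<lambda>x. u (x, t)) \<in> borel_measurable (lebesgue_on (ball x0 (\<eta> / 2)))"
      proof -
        have "integrable lebesgue (\<lambda>x. indicator A x *\<^sub>R u (x, t))" using f As by (subst (asm) integrable_restrict_space) auto
        then have "(\<lambda>x. indicator A x *\<^sub>R u (x, t)) \<in> borel_measurable (lebesgue_on (ball x0 (\<eta> / 2)))"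
          by (intro measurable_restrict_space1 borel_measurable_integrable)
        then show ?thesis
          using bA by (subst measurable_cong[where g = "\<lambda>x. indicator A x *\<^sub>R u (x, t)"]) (auto simp: space_restrict_space subset_iff)
      qed
      show "esssup (lebesgue_on (ball x0 (\<eta> / 2))) (\<lambda>x. ereal (u (x, t))) \<le> ereal ?D"
        by (rule esssup_I[OF _ ae]) (use meas in measurable)
    }
  qed
qed

theorem theorem1p6:
  fixes q \<eta> \<epsilon> \<tau> :: real
  assumes "1 < q" and "0 < \<eta>" and "0 < \<epsilon>" and "0 < \<tau>"
  shows
    "(\<forall>R. 1 \<le> R \<and> q - 1 < R \<longrightarrow>
       (\<exists>C>0. \<forall>\<nu> T (\<Omega> :: 'a::euclidean_space set) x0 u u0.
          0 < \<nu> \<and> \<nu> \<le> 1 \<and> ereal \<tau> < T \<and>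
          open \<Omega> \<and> connected \<Omega> \<and> ball x0 (2 * \<eta>) \<subseteq> \<Omega> \<and>
          u0 \<in> Lp_loc R \<Omega> \<and> (AE x in lebesgue_on \<Omega>. 0 \<le> u0 x) \<and>
          has_initial_trace \<Omega> u (fun_measure \<Omega> u0) \<and>
          continuous_into_Lp_loc {t. 0 \<le> t \<and> ereal t < T} R \<Omega> u \<and>
          (AE x in lebesgue_on \<Omega>. u (x, 0) = u0 x)
          \<longrightarrow>
          (classical_solution \<nu> q \<Omega> T u \<longrightarrow>
             (\<forall>t\<in>{0<..\<tau>}. (SUP x\<in>ball x0 (\<eta> / 2). ereal (u (x, t)))
                \<le> ereal (decay_bound DIM('a) q R \<epsilon> C t (Lp_norm R (ball x0 \<eta>) u0)))) \<and>
          (q \<le> 2 \<and> weak_solution \<nu> q \<Omega> T u \<longrightarrow>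
             (\<forall>t\<in>{0<..\<tau>}. esssup (lebesgue_on (ball x0 (\<eta> / 2))) (\<lambda>x. ereal (u (x, t)))
                \<le> ereal (decay_bound DIM('a) q R \<epsilon> C t (Lp_norm R (ball x0 \<eta>) u0))))))
     \<and>
     (q < 2 \<longrightarrow>
       (\<exists>C>0. \<forall>\<nu> T (\<Omega> :: 'a::euclidean_space set) x0 u \<mu>.
          0 < \<nu> \<and> \<nu> \<le> 1 \<and> ereal \<tau> < T \<and>
          open \<Omega> \<and> connected \<Omega> \<and> ball x0 (2 * \<eta>) \<subseteq> \<Omega> \<and>
          radon_measure_on \<Omega> \<mu> \<and> has_initial_trace \<Omega> u \<mu>
          \<longrightarrow>
          (classical_solution \<nu> q \<Omega> T u \<longrightarrow>
             (\<forall>t\<in>{0<..\<tau>}. (SUP x\<in>ball x0 (\<eta> / 2). ereal (u (x, t)))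
                \<le> ereal (decay_bound DIM('a) q 1 \<epsilon> C t (measure \<mu> (ball x0 \<eta>))))) \<and>
          (weak_solution \<nu> q \<Omega> T u \<longrightarrow>
             (\<forall>t\<in>{0<..\<tau>}. esssup (lebesgue_on (ball x0 (\<eta> / 2))) (\<lambda>x. ereal (u (x, t)))
                \<le> ereal (decay_bound DIM('a) q 1 \<epsilon> C t (measure \<mu> (ball x0 \<eta>)))))))"
proof (intro conjI allI impI)
  have cball_sub: "cball x0 \<eta> \<subseteq> \<Omega>" if "ball x0 (2 * \<eta>) \<subseteq> \<Omega>" for x0 and \<Omega> :: "'a set"
    using that assms(2) by (auto simp: subset_iff)
  {
    fix R :: real assume "1 \<le> R \<and> q - 1 < R"
    then have R: "1 \<le> R" "q - 1 < R" by auto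
    let ?P = "\<lambda>C \<nu> T (\<Omega>::'a set) x0 u m.
       (classical_solution \<nu> q \<Omega> T u \<longrightarrow>
          (\<forall>t\<in>{0<..\<tau>}. (SUP x\<in>ball x0 (\<eta> / 2). ereal (u (x, t))) \<le> ereal (decay_bound DIM('a) q R \<epsilon> C t m))) \<and>
       (weak_solution \<nu> q \<Omega> T u \<and> (\<forall>t. 0 < t \<and> ereal t < T \<longrightarrow> (\<lambda>x. u (x, t)) \<in> Lp_loc R \<Omega>) \<longrightarrow>
          (\<forall>t\<in>{0<..\<tau>}. esssup (lebesgue_on (ball x0 (\<eta> / 2))) (\<lambda>x. ereal (u (x, t)))
             \<le> ereal (decay_bound DIM('a) q R \<epsilon> C t m)))"
    from decay_estimate[OF assms(1-4) R, where 'a='a]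
    obtain C where C: "C > 0" "\<forall>\<nu> T \<Omega> x0 u m. 0 < \<nu> \<and> \<nu> \<le> 1 \<and> ereal \<tau> < T \<and> open \<Omega> \<and> ball x0 (2 * \<eta>) \<subseteq> \<Omega> \<and> 0 \<le> m \<and>
       initial_bound R \<Omega> T x0 (15 * \<eta> / 16) u m \<longrightarrow> ?P C \<nu> T \<Omega> x0 u m" by (elim exE conjE)
    show "\<exists>C>0. \<forall>\<nu> T (\<Omega> :: 'a::euclidean_space set) x0 u u0.
          0 < \<nu> \<and> \<nu> \<le> 1 \<and> ereal \<tau> < T \<and>
          open \<Omega> \<and> connected \<Omega> \<and> ball x0 (2 * \<eta>) \<subseteq> \<Omega> \<and>
          u0 \<in> Lp_loc R \<Omega> \<and> (AE x in lebesgue_on \<Omega>. 0 \<le> u0 x) \<and>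
          has_initial_trace \<Omega> u (fun_measure \<Omega> u0) \<and>
          continuous_into_Lp_loc {t. 0 \<le> t \<and> ereal t < T} R \<Omega> u \<and>
          (AE x in lebesgue_on \<Omega>. u (x, 0) = u0 x)
          \<longrightarrow>
          (classical_solution \<nu> q \<Omega> T u \<longrightarrow>
             (\<forall>t\<in>{0<..\<tau>}. (SUP x\<in>ball x0 (\<eta> / 2). ereal (u (x, t)))
                \<le> ereal (decay_bound DIM('a) q R \<epsilon> C t (Lp_norm R (ball x0 \<eta>) u0)))) \<and>
          (q \<le> 2 \<and> weak_solution \<nu> q \<Omega> T u \<longrightarrow>
             (\<forall>t\<in>{0<..\<tau>}. esssup (lebesgue_on (ball x0 (\<eta> / 2))) (\<lambda>x. ereal (u (x, t)))
                \<le> ereal (decay_bound DIM('a) q R \<epsilon> C t (Lp_norm R (ball x0 \<eta>) u0))))"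
    proof (intro exI[of _ C] conjI[OF C(1)] allI impI; elim conjE)
      fix \<nu> :: real and T :: ereal and x0 :: 'a and u :: "'a \<times> real \<Rightarrow> real" and u0 and \<Omega> :: "'a set"
      assume nu: "0 < \<nu>" "\<nu> \<le> 1" and T: "ereal \<tau> < T" and \<Omega>: "open \<Omega>" "ball x0 (2 * \<eta>) \<subseteq> \<Omega>"
        and u0: "u0 \<in> Lp_loc R \<Omega>" and cont: "continuous_into_Lp_loc {t. 0 \<le> t \<and> ereal t < T} R \<Omega> u"
        and eq: "AE x in lebesgue_on \<Omega>. u (x, 0) = u0 x"
      let ?m = "Lp_norm R (ball x0 \<eta>) u0"
      have "0 < T" using less_trans[OF _ T, of 0] assms(4) by simp
      then have "initial_bound R \<Omega> T x0 (15 * \<eta> / 16) u ?m"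
        using assms(2) by (intro initial_bound_continuous R u0 \<Omega> cont eq cball_sub) auto
      moreover have "0 \<le> ?m" by (simp add: Lp_norm_def)
      ultimately have P: "?P C \<nu> T \<Omega> x0 u ?m" using nu T \<Omega> by (intro C(2)[rule_format] conjI)
      have Lp: "\<forall>t. 0 < t \<and> ereal t < T \<longrightarrow> (\<lambda>x. u (x, t)) \<in> Lp_loc R \<Omega>"
        using cont by (auto simp: continuous_into_Lp_loc_def)
      show "(classical_solution \<nu> q \<Omega> T u \<longrightarrow>
             (\<forall>t\<in>{0<..\<tau>}. (SUP x\<in>ball x0 (\<eta> / 2). ereal (u (x, t))) \<le> ereal (decay_bound DIM('a) q R \<epsilon> C t ?m))) \<and>
          (q \<le> 2 \<and> weak_solution \<nu> q \<Omega> T u \<longrightarrow>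
             (\<forall>t\<in>{0<..\<tau>}. esssup (lebesgue_on (ball x0 (\<eta> / 2))) (\<lambda>x. ereal (u (x, t)))
                \<le> ereal (decay_bound DIM('a) q R \<epsilon> C t ?m)))"
        using P Lp by blast
    qed
  }
  {
    assume q2: "q < 2"
    let ?P = "\<lambda>C \<nu> T (\<Omega>::'a set) x0 u m.
       (classical_solution \<nu> q \<Omega> T u \<longrightarrow>
          (\<forall>t\<in>{0<..\<tau>}. (SUP x\<in>ball x0 (\<eta> / 2). ereal (u (x, t))) \<le> ereal (decay_bound DIM('a) q 1 \<epsilon> C t m))) \<and>
       (weak_solution \<nu> q \<Omega> T u \<and> (\<forall>t. 0 < t \<and> ereal t < T \<longrightarrow> (\<lambda>x. u (x, t)) \<in> Lp_loc 1 \<Omega>) \<longrightarrow>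
          (\<forall>t\<in>{0<..\<tau>}. esssup (lebesgue_on (ball x0 (\<eta> / 2))) (\<lambda>x. ereal (u (x, t)))
             \<le> ereal (decay_bound DIM('a) q 1 \<epsilon> C t m)))"
    have R: "(1::real) \<le> 1" "q - 1 < 1" using q2 by auto
    from decay_estimate[OF assms(1-4) R, where 'a='a]
    obtain C where C: "C > 0" "\<forall>\<nu> T \<Omega> x0 u m. 0 < \<nu> \<and> \<nu> \<le> 1 \<and> ereal \<tau> < T \<and> open \<Omega> \<and> ball x0 (2 * \<eta>) \<subseteq> \<Omega> \<and> 0 \<le> m \<and>
       initial_bound 1 \<Omega> T x0 (15 * \<eta> / 16) u m \<longrightarrow> ?P C \<nu> T \<Omega> x0 u m" by (elim exE conjE)
    show "\<exists>C>0. \<forall>\<nu> T (\<Omega> :: 'a::euclidean_space set) x0 u \<mu>.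
          0 < \<nu> \<and> \<nu> \<le> 1 \<and> ereal \<tau> < T \<and>
          open \<Omega> \<and> connected \<Omega> \<and> ball x0 (2 * \<eta>) \<subseteq> \<Omega> \<and>
          radon_measure_on \<Omega> \<mu> \<and> has_initial_trace \<Omega> u \<mu>
          \<longrightarrow>
          (classical_solution \<nu> q \<Omega> T u \<longrightarrow>
             (\<forall>t\<in>{0<..\<tau>}. (SUP x\<in>ball x0 (\<eta> / 2). ereal (u (x, t)))
                \<le> ereal (decay_bound DIM('a) q 1 \<epsilon> C t (measure \<mu> (ball x0 \<eta>))))) \<and>
          (weak_solution \<nu> q \<Omega> T u \<longrightarrow>
             (\<forall>t\<in>{0<..\<tau>}. esssup (lebesgue_on (ball x0 (\<eta> / 2))) (\<lambda>x. ereal (u (x, t)))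
                \<le> ereal (decay_bound DIM('a) q 1 \<epsilon> C t (measure \<mu> (ball x0 \<eta>)))))"
    proof (intro exI[of _ C] conjI[OF C(1)] allI impI; elim conjE)
      fix \<nu> :: real and T :: ereal and x0 :: 'a and u :: "'a \<times> real \<Rightarrow> real" and \<mu> :: "'a measure" and \<Omega> :: "'a set"
      assume nu: "0 < \<nu>" "\<nu> \<le> 1" and T: "ereal \<tau> < T" and \<Omega>: "open \<Omega>" "ball x0 (2 * \<eta>) \<subseteq> \<Omega>"
        and \<mu>: "radon_measure_on \<Omega> \<mu>" "has_initial_trace \<Omega> u \<mu>"
      let ?m = "measure \<mu> (ball x0 \<eta>)"
      have "initial_bound 1 \<Omega> T x0 (15 * \<eta> / 16) u ?m"
        using assms(2) by (intro initial_bound_measure \<mu> \<Omega> cball_sub) auto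
      then have P: "?P C \<nu> T \<Omega> x0 u ?m" using nu T \<Omega> by (intro C(2)[rule_format] conjI measure_nonneg)
      have Lp: "\<forall>t. 0 < t \<and> ereal t < T \<longrightarrow> (\<lambda>x. u (x, t)) \<in> Lp_loc 1 \<Omega>" if "weak_solution \<nu> q \<Omega> T u"
        using that by (auto simp: weak_solution_def continuous_into_Lp_loc_def)
      show "(classical_solution \<nu> q \<Omega> T u \<longrightarrow>
             (\<forall>t\<in>{0<..\<tau>}. (SUP x\<in>ball x0 (\<eta> / 2). ereal (u (x, t))) \<le> ereal (decay_bound DIM('a) q 1 \<epsilon> C t ?m))) \<and>
          (weak_solution \<nu> q \<Omega> T u \<longrightarrow>
             (\<forall>t\<in>{0<..\<tau>}. esssup (lebesgue_on (ball x0 (\<eta> / 2))) (\<lambda>x. ereal (u (x, t)))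
                \<le> ereal (decay_bound DIM('a) q 1 \<epsilon> C t ?m)))"
        using P Lp by blast
    qed
  }
qed

end
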